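(* Let $\tau>0$ be the time step. Consider the scheme (ESAV-CN) which, for $n\ge 1$, given $z^{n-1},z^n\in V$ and $e^{n-1},e^n>0$, determines $z^{n+1}\in V$ and $e^{n+1}>0$ by $$\frac{z^{n+1}-z^n}{\tau}=\mathcal{D}\mu^{n+\frac12},\qquad \mu^{n+\frac12}=\mathcal{L}z^{n+\frac12}+B\big(\bar z^{n+\frac12},\bar e^{n+\frac12}\big),$$ $$\ln(e^{n+1})-\ln(e^n)=\Big(B\big(\bar z^{n+\frac12},\bar e^{n+\frac12}\big),\,z^{n+1}-z^n\Big),$$ where $$z^{n+\frac12}=\frac{z^n+z^{n+1}}{2},\quad \bar z^{n+\frac12}=\frac{3z^n-z^{n-1}}{2},\quad \bar e^{n+\frac12}=\frac{3e^n-e^{n-1}}{2},\quad B(z,e)=\frac{\mathcal{N}'(z)\,e}{\exp\big(\mathcal{H}_2(z)\big)}.$$ Then this scheme is a linear (linearly implicit), second-order accurate in time, energy-preserving method for the reformulated system $$z_t=\mathcal{D}\mu,\qquad \mu=\mathcal{L}z+B(z,e),\qquad \frac{d}{dt}\ln(e)=\big(B(z,e),z_t\big),$$ and its discrete energy conservation law is $$\tilde{\mathcal{H}}^{n+1}=\tilde{\mathcal{H}}^n,\qquad \tilde{\mathcal{H}}^n=\frac12\big(z^n,\mathcal{L}z^n\big)+\ln(e^n).$$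
   Context: Setting. $\Omega\subset\mathbb{R}^d$ is a spatial region with periodic boundary conditions, $(\cdot,\cdot)$ is the real $L^2$ inner product on $\Omega$, and $V$ is the space of sufficiently smooth real-valued (possibly vector-valued) periodic functions on $\Omega$. $\mathcal{D}:V\to V$ is a linear skew-adjoint operator, $(\mathcal{D}f,g)=-(f,\mathcal{D}g)$, independent of the solution $z$ and its derivatives. $\mathcal{L}:V\to V$ is a linear, symmetric, non-negative operator: $(\mathcal{L}f,g)=(f,\mathcal{L}g)$ and $(f,\mathcal{L}f)\ge 0$. The Hamiltonian PDE is $$z_t=\mathcal{D}\mu,\qquad \mu=\mathcal{L}z+\mathcal{N}'(z),\qquad \mathcal{H}(z)=\tfrac12(z,\mathcal{L}z)+\mathcal{H}_2(z),\qquad \mathcal{H}_2(z)=(\mathcal{N}(z),1),$$ where $\mathcal{N}(z)$ is a (smooth) energy density and $\mathcal{N}'(z)=\delta\mathcal{H}_2/\delta z$ is the variational derivative of $\mathcal{H}_2$. The exponential scalar auxiliary variable is the scalar function $e(t)=\exp(\mathcal{H}_2(z(\cdot,t)))>0$, which turns the PDE into the equivalent reformulated system given in the claim. Terminology. "Linear" (linearly implicit) means that at each step $z^{n+1}$ is determined by a linear equation whose coefficient operator $I-\frac12\tau\mathcal{D}\mathcal{L}$ does not depend on the solution, after which $e^{n+1}$ is given explicitly. "Second-order" means second-order accuracy in time in the sense of consistency: inserting a sufficiently smooth exact solution $(z(t_n),e(t_n))$, $t_n=n\tau$, of the reformulated system into the scheme (with the last equation divided by $\tau$) leaves a residual of size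 $O(\tau^2)$. "Energy-preserving" means that the stated discrete energy conservation law holds for every solution of the scheme. *)

theory Defs
  imports "HOL-Analysis.Analysis"
begin

text \<open>
  Infinitely differentiable functions on an open set: every iterated directional derivative
  exists and is Frechet differentiable there (hence continuous).
\<close>

definition dir_deriv ::
    "'a::real_normed_vector \<Rightarrow> ('a \<Rightarrow> 'b::real_normed_vector) \<Rightarrow> 'a \<Rightarrow> 'b" where
  "dir_deriv v f = (\<lambda>x. frechet_derivative f (at x) v)"

definition smooth_on ::
    "'a::real_normed_vector set \<Rightarrow> ('a \<Rightarrow> 'b::real_normed_vector) \<Rightarrow> bool" where
  "smooth_on S f \<longleftrightarrow> (\<forall>vs. \<forall>x\<in>S. foldr dir_deriv vs f differentiable (at x))"

text \<open>
  The spatial region is the box with corners \<open>a\<close> and \<open>b\<close>, opposite faces being identified. A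
  function on it is a function on the whole space that has period \<open>b $ i - a $ i\<close> in the
  \<open>i\<close>-th coordinate. The space \<open>V\<close> consists of the infinitely differentiable ones, so that
  differential operators of any order can map \<open>V\<close> to itself.
\<close>

definition V :: "real^'d \<Rightarrow> real^'d \<Rightarrow> (real^'d \<Rightarrow> real^'m) set" where
  "V a b = {f. smooth_on UNIV f \<and> (\<forall>i x. f (x + axis i (b $ i - a $ i)) = f x)}"

definition L2_inner ::
    "real^'d \<Rightarrow> real^'d \<Rightarrow> (real^'d \<Rightarrow> 'c::real_inner) \<Rightarrow> (real^'d \<Rightarrow> 'c) \<Rightarrow> real" where
  "L2_inner a b f g = integral (cbox a b) (\<lambda>x. f x \<bullet> g x)"

definition L2_norm :: "real^'d \<Rightarrow> real^'d \<Rightarrow> (real^'d \<Rightarrow> 'c::real_inner) \<Rightarrow> real" where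
  "L2_norm a b f = sqrt (L2_inner a b f f)"

definition linear_op_on :: "(real^'d \<Rightarrow> real^'m) set \<Rightarrow> ((real^'d \<Rightarrow> real^'m) \<Rightarrow> real^'d \<Rightarrow> real^'m) \<Rightarrow> bool" where
  "linear_op_on W T \<longleftrightarrow>
     (\<forall>f\<in>W. T f \<in> W) \<and>
     (\<forall>f\<in>W. \<forall>g\<in>W. T (\<lambda>x. f x + g x) = (\<lambda>x. T f x + T g x)) \<and>
     (\<forall>f\<in>W. \<forall>r. T (\<lambda>x. r *\<^sub>R f x) = (\<lambda>x. r *\<^sub>R T f x))"

definition skew_adjoint :: "real^'d \<Rightarrow> real^'d \<Rightarrow> ((real^'d \<Rightarrow> real^'m) \<Rightarrow> real^'d \<Rightarrow> real^'m) \<Rightarrow> bool" where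
  "skew_adjoint a b T \<longleftrightarrow>
     (\<forall>f\<in>V a b. \<forall>g\<in>V a b. L2_inner a b (T f) g = - L2_inner a b f (T g))"

definition symmetric_op :: "real^'d \<Rightarrow> real^'d \<Rightarrow> ((real^'d \<Rightarrow> real^'m) \<Rightarrow> real^'d \<Rightarrow> real^'m) \<Rightarrow> bool" where
  "symmetric_op a b T \<longleftrightarrow>
     (\<forall>f\<in>V a b. \<forall>g\<in>V a b. L2_inner a b (T f) g = L2_inner a b f (T g))"

definition nonneg_op :: "real^'d \<Rightarrow> real^'d \<Rightarrow> ((real^'d \<Rightarrow> real^'m) \<Rightarrow> real^'d \<Rightarrow> real^'m) \<Rightarrow> bool" where
  "nonneg_op a b T \<longleftrightarrow> (\<forall>f\<in>V a b. 0 \<le> L2_inner a b f (T f))"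

text \<open>
  A smooth energy density is a smooth function \<open>F\<close> of finitely many quantities, the \<open>j\<close>-th of
  which is a spatial partial derivative of a component of \<open>z\<close>: the component \<open>c j\<close>,
  differentiated once in each coordinate direction listed in \<open>\<alpha> j\<close> (the empty list gives the
  component itself). The type \<open>'k\<close> indexes these quantities.
\<close>

definition partial_deriv :: "'d list \<Rightarrow> (real^'d \<Rightarrow> real) \<Rightarrow> real^'d \<Rightarrow> real" where
  "partial_deriv is f = foldr dir_deriv (map (\<lambda>i. axis i 1) is) f"

definition energy_density ::
    "(real^'k \<Rightarrow> real) \<Rightarrow> ('k \<Rightarrow> 'd list) \<Rightarrow> ('k \<Rightarrow> 'm) \<Rightarrow>
     (real^'d \<Rightarrow> real^'m) \<Rightarrow> real^'d \<Rightarrow> real" where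
  "energy_density F \<alpha> c z x = F (\<chi> j. partial_deriv (\<alpha> j) (\<lambda>y. z y $ c j) x)"

definition H2 ::
    "real^'d \<Rightarrow> real^'d \<Rightarrow> ((real^'d \<Rightarrow> real^'m) \<Rightarrow> real^'d \<Rightarrow> real) \<Rightarrow>
     (real^'d \<Rightarrow> real^'m) \<Rightarrow> real" where
  "H2 a b N z = L2_inner a b (N z) (\<lambda>x. 1)"

definition variational_derivative ::
    "real^'d \<Rightarrow> real^'d \<Rightarrow> ((real^'d \<Rightarrow> real^'m) \<Rightarrow> real) \<Rightarrow> ((real^'d \<Rightarrow> real^'m) \<Rightarrow> real^'d \<Rightarrow> real^'m) \<Rightarrow> bool" where
  "variational_derivative a b H G \<longleftrightarrow>
     (\<forall>z\<in>V a b. G z \<in> V a b \<and>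
       (\<forall>v\<in>V a b. ((\<lambda>\<epsilon>. H (\<lambda>x. z x + \<epsilon> *\<^sub>R v x)) has_real_derivative L2_inner a b (G z) v) (at 0)))"

text \<open>The argument \<open>N'\<close> below stands for the variational derivative of \<open>H2 a b N\<close>.\<close>

definition esav_B ::
    "real^'d \<Rightarrow> real^'d \<Rightarrow> ((real^'d \<Rightarrow> real^'m) \<Rightarrow> real^'d \<Rightarrow> real) \<Rightarrow> ((real^'d \<Rightarrow> real^'m) \<Rightarrow> real^'d \<Rightarrow> real^'m) \<Rightarrow>
     (real^'d \<Rightarrow> real^'m) \<Rightarrow> real \<Rightarrow> real^'d \<Rightarrow> real^'m" where
  "esav_B a b N N' z e = (\<lambda>x. (e / exp (H2 a b N z)) *\<^sub>R N' z x)"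

text \<open>
  The reformulated system on the time interval \<open>[0, T]\<close>. Smoothness up to the end points of the
  interval is expressed by smoothness on an open neighbourhood of it.
\<close>

definition smooth_solution ::
    "real^'d \<Rightarrow> real^'d \<Rightarrow> ((real^'d \<Rightarrow> real^'m) \<Rightarrow> real^'d \<Rightarrow> real^'m) \<Rightarrow> ((real^'d \<Rightarrow> real^'m) \<Rightarrow> real^'d \<Rightarrow> real^'m) \<Rightarrow>
     ((real^'d \<Rightarrow> real^'m) \<Rightarrow> real^'d \<Rightarrow> real) \<Rightarrow> ((real^'d \<Rightarrow> real^'m) \<Rightarrow> real^'d \<Rightarrow> real^'m) \<Rightarrow>
     real \<Rightarrow> (real \<Rightarrow> real^'d \<Rightarrow> real^'m) \<Rightarrow> (real \<Rightarrow> real) \<Rightarrow> bool" where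
  "smooth_solution a b D L N N' T z e \<longleftrightarrow>
     (\<exists>J. open J \<and> {0..T} \<subseteq> J \<and>
        smooth_on (J \<times> UNIV) (\<lambda>(t, x). z t x) \<and> smooth_on J e) \<and>
     (\<forall>t\<in>{0..T}. z t \<in> V a b \<and> 0 < e t \<and>
       (let B = esav_B a b N N' (z t) (e t);
            \<mu> = (\<lambda>x. L (z t) x + B x);
            z\<^sub>t = (\<lambda>x. vector_derivative (\<lambda>s. z s x) (at t within {0..T}))
        in z\<^sub>t = D \<mu> \<and>
           ((\<lambda>s. ln (e s)) has_real_derivative L2_inner a b B z\<^sub>t) (at t within {0..T})))"

text \<open>
  One step of the scheme. The superscripts \<open>n - 1\<close>, \<open>n\<close>, \<open>n + 1\<close> are rendered by the suffixes
  \<open>p\<close>, \<open>c\<close>, \<open>n\<close> (previous, current, next).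
\<close>

definition esav_Bbar ::
    "real^'d \<Rightarrow> real^'d \<Rightarrow> ((real^'d \<Rightarrow> real^'m) \<Rightarrow> real^'d \<Rightarrow> real) \<Rightarrow> ((real^'d \<Rightarrow> real^'m) \<Rightarrow> real^'d \<Rightarrow> real^'m) \<Rightarrow>
     (real^'d \<Rightarrow> real^'m) \<Rightarrow> (real^'d \<Rightarrow> real^'m) \<Rightarrow> real \<Rightarrow> real \<Rightarrow> real^'d \<Rightarrow> real^'m" where
  "esav_Bbar a b N N' zp zc ep ec =
     esav_B a b N N' (\<lambda>x. (1/2) *\<^sub>R (3 *\<^sub>R zc x - zp x)) ((3 * ec - ep) / 2)"

definition esav_mu ::
    "real^'d \<Rightarrow> real^'d \<Rightarrow> ((real^'d \<Rightarrow> real^'m) \<Rightarrow> real^'d \<Rightarrow> real^'m) \<Rightarrow>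
     ((real^'d \<Rightarrow> real^'m) \<Rightarrow> real^'d \<Rightarrow> real) \<Rightarrow> ((real^'d \<Rightarrow> real^'m) \<Rightarrow> real^'d \<Rightarrow> real^'m) \<Rightarrow>
     (real^'d \<Rightarrow> real^'m) \<Rightarrow> (real^'d \<Rightarrow> real^'m) \<Rightarrow> (real^'d \<Rightarrow> real^'m) \<Rightarrow>
     real \<Rightarrow> real \<Rightarrow> real^'d \<Rightarrow> real^'m" where
  "esav_mu a b L N N' zp zc zn ep ec =
     (\<lambda>x. L (\<lambda>y. (1/2) *\<^sub>R (zc y + zn y)) x + esav_Bbar a b N N' zp zc ep ec x)"

definition esav_cn ::
    "real^'d \<Rightarrow> real^'d \<Rightarrow> ((real^'d \<Rightarrow> real^'m) \<Rightarrow> real^'d \<Rightarrow> real^'m) \<Rightarrow> ((real^'d \<Rightarrow> real^'m) \<Rightarrow> real^'d \<Rightarrow> real^'m) \<Rightarrow>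
     ((real^'d \<Rightarrow> real^'m) \<Rightarrow> real^'d \<Rightarrow> real) \<Rightarrow> ((real^'d \<Rightarrow> real^'m) \<Rightarrow> real^'d \<Rightarrow> real^'m) \<Rightarrow> real \<Rightarrow>
     (real^'d \<Rightarrow> real^'m) \<Rightarrow> (real^'d \<Rightarrow> real^'m) \<Rightarrow> (real^'d \<Rightarrow> real^'m) \<Rightarrow>
     real \<Rightarrow> real \<Rightarrow> real \<Rightarrow> bool" where
  "esav_cn a b D L N N' \<tau> zp zc zn ep ec en \<longleftrightarrow>
     zp \<in> V a b \<and> zc \<in> V a b \<and> zn \<in> V a b \<and> 0 < ep \<and> 0 < ec \<and> 0 < en \<and>
     (\<lambda>x. (1/\<tau>) *\<^sub>R (zn x - zc x)) = D (esav_mu a b L N N' zp zc zn ep ec) \<and>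
     ln en - ln ec = L2_inner a b (esav_Bbar a b N N' zp zc ep ec) (\<lambda>x. zn x - zc x)"

text \<open>Residuals of the two equations of a step, the second one divided by \<open>\<tau>\<close>.\<close>

definition residual_z ::
    "real^'d \<Rightarrow> real^'d \<Rightarrow> ((real^'d \<Rightarrow> real^'m) \<Rightarrow> real^'d \<Rightarrow> real^'m) \<Rightarrow> ((real^'d \<Rightarrow> real^'m) \<Rightarrow> real^'d \<Rightarrow> real^'m) \<Rightarrow>
     ((real^'d \<Rightarrow> real^'m) \<Rightarrow> real^'d \<Rightarrow> real) \<Rightarrow> ((real^'d \<Rightarrow> real^'m) \<Rightarrow> real^'d \<Rightarrow> real^'m) \<Rightarrow> real \<Rightarrow>
     (real^'d \<Rightarrow> real^'m) \<Rightarrow> (real^'d \<Rightarrow> real^'m) \<Rightarrow> (real^'d \<Rightarrow> real^'m) \<Rightarrow>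
     real \<Rightarrow> real \<Rightarrow> real^'d \<Rightarrow> real^'m" where
  "residual_z a b D L N N' \<tau> zp zc zn ep ec =
     (\<lambda>x. (1/\<tau>) *\<^sub>R (zn x - zc x) - D (esav_mu a b L N N' zp zc zn ep ec) x)"

definition residual_e ::
    "real^'d \<Rightarrow> real^'d \<Rightarrow>
     ((real^'d \<Rightarrow> real^'m) \<Rightarrow> real^'d \<Rightarrow> real) \<Rightarrow> ((real^'d \<Rightarrow> real^'m) \<Rightarrow> real^'d \<Rightarrow> real^'m) \<Rightarrow> real \<Rightarrow>
     (real^'d \<Rightarrow> real^'m) \<Rightarrow> (real^'d \<Rightarrow> real^'m) \<Rightarrow> (real^'d \<Rightarrow> real^'m) \<Rightarrow>
     real \<Rightarrow> real \<Rightarrow> real \<Rightarrow> real" where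
  "residual_e a b N N' \<tau> zp zc zn ep ec en =
     (ln en - ln ec - L2_inner a b (esav_Bbar a b N N' zp zc ep ec) (\<lambda>x. zn x - zc x)) / \<tau>"

definition modified_energy ::
    "real^'d \<Rightarrow> real^'d \<Rightarrow> ((real^'d \<Rightarrow> real^'m) \<Rightarrow> real^'d \<Rightarrow> real^'m) \<Rightarrow> (real^'d \<Rightarrow> real^'m) \<Rightarrow> real \<Rightarrow> real" where
  "modified_energy a b L z e = 1/2 * L2_inner a b z (L z) + ln e"

definition coeff_op :: "((real^'d \<Rightarrow> real^'m) \<Rightarrow> real^'d \<Rightarrow> real^'m) \<Rightarrow> ((real^'d \<Rightarrow> real^'m) \<Rightarrow> real^'d \<Rightarrow> real^'m) \<Rightarrow> real \<Rightarrow> ((real^'d \<Rightarrow> real^'m) \<Rightarrow> real^'d \<Rightarrow> real^'m)" where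
  "coeff_op D L \<tau> f = (\<lambda>x. f x - (\<tau>/2) *\<^sub>R D (L f) x)"

text \<open>
  Linearly implicit: a step amounts to a linear equation for the new \<open>z\<close> which has at most one
  solution and whose coefficient operator depends on \<open>\<tau>\<close> only, followed by an explicit formula
  for the new \<open>e\<close>. Solvability of the linear equation is not part of the notion: the range of the
  coefficient operator need not be all of \<open>V\<close> under the present assumptions on \<open>D\<close> and \<open>L\<close>.
\<close>

definition linearly_implicit ::
    "real^'d \<Rightarrow> real^'d \<Rightarrow> ((real^'d \<Rightarrow> real^'m) \<Rightarrow> real^'d \<Rightarrow> real^'m) \<Rightarrow> ((real^'d \<Rightarrow> real^'m) \<Rightarrow> real^'d \<Rightarrow> real^'m) \<Rightarrow>
     ((real^'d \<Rightarrow> real^'m) \<Rightarrow> real^'d \<Rightarrow> real) \<Rightarrow> ((real^'d \<Rightarrow> real^'m) \<Rightarrow> real^'d \<Rightarrow> real^'m) \<Rightarrow> bool" where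
  "linearly_implicit a b D L N N' \<longleftrightarrow>
     (\<forall>\<tau>>0. linear_op_on (V a b) (coeff_op D L \<tau>) \<and> inj_on (coeff_op D L \<tau>) (V a b) \<and>
       (\<forall>zp\<in>V a b. \<forall>zc\<in>V a b. \<forall>ep>0. \<forall>ec>0.
         (let B = esav_Bbar a b N N' zp zc ep ec;
              r = (\<lambda>x. zc x + (\<tau>/2) *\<^sub>R D (L zc) x + \<tau> *\<^sub>R D B x)
          in r \<in> V a b \<and>
             (\<forall>zn en. esav_cn a b D L N N' \<tau> zp zc zn ep ec en \<longleftrightarrow>
               zn \<in> V a b \<and> coeff_op D L \<tau> zn = r \<and>
               en = ec * exp (L2_inner a b B (\<lambda>x. zn x - zc x))))))"

text \<open>
  Consistency of second order: the bound is uniform over all steps inside the time interval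
  on which the exact solution is given.
\<close>

definition second_order_consistent ::
    "real^'d \<Rightarrow> real^'d \<Rightarrow> ((real^'d \<Rightarrow> real^'m) \<Rightarrow> real^'d \<Rightarrow> real^'m) \<Rightarrow> ((real^'d \<Rightarrow> real^'m) \<Rightarrow> real^'d \<Rightarrow> real^'m) \<Rightarrow>
     ((real^'d \<Rightarrow> real^'m) \<Rightarrow> real^'d \<Rightarrow> real) \<Rightarrow> ((real^'d \<Rightarrow> real^'m) \<Rightarrow> real^'d \<Rightarrow> real^'m) \<Rightarrow> bool" where
  "second_order_consistent a b D L N N' \<longleftrightarrow>
     (\<forall>T>0. \<forall>z e. smooth_solution a b D L N N' T z e \<longrightarrow>
       (\<exists>C. \<exists>\<tau>\<^sub>0>0. \<forall>\<tau> n. 0 < \<tau> \<and> \<tau> < \<tau>\<^sub>0 \<and> 1 \<le> n \<and> real (n + 1) * \<tau> \<le> T \<longrightarrow>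
         (let t = (\<lambda>k::nat. real k * \<tau>) in
           L2_norm a b (residual_z a b D L N N' \<tau>
             (z (t (n - 1))) (z (t n)) (z (t (n + 1))) (e (t (n - 1))) (e (t n))) \<le> C * \<tau>^2 \<and>
           \<bar>residual_e a b N N' \<tau>
             (z (t (n - 1))) (z (t n)) (z (t (n + 1))) (e (t (n - 1))) (e (t n)) (e (t (n + 1)))\<bar>
               \<le> C * \<tau>^2)))"

definition energy_preserving ::
    "real^'d \<Rightarrow> real^'d \<Rightarrow> ((real^'d \<Rightarrow> real^'m) \<Rightarrow> real^'d \<Rightarrow> real^'m) \<Rightarrow> ((real^'d \<Rightarrow> real^'m) \<Rightarrow> real^'d \<Rightarrow> real^'m) \<Rightarrow>
     ((real^'d \<Rightarrow> real^'m) \<Rightarrow> real^'d \<Rightarrow> real) \<Rightarrow> ((real^'d \<Rightarrow> real^'m) \<Rightarrow> real^'d \<Rightarrow> real^'m) \<Rightarrow> bool" where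
  "energy_preserving a b D L N N' \<longleftrightarrow>
     (\<forall>\<tau>>0. \<forall>(z :: nat \<Rightarrow> real^'d \<Rightarrow> real^'m) (e :: nat \<Rightarrow> real). \<forall>n\<ge>1.
       esav_cn a b D L N N' \<tau> (z (n - 1)) (z n) (z (n + 1)) (e (n - 1)) (e n) (e (n + 1)) \<longrightarrow>
       modified_energy a b L (z (n + 1)) (e (n + 1)) = modified_energy a b L (z n) (e n))"

end

theory Submission
  imports Defs
begin

text \<open>
  Linear implicitness and energy conservation are short. With \<open>z\<^sup>n\<^sup>+\<^sup>1\<close> isolated, the first equation of
  a step reads \<open>(I - (\<tau>/2) D L) z\<^sup>n\<^sup>+\<^sup>1 = r\<close>. If \<open>h = (\<tau>/2) D L h\<close>, then pairing with \<open>L h\<close> gives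
  \<open>(h, L h) = 0\<close> because \<open>D\<close> is skew-adjoint; the Cauchy--Schwarz inequality of the semidefinite form
  \<open>(f, L g)\<close> yields \<open>L h = 0\<close>, hence \<open>h = 0\<close>. Energy conservation is the pairing of
  \<open>z\<^sup>n\<^sup>+\<^sup>1 - z\<^sup>n = \<tau> D \<mu>\<close> with \<open>\<mu>\<close>, where \<open>(\<mu>, D \<mu>) = 0\<close>.

  Consistency is the substantial part. Write \<open>B(t)\<close> for the nonlinear term along the exact solution and
  \<open>\<delta>(t, s) = (B(t) + B(t + s)) / 2 - B(extrapolated data)\<close>, with step \<open>s\<close>. Averaging the equation
  \<open>z\<^sub>t = D \<mu>\<close> over the two end points of the step, rather than expanding \<open>D L z\<close> in time, turns the first
  residual into the error of the trapezoidal rule for \<open>z\<close> plus \<open>D \<delta>\<close>. The second residual consists of the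
  error of the trapezoidal rule for \<open>ln e\<close>, whose derivative is \<open>(B, z\<^sub>t)\<close>, and of products of first
  differences. It remains to show that \<open>\<delta>\<close> and \<open>D \<delta>\<close> are \<open>O(s\<^sup>2)\<close>. Three facts are behind this.

  \<^item> The variational derivative is the Euler--Lagrange expression of the density
    (\<open>variational_derivative_eq\<close>): both represent the derivative of the functional against all of \<open>V\<close>, and
    \<open>V\<close> contains their difference. Hence \<open>\<delta>(t, s)(x)\<close> is smooth in all its arguments jointly.

  \<^item> \<open>\<delta>\<close> vanishes to second order at \<open>s = 0\<close>, together with all its derivatives in \<open>x\<close>
    (\<open>extrapolation_defect\<close>). In the plane of \<open>(t, s)\<close> the extrapolated data
    \<open>(3 z(t) - z(t - s)) / 2\<close> have derivative \<open>0\<close> at \<open>s = 0\<close> in the direction \<open>(1/2, -1)\<close>, so the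
    same is true of everything computed from them, and \<open>\<partial>\<^sub>s B = (1/2) \<partial>\<^sub>t B\<close> there. Thus the functions
    \<open>\<delta>(t, s) / s\<^sup>2\<close> are bounded with each of their derivatives.

  \<^item> \<open>D\<close> is merely a linear map with an adjoint on \<open>V\<close>, but this makes it continuous: it maps a set of
    functions that are bounded with each of their derivatives to an \<open>L\<^sup>2\<close>-bounded set
    (\<open>operator_with_adjoint_bounded\<close>, a variant of the Hellinger--Toeplitz theorem proved by a gliding hump).
\<close>

section \<open>Smooth functions\<close>

lemma dir_derivI:
  assumes "(f has_derivative f') (at x)"
  shows "dir_deriv v f x = f' v"
  using frechet_derivative_at[OF assms] by (simp add: dir_deriv_def)

lemma has_derivative_dir_deriv:
  assumes "f differentiable at x"
  shows "(f has_derivative (\<lambda>v. dir_deriv v f x)) (at x)"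
  using assms frechet_derivative_works[of f "at x"] unfolding dir_deriv_def by simp

lemma dir_deriv_eq_sum_Basis:
  fixes f :: "'a::euclidean_space \<Rightarrow> 'b::real_normed_vector"
  assumes "f differentiable at x"
  shows "dir_deriv v f x = (\<Sum>i\<in>Basis. (v \<bullet> i) *\<^sub>R dir_deriv i f x)"
proof -
  interpret linear "\<lambda>v. dir_deriv v f x"
    using has_derivative_dir_deriv[OF assms] by (rule has_derivative_linear)
  have "dir_deriv v f x = dir_deriv (\<Sum>i\<in>Basis. (v \<bullet> i) *\<^sub>R i) f x"
    by (simp add: euclidean_representation)
  also have "\<dots> = (\<Sum>i\<in>Basis. (v \<bullet> i) *\<^sub>R dir_deriv i f x)"
    by (simp add: sum scale)
  finally show ?thesis .
qed

lemma has_derivative_cong_open: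
  assumes "open S" "x \<in> S" "\<And>y. y \<in> S \<Longrightarrow> f y = g y"
  shows "(f has_derivative f') (at x) \<longleftrightarrow> (g has_derivative f') (at x)"
  using assms has_derivative_transform_within_open[OF _ assms(1,2)] by metis

lemma dir_deriv_cong_open:
  assumes "open S" "x \<in> S" "\<And>y. y \<in> S \<Longrightarrow> f y = g y"
  shows "dir_deriv v f x = dir_deriv v g x"
  unfolding dir_deriv_def frechet_derivative_def
  using has_derivative_cong_open[OF assms] by simp

lemma differentiable_cong_open:
  assumes "open S" "x \<in> S" "\<And>y. y \<in> S \<Longrightarrow> f y = g y"
  shows "f differentiable at x \<longleftrightarrow> g differentiable at x"
  unfolding differentiable_def using has_derivative_cong_open[OF assms] by simp

lemma foldr_dir_deriv_cong_open:
  assumes "open S" "\<And>y. y \<in> S \<Longrightarrow> f y = g y" "x \<in> S"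
  shows "foldr dir_deriv vs f x = foldr dir_deriv vs g x"
  using assms(3)
proof (induction vs arbitrary: x)
  case (Cons v vs)
  show ?case
    by (simp, rule dir_deriv_cong_open[OF assms(1) Cons.prems Cons.IH])
qed (simp add: assms)

text \<open>
  The iterated derivatives peel off from the inside here; this is the form needed for inductions in which
  the function varies.
\<close>

lemma smooth_on_iff_step:
  "smooth_on S f \<longleftrightarrow> (\<forall>x\<in>S. f differentiable at x) \<and> (\<forall>v. smooth_on S (dir_deriv v f))"
proof
  assume *: "smooth_on S f"
  have "foldr dir_deriv [] f differentiable at x" if "x \<in> S" for x
    using * that unfolding smooth_on_def by blast
  moreover have "foldr dir_deriv (vs @ [v]) f differentiable at x" if "x \<in> S" for vs v x
    using * that unfolding smooth_on_def by blast
  ultimately show "(\<forall>x\<in>S. f differentiable at x) \<and> (\<forall>v. smooth_on S (dir_deriv v f))"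
    by (simp add: smooth_on_def)
next
  assume *: "(\<forall>x\<in>S. f differentiable at x) \<and> (\<forall>v. smooth_on S (dir_deriv v f))"
  show "smooth_on S f"
    unfolding smooth_on_def
  proof (intro allI ballI)
    fix vs x assume "x \<in> S"
    then show "foldr dir_deriv vs f differentiable at x"
      using * by (cases vs rule: rev_cases) (auto simp: smooth_on_def)
  qed
qed

lemma smooth_on_differentiable: "smooth_on S f \<Longrightarrow> x \<in> S \<Longrightarrow> f differentiable at x"
  using smooth_on_iff_step by blast

lemma smooth_on_dir_deriv: "smooth_on S f \<Longrightarrow> smooth_on S (dir_deriv v f)"
  using smooth_on_iff_step by blast

lemma smooth_on_foldr: "smooth_on S f \<Longrightarrow> smooth_on S (foldr dir_deriv vs f)"
  by (induction vs) (auto intro: smooth_on_dir_deriv)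

lemma smooth_on_continuous_on: "smooth_on S f \<Longrightarrow> T \<subseteq> S \<Longrightarrow> continuous_on T f"
  by (meson continuous_at_imp_continuous_on differentiable_imp_continuous_within
      smooth_on_differentiable subsetD)

lemma smooth_on_cong:
  assumes "smooth_on S f" "open S" "\<And>x. x \<in> S \<Longrightarrow> f x = g x"
  shows "smooth_on S g"
  unfolding smooth_on_def
proof (intro allI ballI)
  fix vs x assume x: "x \<in> S"
  have "foldr dir_deriv vs f differentiable at x"
    using assms(1) x unfolding smooth_on_def by blast
  then show "foldr dir_deriv vs g differentiable at x"
    using differentiable_cong_open[OF assms(2) x, of "foldr dir_deriv vs f" "foldr dir_deriv vs g"]
      foldr_dir_deriv_cong_open[OF assms(2,3)] by simp
qed

text \<open>
  Product and chain rule express a derivative of a compound function by products of its constituents and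
  their derivatives. Closure of smoothness under these operations is therefore an induction on the order of
  differentiability, for which a finite order has to be available.
\<close>

primrec diff_order :: "nat \<Rightarrow> 'a::real_normed_vector set \<Rightarrow> ('a \<Rightarrow> 'b::real_normed_vector) \<Rightarrow> bool" where
  "diff_order 0 S f = True"
| "diff_order (Suc n) S f =
     ((\<forall>x\<in>S. f differentiable at x) \<and> (\<forall>v. diff_order n S (dir_deriv v f)))"

lemma smooth_on_iff_diff_order: "smooth_on S f \<longleftrightarrow> (\<forall>n. diff_order n S f)"
proof
  assume "smooth_on S f"
  then have "diff_order n S f" for n
    by (induction n arbitrary: f) (auto intro: smooth_on_differentiable smooth_on_dir_deriv)
  then show "\<forall>n. diff_order n S f" by blast
next
  assume *: "\<forall>n. diff_order n S f"
  have "foldr dir_deriv vs f differentiable at x" if "diff_order (Suc (length vs)) S f" "x \<in> S" for vs x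
    using that by (induction vs arbitrary: f rule: rev_induct) auto
  then show "smooth_on S f" unfolding smooth_on_def using * by blast
qed

lemma diff_order_mono: "diff_order (Suc n) S f \<Longrightarrow> diff_order n S f"
proof (induction n arbitrary: f)
  case (Suc n)
  have "diff_order n S (dir_deriv v f)" for v
    using Suc.IH[of "dir_deriv v f"] Suc.prems by simp
  then show ?case using Suc.prems by simp
qed simp

lemma diff_order_cong:
  assumes "diff_order n S f" "open S" "\<And>x. x \<in> S \<Longrightarrow> f x = g x"
  shows "diff_order n S g"
  using assms(1,3)
proof (induction n arbitrary: f g)
  case (Suc n)
  have "diff_order n S (dir_deriv v g)" for v
  proof (rule Suc.IH)
    show "diff_order n S (dir_deriv v f)" using Suc.prems by simp
    show "dir_deriv v f x = dir_deriv v g x" if "x \<in> S" for x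
      by (rule dir_deriv_cong_open[OF assms(2) that Suc.prems(2)])
  qed
  then show ?case
    using Suc.prems differentiable_cong_open[OF assms(2), of _ f g] by auto
qed simp

lemma diff_order_const: "diff_order n S (\<lambda>x. c)"
proof (induction n arbitrary: c)
  case (Suc n)
  have "dir_deriv v (\<lambda>x::'a. c) = (\<lambda>x. 0)" for v
    by (rule ext, rule dir_derivI) simp
  then show ?case using Suc by simp
qed simp

lemma diff_order_add:
  assumes "open S"
  shows "diff_order n S f \<Longrightarrow> diff_order n S g \<Longrightarrow> diff_order n S (\<lambda>x. f x + g x)"
proof (induction n arbitrary: f g)
  case (Suc n)
  have "diff_order n S (dir_deriv v (\<lambda>x. f x + g x))" for v
  proof (rule diff_order_cong[OF _ assms])
    show "diff_order n S (\<lambda>x. dir_deriv v f x + dir_deriv v g x)"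
      using Suc by simp
    show "dir_deriv v f x + dir_deriv v g x = dir_deriv v (\<lambda>x. f x + g x) x" if "x \<in> S" for x
      using Suc.prems that
      by (intro dir_derivI[symmetric] has_derivative_add has_derivative_dir_deriv) auto
  qed
  then show ?case using Suc.prems by auto
qed simp

lemma diff_order_bilinear:
  assumes "open S" "bounded_bilinear B"
  shows "diff_order n S f \<Longrightarrow> diff_order n S g \<Longrightarrow> diff_order n S (\<lambda>x. B (f x) (g x))"
proof (induction n arbitrary: f g)
  case (Suc n)
  interpret bounded_bilinear B by fact
  have der: "((\<lambda>x. B (f x) (g x)) has_derivative
      (\<lambda>v. B (f x) (dir_deriv v g x) + B (dir_deriv v f x) (g x))) (at x)" if "x \<in> S" for x
    using Suc.prems that by (intro FDERIV has_derivative_dir_deriv) auto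
  have "diff_order n S (dir_deriv v (\<lambda>x. B (f x) (g x)))" for v
  proof (rule diff_order_cong[OF _ assms(1)])
    show "diff_order n S (\<lambda>x. B (f x) (dir_deriv v g x) + B (dir_deriv v f x) (g x))"
      using Suc.prems diff_order_mono[OF Suc.prems(1)] diff_order_mono[OF Suc.prems(2)]
      by (intro diff_order_add assms Suc.IH) auto
    show "B (f x) (dir_deriv v g x) + B (dir_deriv v f x) (g x) = dir_deriv v (\<lambda>x. B (f x) (g x)) x"
      if "x \<in> S" for x
      using dir_derivI[OF der[OF that], of v] by simp
  qed
  moreover have "(\<lambda>x. B (f x) (g x)) differentiable at x" if "x \<in> S" for x
    using der[OF that] unfolding differentiable_def by blast
  ultimately show ?case by auto
qed simp

lemma diff_order_sum:
  assumes "open S" "\<And>i. i \<in> I \<Longrightarrow> diff_order n S (f i)"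
  shows "diff_order n S (\<lambda>x. \<Sum>i\<in>I. f i x)"
  using assms(2)
  by (induction I rule: infinite_finite_induct) (auto intro: diff_order_const diff_order_add[OF assms(1)])

text \<open>
  In the induction step the chain rule is written with the partial derivatives of the outer function,
  \<open>\<Sum>\<^sub>i (\<partial>\<^sub>v u \<bullet> i) (\<partial>\<^sub>i f)(u)\<close>, so that the induction hypothesis applies to each factor.
\<close>

lemma diff_order_compose:
  fixes f :: "'b::euclidean_space \<Rightarrow> 'c::real_normed_vector"
    and u :: "'a::real_normed_vector \<Rightarrow> 'b"
  assumes "open S" "u ` S \<subseteq> T"
  shows "diff_order n T f \<Longrightarrow> diff_order n S u \<Longrightarrow> diff_order n S (\<lambda>x. f (u x))"
proof (induction n arbitrary: f)
  case (Suc n)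
  have der: "((\<lambda>x. f (u x)) has_derivative (\<lambda>v. dir_deriv (dir_deriv v u x) f (u x))) (at x)"
    if "x \<in> S" for x
    using Suc.prems that assms(2)
    by (intro has_derivative_compose[of u "\<lambda>v. dir_deriv v u x" _ _ f "\<lambda>w. dir_deriv w f (u x)"]
        has_derivative_dir_deriv) auto
  have "diff_order n S (dir_deriv v (\<lambda>x. f (u x)))" for v
  proof (rule diff_order_cong[OF _ assms(1)])
    show "diff_order n S (\<lambda>x. \<Sum>i\<in>Basis. (dir_deriv v u x \<bullet> i) *\<^sub>R dir_deriv i f (u x))"
    proof (intro diff_order_sum assms diff_order_bilinear[OF _ bounded_bilinear_scaleR])
      fix i :: 'b
      show "diff_order n S (\<lambda>x. dir_deriv v u x \<bullet> i)"
        using Suc.prems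
        by (intro diff_order_bilinear[OF _ bounded_bilinear_inner] assms diff_order_const) auto
      show "diff_order n S (\<lambda>x. dir_deriv i f (u x))"
        using Suc.prems diff_order_mono[OF Suc.prems(2)] by (intro Suc.IH) auto
    qed
    show "(\<Sum>i\<in>Basis. (dir_deriv v u x \<bullet> i) *\<^sub>R dir_deriv i f (u x)) = dir_deriv v (\<lambda>x. f (u x)) x"
      if "x \<in> S" for x
    proof -
      have "f differentiable at (u x)" using Suc.prems that assms(2) by auto
      then show ?thesis
        using dir_derivI[OF der[OF that], of v] dir_deriv_eq_sum_Basis[of f "u x" "dir_deriv v u x"]
        by simp
    qed
  qed
  moreover have "(\<lambda>x. f (u x)) differentiable at x" if "x \<in> S" for x
    using der[OF that] unfolding differentiable_def by blast
  ultimately show ?case by auto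
qed simp

lemma smooth_on_const: "smooth_on S (\<lambda>x. c)"
  by (simp add: smooth_on_iff_diff_order diff_order_const)

lemma smooth_on_add:
  "open S \<Longrightarrow> smooth_on S f \<Longrightarrow> smooth_on S g \<Longrightarrow> smooth_on S (\<lambda>x. f x + g x)"
  by (simp add: smooth_on_iff_diff_order diff_order_add)

lemma smooth_on_sum:
  "open S \<Longrightarrow> (\<And>i. i \<in> I \<Longrightarrow> smooth_on S (f i)) \<Longrightarrow> smooth_on S (\<lambda>x. \<Sum>i\<in>I. f i x)"
  by (simp add: smooth_on_iff_diff_order diff_order_sum)

lemma smooth_on_bilinear:
  "open S \<Longrightarrow> bounded_bilinear B \<Longrightarrow> smooth_on S f \<Longrightarrow> smooth_on S g \<Longrightarrow>
   smooth_on S (\<lambda>x. B (f x) (g x))"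
  by (simp add: smooth_on_iff_diff_order diff_order_bilinear)

lemmas smooth_on_scaleR = smooth_on_bilinear[OF _ bounded_bilinear_scaleR]
lemmas smooth_on_inner = smooth_on_bilinear[OF _ bounded_bilinear_inner]

lemma smooth_on_compose:
  fixes f :: "'b::euclidean_space \<Rightarrow> 'c::real_normed_vector"
    and u :: "'a::real_normed_vector \<Rightarrow> 'b"
  shows "smooth_on T f \<Longrightarrow> open S \<Longrightarrow> smooth_on S u \<Longrightarrow> (\<And>x. x \<in> S \<Longrightarrow> u x \<in> T) \<Longrightarrow>
    smooth_on S (\<lambda>x. f (u x))"
  unfolding smooth_on_iff_diff_order by (blast intro: diff_order_compose)

lemma smooth_on_bounded_linear:
  assumes "bounded_linear T"
  shows "smooth_on S T"
proof -
  have der: "(T has_derivative T) (at x)" for x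
    using bounded_linear_imp_has_derivative[OF assms] .
  then have "dir_deriv v T = (\<lambda>x. T v)" for v
    using dir_derivI by blast
  then show ?thesis
    using der by (auto simp: smooth_on_iff_step[of S T] smooth_on_const differentiable_def)
qed

lemma smooth_on_linear_compose:
  fixes T :: "'b::euclidean_space \<Rightarrow> 'c::real_normed_vector"
  assumes "bounded_linear T" "open S" "smooth_on S f"
  shows "smooth_on S (\<lambda>x. T (f x))"
  by (rule smooth_on_compose[OF smooth_on_bounded_linear[OF assms(1), of UNIV] assms(2,3)]) simp

lemma smooth_on_minus:
  "open S \<Longrightarrow> smooth_on S f \<Longrightarrow> smooth_on S g \<Longrightarrow> smooth_on S (\<lambda>x. f x - g x)"
  using smooth_on_add[of S f "\<lambda>x. (-1) *\<^sub>R g x"] smooth_on_scaleR[of S "\<lambda>x. -1" g] smooth_on_const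
  by fastforce

lemma smooth_on_vec_lambda:
  fixes f :: "'k::finite \<Rightarrow> 'a::real_normed_vector \<Rightarrow> real"
  assumes "open S" "\<And>j. smooth_on S (f j)"
  shows "smooth_on S (\<lambda>x. \<chi> j. f j x)"
proof -
  have "(\<lambda>x. \<chi> j. f j x) = (\<lambda>x. \<Sum>j\<in>UNIV. f j x *\<^sub>R (axis j 1 :: real^'k))"
    by (auto simp: fun_eq_iff vec_eq_iff axis_def if_distrib[of "\<lambda>c. _ * c"] sum.delta cong: if_cong)
  then show ?thesis
    using assms by (simp add: smooth_on_sum smooth_on_scaleR smooth_on_const)
qed

lemma smooth_on_exp: "smooth_on UNIV (exp :: real \<Rightarrow> real)"
proof -
  have "dir_deriv v exp = (\<lambda>x::real. exp x * v)" for v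
    by (rule ext, rule dir_derivI)
      (use DERIV_exp in \<open>simp add: has_field_derivative_def\<close>)
  moreover have "(exp :: real \<Rightarrow> real) differentiable at x" for x
    using DERIV_exp[of x] unfolding has_field_derivative_def differentiable_def by blast
  ultimately have "diff_order n UNIV (exp :: real \<Rightarrow> real)" for n
    by (induction n) (auto intro: diff_order_bilinear[OF _ bounded_bilinear_mult] diff_order_const)
  then show ?thesis by (simp add: smooth_on_iff_diff_order)
qed

lemma foldr_dir_deriv_add:
  assumes "open S" "smooth_on S f" "smooth_on S g" "x \<in> S"
  shows "foldr dir_deriv vs (\<lambda>x. f x + g x) x = foldr dir_deriv vs f x + foldr dir_deriv vs g x"
  using assms(4)
proof (induction vs arbitrary: x)
  case (Cons v vs)
  have "dir_deriv v (foldr dir_deriv vs (\<lambda>x. f x + g x)) x =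
      dir_deriv v (\<lambda>x. foldr dir_deriv vs f x + foldr dir_deriv vs g x) x"
    by (rule dir_deriv_cong_open[OF assms(1) Cons.prems]) (rule Cons.IH)
  also have "\<dots> = dir_deriv v (foldr dir_deriv vs f) x + dir_deriv v (foldr dir_deriv vs g) x"
    using Cons.prems assms smooth_on_foldr smooth_on_differentiable
    by (intro dir_derivI has_derivative_add has_derivative_dir_deriv) blast+
  finally show ?case by simp
qed simp

lemma foldr_dir_deriv_linear:
  assumes "open S" "smooth_on S f" "bounded_linear T" "x \<in> S"
  shows "foldr dir_deriv vs (\<lambda>x. T (f x)) x = T (foldr dir_deriv vs f x)"
  using assms(4)
proof (induction vs arbitrary: x)
  case (Cons v vs)
  have "dir_deriv v (foldr dir_deriv vs (\<lambda>x. T (f x))) x =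
      dir_deriv v (\<lambda>x. T (foldr dir_deriv vs f x)) x"
    by (rule dir_deriv_cong_open[OF assms(1) Cons.prems]) (rule Cons.IH)
  also have "\<dots> = T (dir_deriv v (foldr dir_deriv vs f) x)"
    using Cons.prems assms smooth_on_foldr smooth_on_differentiable
    by (intro dir_derivI bounded_linear.has_derivative[OF assms(3)] has_derivative_dir_deriv) blast+
  finally show ?case by simp
qed simp

lemma has_derivative_slice:
  assumes "g differentiable at (p, x)"
  shows "((\<lambda>x. g (p, x)) has_derivative (\<lambda>v. dir_deriv (0, v) g (p, x))) (at x)"
  using has_derivative_compose[OF has_derivative_Pair[OF has_derivative_const has_derivative_ident]
    has_derivative_dir_deriv[OF assms]] .

lemma has_derivative_slice_param:
  assumes "g differentiable at (p, x)"
  shows "((\<lambda>p. g (p, x)) has_derivative (\<lambda>v. dir_deriv (v, 0) g (p, x))) (at p)"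
  using has_derivative_compose[OF has_derivative_Pair[OF has_derivative_ident has_derivative_const]
    has_derivative_dir_deriv[OF assms]] .

text \<open>
  Derivatives of a member \<open>g (p, \<cdot>)\<close> of a family are derivatives of the family in directions \<open>(0, v)\<close>. Joint
  smoothness in parameter and space thereby controls all spatial derivatives uniformly in the parameter.
\<close>

lemma foldr_dir_deriv_slice:
  assumes "smooth_on (P \<times> UNIV) g" "p \<in> P"
  shows "foldr dir_deriv vs (\<lambda>x. g (p, x)) = (\<lambda>x. foldr dir_deriv (map (Pair 0) vs) g (p, x))"
proof (induction vs)
  case (Cons v vs)
  show ?case
  proof
    fix x
    have "foldr dir_deriv (map (Pair 0) vs) g differentiable at (p, x)"
      using smooth_on_foldr[OF assms(1)] assms(2) by (auto intro: smooth_on_differentiable)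
    from dir_derivI[OF has_derivative_slice[OF this]]
    show "foldr dir_deriv (v # vs) (\<lambda>x. g (p, x)) x = foldr dir_deriv (map (Pair 0) (v # vs)) g (p, x)"
      by (simp add: Cons.IH)
  qed
qed simp

lemma smooth_on_slice:
  assumes "smooth_on (P \<times> UNIV) g" "p \<in> P"
  shows "smooth_on UNIV (\<lambda>x. g (p, x))"
  unfolding smooth_on_def foldr_dir_deriv_slice[OF assms]
proof (intro allI ballI)
  fix vs x
  have "foldr dir_deriv (map (Pair 0) vs) g differentiable at (p, x)"
    using smooth_on_foldr[OF assms(1)] assms(2) by (auto intro: smooth_on_differentiable)
  from has_derivative_slice[OF this]
  show "(\<lambda>x. foldr dir_deriv (map (Pair 0) vs) g (p, x)) differentiable at x"
    unfolding differentiable_def by blast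
qed

text \<open>
  The mean value inequality is applied to \<open>s \<mapsto> f (x + s u + h v) - f (x + s u)\<close> on \<open>[0, h]\<close>. Its derivative
  is a difference of values of \<open>\<partial>\<^sub>u f\<close> near \<open>x\<close>, which equals \<open>h \<partial>\<^sub>v \<partial>\<^sub>u f x\<close> up to \<open>o(h)\<close> by differentiability of
  \<open>\<partial>\<^sub>u f\<close> at \<open>x\<close>.
\<close>

lemma second_difference_quotient:
  fixes f :: "'a::real_normed_vector \<Rightarrow> 'b::real_normed_vector"
  assumes "open S" "x \<in> S" "\<And>y. y \<in> S \<Longrightarrow> f differentiable at y"
    and "dir_deriv u f differentiable at x" and "\<epsilon> > 0"
  shows "\<forall>\<^sub>F h in at_right 0. norm (f (x + h *\<^sub>R u + h *\<^sub>R v) - f (x + h *\<^sub>R u) - (f (x + h *\<^sub>R v) - f x)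
           - h\<^sup>2 *\<^sub>R dir_deriv v (dir_deriv u f) x) \<le> \<epsilon> * h\<^sup>2"
proof -
  let ?g = "dir_deriv u f" and ?T = "\<lambda>w. dir_deriv w (dir_deriv u f) x"
  \<comment> \<open>Two points at distance at most \<open>h (norm u + norm v)\<close> from \<open>x\<close> are compared; the summand \<open>1\<close>
    keeps \<open>K\<close> positive.\<close>
  define K where "K = 2 * (norm u + norm v) + 1"
  have K: "K > 0" by (simp add: K_def add_nonneg_pos)
  have T: "(?g has_derivative ?T) (at x)"
    using has_derivative_dir_deriv[OF assms(4)] .
  interpret T: linear ?T using T by (rule has_derivative_linear)
  obtain r where r: "r > 0" "ball x r \<subseteq> S" using assms(1,2) openE by blast
  have "\<epsilon> / K > 0" using assms(5) K by simp
  then obtain d where d: "d > 0" "\<And>y. norm (y - x) < d \<Longrightarrow>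
      norm (?g y - ?g x - ?T (y - x)) \<le> \<epsilon> / K * norm (y - x)"
    using T unfolding has_derivative_at_alt by blast
  define m where "m = min r d / K"
  have m: "m > 0" using r d K by (simp add: m_def)
  show ?thesis
    unfolding eventually_at_right_field
  proof (intro exI[of _ m] conjI allI impI m)
    fix h :: real assume h: "0 < h" "h < m"
    have hK: "h * K < min r d" using h K by (simp add: m_def field_simps)
    have small: "norm (s *\<^sub>R u + t *\<^sub>R v) \<le> h * (norm u + norm v)"
      if "0 \<le> s" "s \<le> h" "0 \<le> t" "t \<le> h" for s t
    proof -
      have "norm (s *\<^sub>R u + t *\<^sub>R v) \<le> s * norm u + t * norm v"
        using norm_triangle_ineq[of "s *\<^sub>R u" "t *\<^sub>R v"] that by simp
      also have "\<dots> \<le> h * norm u + h * norm v"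
        using that by (intro add_mono mult_right_mono) auto
      finally show ?thesis by (simp add: algebra_simps)
    qed
    have lt: "h * (norm u + norm v) < min r d"
    proof -
      have "h * (norm u + norm v) \<le> h * K"
        using h by (intro mult_left_mono) (auto simp: K_def)
      then show ?thesis using hK by simp
    qed
    have inS: "x + s *\<^sub>R u + t *\<^sub>R v \<in> S" if "0 \<le> s" "s \<le> h" "0 \<le> t" "t \<le> h" for s t
    proof -
      have "dist x (x + (s *\<^sub>R u + t *\<^sub>R v)) < r"
        using small[OF that] lt norm_minus_cancel[of "s *\<^sub>R u + t *\<^sub>R v"] unfolding dist_norm by simp
      then show ?thesis using r(2) by (auto simp: add.assoc)
    qed
    define \<phi> where "\<phi> s = f (x + s *\<^sub>R u + h *\<^sub>R v) - f (x + s *\<^sub>R u) - (s * h) *\<^sub>R ?T v" for s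
    define \<phi>' where "\<phi>' s = ?g (x + s *\<^sub>R u + h *\<^sub>R v) - ?g (x + s *\<^sub>R u) - h *\<^sub>R ?T v" for s
    have der: "(\<phi> has_derivative (\<lambda>k. k *\<^sub>R \<phi>' s)) (at s within {0..h})" if "s \<in> {0..h}" for s
    proof -
      have line: "((\<lambda>s. f (y + s *\<^sub>R u)) has_derivative (\<lambda>k. k *\<^sub>R ?g (y + s *\<^sub>R u))) (at s within {0..h})"
        if "f differentiable at (y + s *\<^sub>R u)" for y
      proof -
        have f': "(f has_derivative (\<lambda>w. dir_deriv w f (y + s *\<^sub>R u))) (at (y + s *\<^sub>R u))"
          by (rule has_derivative_dir_deriv[OF that])
        interpret F: linear "\<lambda>w. dir_deriv w f (y + s *\<^sub>R u)"
          using f' by (rule has_derivative_linear)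
        have "((\<lambda>s. y + s *\<^sub>R u) has_derivative (\<lambda>k. k *\<^sub>R u)) (at s within {0..h})"
          by (auto intro!: derivative_eq_intros)
        from has_derivative_compose[OF this f'] show ?thesis
          by (simp add: F.scale)
      qed
      have d1: "f differentiable at (x + h *\<^sub>R v + s *\<^sub>R u)"
        using assms(3) inS[of s h] that h by (simp add: algebra_simps)
      have d2: "f differentiable at (x + s *\<^sub>R u)"
        using assms(3) inS[of s 0] that h by (simp add: algebra_simps)
      have "((\<lambda>s. f (x + h *\<^sub>R v + s *\<^sub>R u) - f (x + s *\<^sub>R u) - (s * h) *\<^sub>R ?T v) has_derivative
          (\<lambda>k. k *\<^sub>R ?g (x + h *\<^sub>R v + s *\<^sub>R u) - k *\<^sub>R ?g (x + s *\<^sub>R u) - (k * h) *\<^sub>R ?T v)) (at s within {0..h})"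
        by (intro has_derivative_diff line d1 d2) (auto intro!: derivative_eq_intros)
      then show ?thesis
        unfolding \<phi>_def \<phi>'_def by (simp add: algebra_simps)
    qed
    have bd: "norm (\<phi>' s) \<le> \<epsilon> * h" if "s \<in> {0..h}" for s
    proof -
      have n1: "norm (s *\<^sub>R u + h *\<^sub>R v) \<le> h * (norm u + norm v)"
        and n2: "norm (s *\<^sub>R u) \<le> h * (norm u + norm v)"
        using small[of s h] small[of s 0] that h by auto
      have "\<phi>' s = (?g (x + (s *\<^sub>R u + h *\<^sub>R v)) - ?g x - ?T (s *\<^sub>R u + h *\<^sub>R v))
          - (?g (x + s *\<^sub>R u) - ?g x - ?T (s *\<^sub>R u))"
        unfolding \<phi>'_def by (simp add: T.add T.scale add.assoc)
      also have "norm \<dots> \<le> \<epsilon> / K * norm (s *\<^sub>R u + h *\<^sub>R v) + \<epsilon> / K * norm (s *\<^sub>R u)"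
        using d(2)[of "x + (s *\<^sub>R u + h *\<^sub>R v)"] d(2)[of "x + s *\<^sub>R u"] n1 n2 lt
        by (intro order.trans[OF norm_triangle_ineq4[of
              "?g (x + (s *\<^sub>R u + h *\<^sub>R v)) - ?g x - ?T (s *\<^sub>R u + h *\<^sub>R v)"
              "?g (x + s *\<^sub>R u) - ?g x - ?T (s *\<^sub>R u)"] add_mono]) auto
      also have "\<dots> \<le> \<epsilon> / K * (h * (norm u + norm v)) + \<epsilon> / K * (h * (norm u + norm v))"
        using n1 n2 assms(5) K by (intro add_mono mult_left_mono) auto
      also have "\<dots> = \<epsilon> * h * ((K - 1) / K)"
        by (simp add: K_def field_simps)
      also have "\<dots> \<le> \<epsilon> * h * 1"
        using assms(5) h K by (intro mult_left_mono) auto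
      finally show ?thesis by simp
    qed
    have "norm (\<phi> h - \<phi> 0) \<le> \<epsilon> * h * norm (h - 0)"
    proof (rule differentiable_bound[OF _ der])
      show "onorm (\<lambda>k. k *\<^sub>R \<phi>' s) \<le> \<epsilon> * h" if "s \<in> {0..h}" for s
        using bd[OF that] by (intro onorm_le) (simp add: mult.commute mult_left_mono)
    qed (use h in auto)
    then show "norm (f (x + h *\<^sub>R u + h *\<^sub>R v) - f (x + h *\<^sub>R u) - (f (x + h *\<^sub>R v) - f x)
           - h\<^sup>2 *\<^sub>R ?T v) \<le> \<epsilon> * h\<^sup>2"
      using h by (simp add: \<phi>_def power2_eq_square algebra_simps)
  qed
qed

text \<open>
  The second difference of \<open>f\<close> is symmetric in \<open>u\<close> and \<open>v\<close>, and divided by \<open>h\<^sup>2\<close> it converges to both mixed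
  derivatives.
\<close>

lemma dir_deriv_commute:
  fixes f :: "'a::real_normed_vector \<Rightarrow> 'b::real_normed_vector"
  assumes "open S" "smooth_on S f" "x \<in> S"
  shows "dir_deriv u (dir_deriv v f) x = dir_deriv v (dir_deriv u f) x"
proof (rule ccontr)
  let ?A = "dir_deriv v (dir_deriv u f) x" and ?B = "dir_deriv u (dir_deriv v f) x"
  let ?\<Delta> = "\<lambda>h. f (x + h *\<^sub>R u + h *\<^sub>R v) - f (x + h *\<^sub>R u) - (f (x + h *\<^sub>R v) - f x)"
  assume "?B \<noteq> ?A"
  define \<epsilon> where "\<epsilon> = norm (?B - ?A) / 3"
  have \<epsilon>: "\<epsilon> > 0" using \<open>?B \<noteq> ?A\<close> by (simp add: \<epsilon>_def)
  have "\<forall>\<^sub>F h in at_right 0. norm (?\<Delta> h - h\<^sup>2 *\<^sub>R ?A) \<le> \<epsilon> * h\<^sup>2"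
    using assms smooth_on_differentiable smooth_on_dir_deriv \<epsilon>
    by (intro second_difference_quotient[of S]) blast+
  moreover have "\<forall>\<^sub>F h in at_right 0. norm (f (x + h *\<^sub>R v + h *\<^sub>R u) - f (x + h *\<^sub>R v)
      - (f (x + h *\<^sub>R u) - f x) - h\<^sup>2 *\<^sub>R ?B) \<le> \<epsilon> * h\<^sup>2"
    using assms smooth_on_differentiable smooth_on_dir_deriv \<epsilon>
    by (intro second_difference_quotient[of S]) blast+
  ultimately have "\<forall>\<^sub>F h in at_right (0::real). h > 0 \<and> norm (?\<Delta> h - h\<^sup>2 *\<^sub>R ?A) \<le> \<epsilon> * h\<^sup>2 \<and>
      norm (?\<Delta> h - h\<^sup>2 *\<^sub>R ?B) \<le> \<epsilon> * h\<^sup>2"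
    using eventually_at_right_less[of "0::real"]
  proof eventually_elim
    case (elim h)
    have "f (x + h *\<^sub>R v + h *\<^sub>R u) - f (x + h *\<^sub>R v) - (f (x + h *\<^sub>R u) - f x) = ?\<Delta> h"
      by (simp add: add.commute add.left_commute)
    then show ?case using elim by metis
  qed
  from eventually_happens'[OF trivial_limit_at_right_real this]
  obtain h :: real where h: "h > 0" "norm (?\<Delta> h - h\<^sup>2 *\<^sub>R ?A) \<le> \<epsilon> * h\<^sup>2"
      "norm (?\<Delta> h - h\<^sup>2 *\<^sub>R ?B) \<le> \<epsilon> * h\<^sup>2"
    by blast
  have "h\<^sup>2 * norm (?B - ?A) = norm (h\<^sup>2 *\<^sub>R (?B - ?A))" by simp
  also have "h\<^sup>2 *\<^sub>R (?B - ?A) = (?\<Delta> h - h\<^sup>2 *\<^sub>R ?A) - (?\<Delta> h - h\<^sup>2 *\<^sub>R ?B)"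
    by (simp add: algebra_simps)
  also have "norm \<dots> \<le> \<epsilon> * h\<^sup>2 + \<epsilon> * h\<^sup>2"
    using h by (intro order.trans[OF norm_triangle_ineq4[of "?\<Delta> h - h\<^sup>2 *\<^sub>R ?A"
            "?\<Delta> h - h\<^sup>2 *\<^sub>R ?B"] add_mono]) auto
  finally have "h\<^sup>2 * norm (?B - ?A) \<le> h\<^sup>2 * (2 * \<epsilon>)" by (simp add: algebra_simps)
  then have "norm (?B - ?A) \<le> 2 * \<epsilon>" using h(1) by simp
  then show False using \<epsilon> by (simp add: \<epsilon>_def)
qed

section \<open>Integrals depending on a parameter\<close>

lemma has_derivative_integral_param:
  fixes g :: "('p::euclidean_space \<times> 'x::euclidean_space) \<Rightarrow> real"
  assumes "open P" "smooth_on (P \<times> UNIV) g" "p \<in> P"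
  shows "((\<lambda>p. integral (cbox a b) (\<lambda>x. g (p, x))) has_derivative
    (\<lambda>v. integral (cbox a b) (\<lambda>x. dir_deriv (v, 0) g (p, x)))) (at p)"
proof -
  obtain r where r: "r > 0" "ball p r \<subseteq> P" using assms(1,3) openE by blast
  have diff: "g differentiable at (q, x)" if "q \<in> P" for q x
    using smooth_on_differentiable[OF assms(2)] that by auto
  define G where "G q x = Blinfun (\<lambda>v. dir_deriv (v, 0) g (q, x))" for q x
  have G: "blinfun_apply (G q x) = (\<lambda>v. dir_deriv (v, 0) g (q, x))" if "q \<in> P" for q x
    unfolding G_def using has_derivative_slice_param[OF diff[OF that]]
    by (intro bounded_linear_Blinfun_apply) (rule has_derivative_bounded_linear)
  have cont: "continuous_on (ball p r \<times> cbox a b) (\<lambda>(q, x). G q x)"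
  proof (rule continuous_on_blinfun_componentwise)
    fix i :: 'p
    have "continuous_on (ball p r \<times> cbox a b) (dir_deriv (i, 0) g)"
      using smooth_on_continuous_on[OF smooth_on_dir_deriv[OF assms(2)]] r by blast
    then show "continuous_on (ball p r \<times> cbox a b) (\<lambda>y. blinfun_apply (case y of (q, x) \<Rightarrow> G q x) i)"
      by (rule continuous_on_eq) (use r G in auto)
  qed
  have "((\<lambda>q. integral (cbox a b) (\<lambda>x. g (q, x))) has_derivative
      blinfun_apply (integral (cbox a b) (G p))) (at p within ball p r)"
  proof (rule leibniz_rule)
    fix q assume "q \<in> ball p r"
    then have q: "q \<in> P" using r(2) by blast
    show "((\<lambda>q. g (q, x)) has_derivative blinfun_apply (G q x)) (at q within ball p r)" for x
      unfolding G[OF q] by (rule has_derivative_at_withinI[OF has_derivative_slice_param[OF diff[OF q]]])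
    have "smooth_on UNIV (\<lambda>x. g (q, x))"
      by (rule smooth_on_slice[OF assms(2) q])
    then show "(\<lambda>x. g (q, x)) integrable_on cbox a b"
      by (intro integrable_continuous smooth_on_continuous_on) auto
  qed (use cont r in auto)
  moreover have "at p within ball p r = at p"
    using r by (intro at_within_open) auto
  moreover have "blinfun_apply (integral (cbox a b) (G p)) v =
      integral (cbox a b) (\<lambda>x. dir_deriv (v, 0) g (p, x))" for v
  proof -
    have "continuous_on (cbox a b) (G p)"
      using continuous_on_compose2[OF cont, of "cbox a b" "\<lambda>x. (p, x)"] r(1)
        continuous_on_Pair[OF continuous_on_const continuous_on_id, of "cbox a b" p]
      by (simp add: image_subset_iff)
    then have "G p integrable_on cbox a b" by (rule integrable_continuous)
    from blinfun_apply_integral[OF this] show ?thesis using G[OF assms(3)] by simp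
  qed
  then have "blinfun_apply (integral (cbox a b) (G p)) =
      (\<lambda>v. integral (cbox a b) (\<lambda>x. dir_deriv (v, 0) g (p, x)))" by (rule ext)
  ultimately show ?thesis by simp
qed

lemma dir_deriv_integral_param:
  fixes g :: "('p::euclidean_space \<times> 'x::euclidean_space) \<Rightarrow> real"
  assumes "open P" "smooth_on (P \<times> UNIV) g" "p \<in> P"
  shows "dir_deriv v (\<lambda>p. integral (cbox a b) (\<lambda>x. g (p, x))) p =
    integral (cbox a b) (\<lambda>x. dir_deriv (v, 0) g (p, x))"
  using dir_derivI[OF has_derivative_integral_param[OF assms]] .

lemma smooth_on_integral_param:
  fixes g :: "('p::euclidean_space \<times> 'x::euclidean_space) \<Rightarrow> real"
  assumes "open P" "smooth_on (P \<times> UNIV) g"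
  shows "smooth_on P (\<lambda>p. integral (cbox a b) (\<lambda>x. g (p, x)))"
proof -
  have "diff_order n P (\<lambda>p. integral (cbox a b) (\<lambda>x. g (p, x)))" for n
    using assms(2)
  proof (induction n arbitrary: g)
    case (Suc n)
    have "diff_order n P (dir_deriv v (\<lambda>p. integral (cbox a b) (\<lambda>x. g (p, x))))" for v
      by (rule diff_order_cong[OF Suc.IH[OF smooth_on_dir_deriv[OF Suc.prems]] assms(1)])
        (rule dir_deriv_integral_param[OF assms(1) Suc.prems, symmetric])
    moreover have "(\<lambda>p. integral (cbox a b) (\<lambda>x. g (p, x))) differentiable at p" if "p \<in> P" for p
      using has_derivative_integral_param[OF assms(1) Suc.prems that] unfolding differentiable_def
      by blast
    ultimately show ?case by simp
  qed simp
  then show ?thesis by (simp add: smooth_on_iff_diff_order)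
qed

section \<open>Periodic functions\<close>

definition periodic :: "real^'d \<Rightarrow> real^'d \<Rightarrow> (real^'d \<Rightarrow> 'c) \<Rightarrow> bool" where
  "periodic a b f \<longleftrightarrow> (\<forall>i x. f (x + axis i (b $ i - a $ i)) = f x)"

lemma V_iff: "f \<in> V a b \<longleftrightarrow> smooth_on UNIV f \<and> periodic a b f"
  by (simp add: V_def periodic_def)

lemma VD: "f \<in> V a b \<Longrightarrow> smooth_on UNIV f" "f \<in> V a b \<Longrightarrow> periodic a b f"
  by (simp_all add: V_iff)

lemma V_continuous: "f \<in> V a b \<Longrightarrow> continuous_on S f"
  using smooth_on_continuous_on VD(1) by blast

lemma V_add: "f \<in> V a b \<Longrightarrow> g \<in> V a b \<Longrightarrow> (\<lambda>x. f x + g x) \<in> V a b"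
  by (simp add: V_iff smooth_on_add periodic_def)

lemma V_diff: "f \<in> V a b \<Longrightarrow> g \<in> V a b \<Longrightarrow> (\<lambda>x. f x - g x) \<in> V a b"
  by (simp add: V_iff smooth_on_minus periodic_def)

lemma V_scaleR: "f \<in> V a b \<Longrightarrow> (\<lambda>x. r *\<^sub>R f x) \<in> V a b"
  by (simp add: V_iff smooth_on_scaleR smooth_on_const periodic_def)

lemma V_zero: "(\<lambda>x. 0) \<in> V a b"
  by (simp add: V_iff smooth_on_const periodic_def)

lemma axis_add: "axis i (u + v) = axis i u + (axis i v :: real^'d)"
  by (auto simp: vec_eq_iff axis_def)

lemma periodic_int:
  assumes "periodic a b f"
  shows "f (x + axis i (of_int k * (b $ i - a $ i))) = f x"
proof -
  have nat: "f (x + axis i (of_nat n * (b $ i - a $ i))) = f x" for n x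
  proof (induction n)
    case (Suc n)
    have "x + axis i (of_nat (Suc n) * (b $ i - a $ i)) =
        (x + axis i (of_nat n * (b $ i - a $ i))) + axis i (b $ i - a $ i)"
      by (simp add: axis_add[symmetric] algebra_simps)
    then show ?case using assms Suc unfolding periodic_def by metis
  qed (simp add: axis_def vec_eq_iff[symmetric] zero_vec_def[symmetric])
  show ?thesis
  proof (cases "k \<ge> 0")
    case True
    then show ?thesis using nat[of x "nat k"] by simp
  next
    case False
    have "f (x + axis i (of_int k * (b $ i - a $ i))) =
        f (x + axis i (of_int k * (b $ i - a $ i)) + axis i (of_nat (nat (- k)) * (b $ i - a $ i)))"
      by (rule nat[symmetric])
    also have "x + axis i (of_int k * (b $ i - a $ i)) + axis i (of_nat (nat (- k)) * (b $ i - a $ i)) = x"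
      using False by (simp add: add.assoc axis_add[symmetric] algebra_simps)
    finally show ?thesis .
  qed
qed

text \<open>
  The point \<open>y\<close> does not depend on \<open>f\<close>. Bounds over the compact box therefore extend to the whole space, and
  the inner product is definite on \<open>V\<close>.
\<close>

lemma periodic_representative:
  fixes a b :: "real^'d"
  assumes "\<And>i. a $ i < b $ i"
  obtains y where "y \<in> cbox a b" "\<And>f :: real^'d \<Rightarrow> 'c. periodic a b f \<Longrightarrow> f x = f y"
proof -
  define k where "k i = \<lfloor>(x $ i - a $ i) / (b $ i - a $ i)\<rfloor>" for i
  define y where "y I = x + (\<Sum>i\<in>I. axis i (of_int (- k i) * (b $ i - a $ i)))" for I
  have eq: "f x = f (y I)" if "finite I" "periodic a b f" for I and f :: "real^'d \<Rightarrow> 'c"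
    using that(1)
  proof (induction I)
    case (insert i I)
    have "y (insert i I) = y I + axis i (of_int (- k i) * (b $ i - a $ i))"
      using insert by (simp add: y_def)
    then show ?case using insert periodic_int[OF that(2)] by metis
  qed (simp add: y_def)
  have nth: "y UNIV $ j = x $ j - of_int (k j) * (b $ j - a $ j)" for j
    by (simp add: y_def axis_def sum.delta if_distrib cong: if_cong)
  have "a $ j \<le> y UNIV $ j \<and> y UNIV $ j \<le> b $ j" for j
  proof -
    have pos: "b $ j - a $ j > 0" using assms[of j] by simp
    have "of_int (k j) \<le> (x $ j - a $ j) / (b $ j - a $ j)"
      "(x $ j - a $ j) / (b $ j - a $ j) \<le> of_int (k j) + 1"
      unfolding k_def by linarith+
    then have "of_int (k j) * (b $ j - a $ j) \<le> x $ j - a $ j"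
      "x $ j - a $ j \<le> (of_int (k j) + 1) * (b $ j - a $ j)"
      using pos by (simp_all add: pos_le_divide_eq pos_divide_le_eq)
    then show ?thesis unfolding nth by (simp add: algebra_simps)
  qed
  then have "y UNIV \<in> cbox a b" by (simp add: mem_box_cart)
  then show ?thesis using that eq[of UNIV] by auto
qed

lemma periodic_dir_deriv:
  assumes "smooth_on UNIV f" "periodic a b f"
  shows "periodic a b (dir_deriv v f)"
  unfolding periodic_def
proof (intro allI)
  fix i x
  let ?c = "axis i (b $ i - a $ i)"
  have "((\<lambda>x. f (x + ?c)) has_derivative (\<lambda>v. dir_deriv v f (x + ?c))) (at x)"
    by (rule has_derivative_compose[of "\<lambda>x. x + ?c" "\<lambda>h. h", OF _ has_derivative_dir_deriv])
      (auto intro!: derivative_eq_intros smooth_on_differentiable[OF assms(1)])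
  moreover have "(\<lambda>x. f (x + ?c)) = f" using assms(2) by (auto simp: periodic_def)
  ultimately have "(f has_derivative (\<lambda>v. dir_deriv v f (x + ?c))) (at x)" by simp
  from dir_derivI[OF this] show "dir_deriv v f (x + ?c) = dir_deriv v f x" by simp
qed

lemma periodic_foldr_dir_deriv:
  assumes "smooth_on UNIV f" "periodic a b f"
  shows "periodic a b (foldr dir_deriv vs f)"
  by (induction vs) (auto intro: assms periodic_dir_deriv smooth_on_foldr)

section \<open>The inner product\<close>

lemma L2_inner_commute: "L2_inner a b f g = L2_inner a b g f"
  by (simp add: L2_inner_def inner_commute)

lemma L2_integrable:
  "continuous_on (cbox a b) f \<Longrightarrow> continuous_on (cbox a b) g \<Longrightarrow> (\<lambda>x. f x \<bullet> g x) integrable_on cbox a b"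
  by (intro integrable_continuous continuous_on_inner)

lemma L2_inner_add_left:
  assumes "continuous_on (cbox a b) f" "continuous_on (cbox a b) g" "continuous_on (cbox a b) h"
  shows "L2_inner a b (\<lambda>x. f x + g x) h = L2_inner a b f h + L2_inner a b g h"
  unfolding L2_inner_def inner_add_left using assms by (intro integral_add L2_integrable)

lemma L2_inner_diff_left:
  assumes "continuous_on (cbox a b) f" "continuous_on (cbox a b) g" "continuous_on (cbox a b) h"
  shows "L2_inner a b (\<lambda>x. f x - g x) h = L2_inner a b f h - L2_inner a b g h"
  unfolding L2_inner_def inner_diff_left using assms by (intro integral_diff L2_integrable)

lemma L2_inner_scaleR_left: "L2_inner a b (\<lambda>x. r *\<^sub>R f x) h = r * L2_inner a b f h"
  by (simp add: L2_inner_def)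

lemma L2_inner_add_right:
  assumes "continuous_on (cbox a b) f" "continuous_on (cbox a b) g" "continuous_on (cbox a b) h"
  shows "L2_inner a b h (\<lambda>x. f x + g x) = L2_inner a b h f + L2_inner a b h g"
  using L2_inner_add_left[OF assms] L2_inner_commute by metis

lemma L2_inner_diff_right:
  assumes "continuous_on (cbox a b) f" "continuous_on (cbox a b) g" "continuous_on (cbox a b) h"
  shows "L2_inner a b h (\<lambda>x. f x - g x) = L2_inner a b h f - L2_inner a b h g"
  using L2_inner_diff_left[OF assms] L2_inner_commute by metis

lemma L2_inner_scaleR_right: "L2_inner a b h (\<lambda>x. r *\<^sub>R f x) = r * L2_inner a b h f"
  by (simp add: L2_inner_def)

lemma L2_inner_nonneg: "L2_inner a b f f \<ge> 0"
  unfolding L2_inner_def by (cases "(\<lambda>x. f x \<bullet> f x) integrable_on cbox a b")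
    (auto intro: integral_nonneg simp: not_integrable_integral)

lemma L2_norm_power2: "(L2_norm a b f)\<^sup>2 = L2_inner a b f f"
  by (simp add: L2_norm_def L2_inner_nonneg)

lemma L2_norm_nonneg: "L2_norm a b f \<ge> 0"
  by (simp add: L2_norm_def L2_inner_nonneg)

text \<open>
  The common core of the Cauchy--Schwarz inequality and of its version for a semidefinite operator, where
  \<open>A = 0\<close> forces \<open>B = 0\<close>.
\<close>

lemma nonneg_quadratic_discriminant:
  fixes A B C :: real
  assumes "\<And>r. 0 \<le> A + 2 * r * B + r\<^sup>2 * C"
  shows "B\<^sup>2 \<le> A * C"
proof (cases "C = 0")
  case True
  have "B = 0"
  proof (rule ccontr)
    assume "B \<noteq> 0"
    then show False using assms[of "- (A + 1) / (2 * B)"] True by (simp add: field_simps)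
  qed
  then show ?thesis using True by simp
next
  case False
  have "C \<ge> 0"
  proof (rule ccontr)
    assume "\<not> C \<ge> 0"
    have "0 \<le> A + 2 * r * B + r\<^sup>2 * C + (A + 2 * (- r) * B + (- r)\<^sup>2 * C)" for r
      using assms[of r] assms[of "- r"] by linarith
    then have "0 \<le> 2 * (A + r\<^sup>2 * C)" for r by (simp add: algebra_simps)
    then have "0 \<le> A + r\<^sup>2 * C" for r by (meson zero_le_mult_iff zero_less_numeral not_less)
    from this[of "sqrt ((\<bar>A\<bar> + 1) / - C)"]
    have "0 \<le> A + (sqrt ((\<bar>A\<bar> + 1) / - C))\<^sup>2 * C" .
    moreover have "(sqrt ((\<bar>A\<bar> + 1) / - C))\<^sup>2 * C = - (\<bar>A\<bar> + 1)"
      using \<open>\<not> C \<ge> 0\<close> by (simp add: divide_nonneg_neg)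
    ultimately show False by linarith
  qed
  then have "C > 0" using False by simp
  have "0 \<le> A + 2 * (- B / C) * B + (- B / C)\<^sup>2 * C" by (rule assms)
  also have "\<dots> = A - B\<^sup>2 / C" using \<open>C > 0\<close> by (simp add: field_simps power2_eq_square)
  finally show ?thesis using \<open>C > 0\<close> by (simp add: field_simps)
qed

lemma L2_Cauchy_Schwarz:
  assumes f: "continuous_on (cbox a b) f" and g: "continuous_on (cbox a b) g"
  shows "\<bar>L2_inner a b f g\<bar> \<le> L2_norm a b f * L2_norm a b g"
proof -
  have "0 \<le> L2_inner a b f f + 2 * r * L2_inner a b f g + r\<^sup>2 * L2_inner a b g g" for r
  proof -
    have rg: "continuous_on (cbox a b) (\<lambda>x. r *\<^sub>R g x)" by (intro continuous_intros g)
    have s: "continuous_on (cbox a b) (\<lambda>x. f x + r *\<^sub>R g x)" by (intro continuous_intros f g)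
    have "0 \<le> L2_inner a b (\<lambda>x. f x + r *\<^sub>R g x) (\<lambda>x. f x + r *\<^sub>R g x)"
      by (rule L2_inner_nonneg)
    also have "\<dots> = L2_inner a b f f + 2 * r * L2_inner a b f g + r\<^sup>2 * L2_inner a b g g"
      unfolding L2_inner_add_left[OF f rg s] L2_inner_add_right[OF f rg f] L2_inner_scaleR_left
        L2_inner_add_right[OF f rg g] L2_inner_scaleR_right L2_inner_commute[of a b g f]
      by (simp add: algebra_simps power2_eq_square)
    finally show ?thesis .
  qed
  then have "(L2_inner a b f g)\<^sup>2 \<le> L2_inner a b f f * L2_inner a b g g"
    by (rule nonneg_quadratic_discriminant)
  then have "sqrt ((L2_inner a b f g)\<^sup>2) \<le> sqrt (L2_inner a b f f * L2_inner a b g g)"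
    by (rule real_sqrt_le_mono)
  then show ?thesis by (simp add: L2_norm_def real_sqrt_mult)
qed

lemma L2_norm_triangle:
  assumes f: "continuous_on (cbox a b) f" and g: "continuous_on (cbox a b) g"
  shows "L2_norm a b (\<lambda>x. f x + g x) \<le> L2_norm a b f + L2_norm a b g"
proof (rule power2_le_imp_le)
  have s: "continuous_on (cbox a b) (\<lambda>x. f x + g x)" by (intro continuous_intros f g)
  have "(L2_norm a b (\<lambda>x. f x + g x))\<^sup>2 =
      L2_inner a b f f + 2 * L2_inner a b f g + L2_inner a b g g"
    unfolding L2_norm_power2 L2_inner_add_left[OF f g s] L2_inner_add_right[OF f g f]
      L2_inner_add_right[OF f g g] L2_inner_commute[of a b g f] by simp
  also have "\<dots> \<le> (L2_norm a b f)\<^sup>2 + 2 * (L2_norm a b f * L2_norm a b g) + (L2_norm a b g)\<^sup>2"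
    using L2_Cauchy_Schwarz[OF f g] by (simp add: L2_norm_power2)
  finally show "(L2_norm a b (\<lambda>x. f x + g x))\<^sup>2 \<le> (L2_norm a b f + L2_norm a b g)\<^sup>2"
    by (simp add: power2_sum)
qed (simp add: L2_norm_nonneg)

lemma L2_norm_scaleR: "L2_norm a b (\<lambda>x. r *\<^sub>R f x) = \<bar>r\<bar> * L2_norm a b f"
  unfolding L2_norm_def L2_inner_scaleR_left L2_inner_scaleR_right
  by (simp add: real_sqrt_mult)

lemma L2_inner_bound:
  assumes "continuous_on (cbox a b) f" "continuous_on (cbox a b) g"
    and "\<And>x. x \<in> cbox a b \<Longrightarrow> norm (f x) \<le> A" "\<And>x. x \<in> cbox a b \<Longrightarrow> norm (g x) \<le> B"
    and "A \<ge> 0"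
  shows "\<bar>L2_inner a b f g\<bar> \<le> A * B * measure lborel (cbox a b)"
proof -
  have "norm (f x \<bullet> g x) \<le> A * B" if "x \<in> cbox a b" for x
    using Cauchy_Schwarz_ineq2[of "f x" "g x"] mult_mono[OF assms(3,4)[OF that] assms(5) norm_ge_zero]
    by simp
  then have "norm (integral (cbox a b) (\<lambda>x. f x \<bullet> g x)) \<le> integral (cbox a b) (\<lambda>x. A * B)"
    using assms by (intro integral_norm_bound_integral L2_integrable) auto
  then show ?thesis by (simp add: L2_inner_def ac_simps)
qed

lemma L2_norm_bound:
  assumes "continuous_on (cbox a b) f" "\<And>x. x \<in> cbox a b \<Longrightarrow> norm (f x) \<le> A" "A \<ge> 0"
  shows "L2_norm a b f \<le> A * sqrt (measure lborel (cbox a b))"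
proof -
  have "L2_inner a b f f \<le> A * A * measure lborel (cbox a b)"
    using L2_inner_bound[OF assms(1,1) assms(2,2,3)] by simp
  then have "L2_norm a b f \<le> sqrt (A\<^sup>2 * measure lborel (cbox a b))"
    by (simp add: L2_norm_def power2_eq_square)
  then show ?thesis using assms(3) by (simp add: real_sqrt_mult)
qed

lemma L2_inner_eq_0D:
  fixes a b :: "real^'d" and f :: "real^'d \<Rightarrow> real^'m"
  assumes "\<And>i. a $ i < b $ i" "f \<in> V a b" "L2_inner a b f f = 0"
  shows "f = (\<lambda>x. 0)"
proof
  fix x
  obtain y where y: "y \<in> cbox a b" "\<And>f :: real^'d \<Rightarrow> real^'m. periodic a b f \<Longrightarrow> f x = f y"
    using periodic_representative[of a b x] assms(1) by metis
  have "box a b \<noteq> {}" using assms(1) by (simp add: interval_ne_empty_cart)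
  moreover have "continuous_on (cbox a b) (\<lambda>x. f x \<bullet> f x)"
    by (intro continuous_intros V_continuous[OF assms(2)])
  ultimately have "\<forall>x\<in>cbox a b. f x \<bullet> f x = 0"
    using integral_cbox_eq_0_iff[of a b "\<lambda>x. f x \<bullet> f x"] assms(3) by (simp add: L2_inner_def)
  then show "f x = 0" using y(1) y(2)[OF VD(2)[OF assms(2)]] by simp
qed

section \<open>Integration by parts\<close>

text \<open>
  The shifted box is cut along the face \<open>x $ i = b $ i\<close>. The part beyond this face, moved back by one period,
  fills the gap that the shift leaves at the opposite face.
\<close>

lemma integral_periodic_shift:
  fixes a b :: "real^'d" and h :: "real^'d \<Rightarrow> real"
  assumes "continuous_on UNIV h" "periodic a b h" "0 \<le> s" "s \<le> b $ i - a $ i"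
  shows "integral (cbox a b) (\<lambda>x. h (x + s *\<^sub>R axis i 1)) = integral (cbox a b) h"
proof -
  define l where "l = b $ i - a $ i"
  let ?e = "axis i 1 :: real^'d"
  have int: "h integrable_on cbox u v" for u v
    by (intro integrable_continuous continuous_on_subset[OF assms(1)]) auto
  have e: "?e \<in> Basis" by simp
  have nth: "x \<bullet> ?e = x $ i" for x by (simp add: inner_axis)
  have ax: "(r *\<^sub>R ?e) $ j = (if j = i then r else 0)" for r j
    by (simp add: axis_def)
  let ?p = "b - (l - s) *\<^sub>R ?e"
  have all: "(\<forall>j. P j) \<longleftrightarrow> P i \<and> (\<forall>j\<in>- {i}. P j)" for P by auto
  have sets1: "cbox (a + s *\<^sub>R ?e) (b + s *\<^sub>R ?e) \<inter> {x. x $ i \<le> b $ i} = cbox a b \<inter> {x. x $ i \<ge> a $ i + s}"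
    unfolding set_eq_iff Int_iff mem_box_cart mem_Collect_eq all
    using assms(3,4) by (simp add: axis_def cong: ball_cong) (smt (verit))
  have sets2: "cbox (a + s *\<^sub>R ?e) (b + s *\<^sub>R ?e) \<inter> {x. x $ i \<ge> b $ i} = cbox (a + l *\<^sub>R ?e) (?p + l *\<^sub>R ?e)"
    unfolding set_eq_iff Int_iff mem_box_cart mem_Collect_eq all
    using assms(3,4) by (simp add: axis_def l_def cong: ball_cong) (smt (verit))
  have sets3: "cbox a b \<inter> {x. x $ i \<le> a $ i + s} = cbox a ?p"
    unfolding set_eq_iff Int_iff mem_box_cart mem_Collect_eq all
    using assms(3,4) by (simp add: axis_def l_def cong: ball_cong) (smt (verit))
  have "integral (cbox a b) (\<lambda>x. h (x + s *\<^sub>R ?e)) = integral (cbox (a + s *\<^sub>R ?e) (b + s *\<^sub>R ?e)) h"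
    using integral_shift_cbox_plus[of a b h "s *\<^sub>R ?e"] by (simp add: comp_def add.commute)
  also have "\<dots> = integral (cbox a b \<inter> {x. x $ i \<ge> a $ i + s}) h
      + integral (cbox (a + l *\<^sub>R ?e) (?p + l *\<^sub>R ?e)) h"
    using integral_split[OF int e, of "a + s *\<^sub>R ?e" "b + s *\<^sub>R ?e" "b $ i"]
    unfolding nth sets1 sets2 .
  also have "integral (cbox (a + l *\<^sub>R ?e) (?p + l *\<^sub>R ?e)) h = integral (cbox a ?p) (\<lambda>x. h (x + l *\<^sub>R ?e))"
    using integral_shift_cbox_plus[of a ?p h "l *\<^sub>R ?e"] by (simp add: comp_def add.commute)
  also have "(\<lambda>x. h (x + l *\<^sub>R ?e)) = h"
  proof
    fix x
    have "l *\<^sub>R ?e = axis i (b $ i - a $ i)" by (simp add: vec_eq_iff axis_def l_def)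
    then show "h (x + l *\<^sub>R ?e) = h x" using assms(2) by (simp add: periodic_def)
  qed
  also have "integral (cbox a b \<inter> {x. x $ i \<ge> a $ i + s}) h + integral (cbox a ?p) h = integral (cbox a b) h"
    using integral_split[OF int e, of a b "a $ i + s"] unfolding nth sets3 by simp
  finally show ?thesis .
qed

text \<open>
  The integral is the derivative, at shift \<open>0\<close>, of the integral of the shifted function, which is constant.
\<close>

lemma integral_partial_deriv_periodic:
  fixes a b :: "real^'d" and h :: "real^'d \<Rightarrow> real"
  assumes "\<And>i. a $ i < b $ i" "smooth_on UNIV h" "periodic a b h"
  shows "integral (cbox a b) (dir_deriv (axis i 1) h) = 0"
proof -
  let ?e = "axis i 1 :: real^'d"
  define g where "g w = h (snd w + fst w *\<^sub>R ?e)" for w :: "real \<times> (real^'d)"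
  have "smooth_on UNIV g"
    unfolding g_def
    by (rule smooth_on_compose[OF assms(2)])
      (auto intro!: smooth_on_bounded_linear bounded_linear_intros)
  then have g: "smooth_on (UNIV \<times> UNIV) g" by simp
  let ?\<phi> = "\<lambda>s. integral (cbox a b) (\<lambda>x. g (s, x))"
  have cont: "continuous_on UNIV h" using assms(2) by (rule smooth_on_continuous_on) simp
  have pos: "?\<phi> s = ?\<phi> 0" if "0 \<le> s" "s \<le> b $ i - a $ i" for s
    using integral_periodic_shift[OF cont assms(3) that] by (simp add: g_def)
  have neg: "?\<phi> s = ?\<phi> 0" if "s \<le> 0" "- s \<le> b $ i - a $ i" for s
  proof -
    have "integral (cbox a b) (\<lambda>x. h (x + (- s) *\<^sub>R ?e + s *\<^sub>R ?e)) = integral (cbox a b) (\<lambda>x. h (x + s *\<^sub>R ?e))"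
    proof (rule integral_periodic_shift[where h = "\<lambda>x. h (x + s *\<^sub>R ?e)"])
      show "continuous_on UNIV (\<lambda>x. h (x + s *\<^sub>R ?e))"
        by (rule continuous_on_compose2[OF cont]) (auto intro!: continuous_intros)
      show "periodic a b (\<lambda>x. h (x + s *\<^sub>R ?e))"
        using assms(3) unfolding periodic_def by (metis add.assoc add.commute)
    qed (use that in auto)
    then show ?thesis by (simp add: g_def)
  qed
  have const: "?\<phi> s = ?\<phi> 0" if "s \<in> {- (b $ i - a $ i)<..<b $ i - a $ i}" for s
    using pos[of s] neg[of s] that by (cases "s \<ge> 0") auto
  have "dir_deriv 1 ?\<phi> 0 = dir_deriv 1 (\<lambda>s. ?\<phi> 0) (0::real)"
    by (rule dir_deriv_cong_open[of "{- (b $ i - a $ i)<..<b $ i - a $ i}", OF _ _ const])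
      (use assms(1)[of i] in auto)
  also have "\<dots> = 0" by (rule dir_derivI[of "\<lambda>s. ?\<phi> 0" "\<lambda>s. 0"]) simp
  finally have "integral (cbox a b) (\<lambda>x. dir_deriv (1, 0) g (0, x)) = 0"
    using dir_deriv_integral_param[OF open_UNIV g, of 0 1 a b] by simp
  moreover have "dir_deriv (1, 0) g (0, x) = dir_deriv ?e h x" for x
  proof (rule dir_derivI[of g "\<lambda>w. dir_deriv (snd w + fst w *\<^sub>R ?e) h x" "(0, x)" "(1, 0)", simplified])
    have "((\<lambda>w::real \<times> (real^'d). snd w + fst w *\<^sub>R ?e) has_derivative (\<lambda>w. snd w + fst w *\<^sub>R ?e)) (at (0, x))"
      by (intro bounded_linear_imp_has_derivative bounded_linear_intros)
    from has_derivative_compose[OF this, of h "\<lambda>v. dir_deriv v h x"]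
    show "(g has_derivative (\<lambda>w. dir_deriv (snd w + fst w *\<^sub>R ?e) h x)) (at (0, x))"
      using has_derivative_dir_deriv[OF smooth_on_differentiable[OF assms(2)], of x]
      unfolding g_def by simp
  qed
  ultimately show ?thesis by simp
qed

lemma dir_deriv_mult:
  fixes f g :: "'a::real_normed_vector \<Rightarrow> real"
  assumes "f differentiable at x" "g differentiable at x"
  shows "dir_deriv v (\<lambda>x. f x * g x) x = f x * dir_deriv v g x + dir_deriv v f x * g x"
  using dir_derivI[OF has_derivative_mult[OF assms[THEN has_derivative_dir_deriv]]] .

lemma integration_by_parts_periodic:
  fixes a b :: "real^'d" and f g :: "real^'d \<Rightarrow> real"
  assumes ab: "\<And>i. a $ i < b $ i"
    and f: "smooth_on UNIV f" "periodic a b f" and g: "smooth_on UNIV g" "periodic a b g"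
  shows "integral (cbox a b) (\<lambda>x. f x * dir_deriv (axis i 1) g x) =
    - integral (cbox a b) (\<lambda>x. dir_deriv (axis i 1) f x * g x)"
proof -
  let ?D = "dir_deriv (axis i 1)"
  have int: "(\<lambda>x. f' x * g' x) integrable_on cbox a b"
    if "smooth_on UNIV f'" "smooth_on UNIV g'" for f' g' :: "real^'d \<Rightarrow> real"
    using that by (intro integrable_continuous continuous_on_mult) (auto intro: smooth_on_continuous_on)
  have "0 = integral (cbox a b) (?D (\<lambda>x. f x * g x))"
    using f g by (intro integral_partial_deriv_periodic[symmetric] ab
        smooth_on_bilinear[OF _ bounded_bilinear_mult]) (auto simp: periodic_def)
  also have "?D (\<lambda>x. f x * g x) = (\<lambda>x. f x * ?D g x + ?D f x * g x)"
    using dir_deriv_mult smooth_on_differentiable[OF f(1)] smooth_on_differentiable[OF g(1)] by blast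
  also have "integral (cbox a b) \<dots> =
      integral (cbox a b) (\<lambda>x. f x * ?D g x) + integral (cbox a b) (\<lambda>x. ?D f x * g x)"
    using f g smooth_on_dir_deriv by (intro integral_add int) blast+
  finally show ?thesis by simp
qed

lemma partial_deriv_Cons: "partial_deriv (i # is) f = dir_deriv (axis i 1) (partial_deriv is f)"
  by (simp add: partial_deriv_def)

lemma partial_deriv_snoc: "partial_deriv (is @ [i]) f = partial_deriv is (dir_deriv (axis i 1) f)"
  by (simp add: partial_deriv_def)

lemma smooth_on_partial_deriv: "smooth_on S f \<Longrightarrow> smooth_on S (partial_deriv is f)"
  by (simp add: partial_deriv_def smooth_on_foldr)

lemma periodic_partial_deriv:
  "smooth_on UNIV f \<Longrightarrow> periodic a b f \<Longrightarrow> periodic a b (partial_deriv is f)"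
  by (simp add: partial_deriv_def periodic_foldr_dir_deriv)

lemma iterated_integration_by_parts:
  fixes a b :: "real^'d" and f g :: "real^'d \<Rightarrow> real"
  assumes ab: "\<And>i. a $ i < b $ i"
    and f: "smooth_on UNIV f" "periodic a b f" and g: "smooth_on UNIV g" "periodic a b g"
  shows "integral (cbox a b) (\<lambda>x. f x * partial_deriv is g x) =
    (-1) ^ length is * integral (cbox a b) (\<lambda>x. partial_deriv (rev is) f x * g x)"
  using f
proof (induction "is" arbitrary: f)
  case (Cons i "is")
  have "integral (cbox a b) (\<lambda>x. f x * partial_deriv (i # is) g x) =
      - integral (cbox a b) (\<lambda>x. dir_deriv (axis i 1) f x * partial_deriv is g x)"
    unfolding partial_deriv_Cons
    by (intro integration_by_parts_periodic ab Cons.prems smooth_on_partial_deriv periodic_partial_deriv g)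
  also have "\<dots> = (-1) ^ length (i # is) *
      integral (cbox a b) (\<lambda>x. partial_deriv (rev is) (dir_deriv (axis i 1) f) x * g x)"
    using Cons.IH[of "dir_deriv (axis i 1) f"] Cons.prems
    by (simp add: smooth_on_dir_deriv periodic_dir_deriv)
  finally show ?case by (simp add: partial_deriv_snoc)
qed (simp add: partial_deriv_def)

section \<open>The variational derivative\<close>

definition jet :: "('k \<Rightarrow> 'd list) \<Rightarrow> ('k \<Rightarrow> 'm) \<Rightarrow> (real^'d \<Rightarrow> real^'m) \<Rightarrow> real^'d \<Rightarrow> real^'k" where
  "jet \<alpha> c z x = (\<chi> j. partial_deriv (\<alpha> j) (\<lambda>y. z y $ c j) x)"

text \<open>
  The classical expression \<open>\<Sum>\<^sub>j (-1)\<^sup>|\<^sup>\<alpha>\<^sup>j\<^sup>| \<partial>\<^sup>\<alpha>\<^sup>j (\<partial>F/\<partial>u\<^sub>j)\<close>, the \<open>j\<close>-th term contributing to the component \<open>c j\<close>.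
  The list of directions is reversed because integration by parts removes the outermost derivative first.
\<close>

definition euler_lagrange ::
    "(real^'k \<Rightarrow> real) \<Rightarrow> ('k \<Rightarrow> 'd list) \<Rightarrow> ('k \<Rightarrow> 'm) \<Rightarrow> (real^'d \<Rightarrow> real^'m) \<Rightarrow> real^'d \<Rightarrow> real^'m" where
  "euler_lagrange F \<alpha> c z x = (\<Sum>j\<in>UNIV. ((-1) ^ length (\<alpha> j) *
     partial_deriv (rev (\<alpha> j)) (\<lambda>y. dir_deriv (axis j 1) F (jet \<alpha> c z y)) x) *\<^sub>R axis (c j) 1)"

lemma partial_deriv_slice:
  assumes "smooth_on (P \<times> UNIV) g" "p \<in> P"
  shows "partial_deriv is (\<lambda>y. g (p, y)) x = foldr dir_deriv (map (\<lambda>i. (0, axis i 1)) is) g (p, x)"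
  using foldr_dir_deriv_slice[OF assms, of "map (\<lambda>i. axis i 1) is"]
  by (simp add: partial_deriv_def comp_def)

lemma smooth_on_partial_deriv_param:
  assumes "open P" "smooth_on (P \<times> UNIV) g"
  shows "smooth_on (P \<times> UNIV) (\<lambda>w. partial_deriv is (\<lambda>y. g (fst w, y)) (snd w))"
  by (rule smooth_on_cong[OF smooth_on_foldr[OF assms(2), of "map (\<lambda>i. (0, axis i 1)) is"]])
    (auto simp: partial_deriv_slice[OF assms(2)] open_Times assms(1))

lemma smooth_on_component:
  fixes f :: "'a::real_normed_vector \<Rightarrow> real^'m"
  assumes "open S" "smooth_on S f"
  shows "smooth_on S (\<lambda>x. f x $ i)"
  by (rule smooth_on_linear_compose[OF bounded_linear_vec_nth assms])

lemma smooth_on_jet_param: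
  fixes Z :: "'p::euclidean_space \<times> (real^'d) \<Rightarrow> real^'m"
  assumes "open P" "smooth_on (P \<times> UNIV) Z"
  shows "smooth_on (P \<times> UNIV) (\<lambda>w. jet \<alpha> c (\<lambda>y. Z (fst w, y)) (snd w))"
  unfolding jet_def
  by (intro smooth_on_vec_lambda smooth_on_partial_deriv_param[where g = "\<lambda>w. Z w $ _"]
      smooth_on_component open_Times assms open_UNIV)

lemma smooth_on_density_param:
  fixes Z :: "'p::euclidean_space \<times> (real^'d) \<Rightarrow> real^'m" and G :: "real^'k \<Rightarrow> real"
  assumes "open P" "smooth_on (P \<times> UNIV) Z" "smooth_on UNIV G"
  shows "smooth_on (P \<times> UNIV) (\<lambda>w. G (jet \<alpha> c (\<lambda>y. Z (fst w, y)) (snd w)))"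
  using smooth_on_compose[OF assms(3) _ smooth_on_jet_param[OF assms(1,2)]] assms(1)
  by (simp add: open_Times)

lemma smooth_on_euler_lagrange_param:
  fixes Z :: "'p::euclidean_space \<times> (real^'d) \<Rightarrow> real^'m" and F :: "real^'k \<Rightarrow> real"
  assumes "open P" "smooth_on (P \<times> UNIV) Z" "smooth_on UNIV F"
  shows "smooth_on (P \<times> UNIV) (\<lambda>w. euler_lagrange F \<alpha> c (\<lambda>y. Z (fst w, y)) (snd w))"
proof -
  have "smooth_on (P \<times> UNIV) (\<lambda>w. partial_deriv (rev (\<alpha> j))
      (\<lambda>y. dir_deriv (axis j 1) F (jet \<alpha> c (\<lambda>y. Z (fst w, y)) y)) (snd w))" for j
    using smooth_on_partial_deriv_param[OF assms(1)
        smooth_on_density_param[OF assms(1,2) smooth_on_dir_deriv[OF assms(3)]]] by simp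
  then show ?thesis
    unfolding euler_lagrange_def
    by (intro smooth_on_sum smooth_on_scaleR smooth_on_bilinear[OF _ bounded_bilinear_mult]
        smooth_on_const open_Times assms open_UNIV)
qed

lemma smooth_on_jet:
  fixes z :: "real^'d \<Rightarrow> real^'m"
  assumes "smooth_on UNIV z"
  shows "smooth_on UNIV (jet \<alpha> c z)"
  unfolding jet_def
  by (intro smooth_on_vec_lambda smooth_on_partial_deriv smooth_on_component assms open_UNIV)

lemma periodic_jet:
  fixes z :: "real^'d \<Rightarrow> real^'m"
  assumes "smooth_on UNIV z" "periodic a b z"
  shows "periodic a b (jet \<alpha> c z)"
proof -
  have "periodic a b (partial_deriv (\<alpha> j) (\<lambda>y. z y $ c j))" for j
    using assms(2) by (intro periodic_partial_deriv smooth_on_component assms) (auto simp: periodic_def)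
  then show ?thesis by (simp add: periodic_def jet_def)
qed

lemma euler_lagrange_V:
  fixes z :: "real^'d \<Rightarrow> real^'m"
  assumes "smooth_on UNIV F" "z \<in> V a b"
  shows "euler_lagrange F \<alpha> c z \<in> V a b"
proof -
  have 1: "smooth_on UNIV (\<lambda>y. dir_deriv (axis j 1) F (jet \<alpha> c z y))" for j
    by (rule smooth_on_compose[OF smooth_on_dir_deriv[OF assms(1)] _ smooth_on_jet[OF VD(1)[OF assms(2)]]]) auto
  have 2: "periodic a b (\<lambda>y. dir_deriv (axis j 1) F (jet \<alpha> c z y))" for j
    using periodic_jet[OF VD[OF assms(2)], of \<alpha> c] by (simp add: periodic_def)
  have "smooth_on UNIV (euler_lagrange F \<alpha> c z)"
    unfolding euler_lagrange_def
    by (intro smooth_on_sum smooth_on_scaleR smooth_on_bilinear[OF _ bounded_bilinear_mult]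
        smooth_on_const open_UNIV smooth_on_partial_deriv 1)
  moreover have "periodic a b (euler_lagrange F \<alpha> c z)"
    using periodic_partial_deriv[OF 1 2] by (simp add: periodic_def euler_lagrange_def)
  ultimately show ?thesis by (simp add: V_iff)
qed

lemma dir_deriv_eq_sum_axis:
  fixes F :: "real^'k \<Rightarrow> 'b::real_normed_vector"
  assumes "F differentiable at x"
  shows "dir_deriv v F x = (\<Sum>j\<in>UNIV. (v $ j) *\<^sub>R dir_deriv (axis j 1) F x)"
proof -
  interpret linear "\<lambda>v. dir_deriv v F x"
    using has_derivative_dir_deriv[OF assms] by (rule has_derivative_linear)
  have "dir_deriv v F x = dir_deriv (\<Sum>j\<in>UNIV. (v $ j) *\<^sub>R axis j 1) F x"
    using basis_expansion[of v] by (simp add: scalar_mult_eq_scaleR)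
  also have "\<dots> = (\<Sum>j\<in>UNIV. (v $ j) *\<^sub>R dir_deriv (axis j 1) F x)"
    by (simp add: sum scale)
  finally show ?thesis .
qed

lemma jet_add_scaleR:
  fixes z v :: "real^'d \<Rightarrow> real^'m"
  assumes "smooth_on UNIV z" "smooth_on UNIV v"
  shows "jet \<alpha> c (\<lambda>x. z x + r *\<^sub>R v x) x = jet \<alpha> c z x + r *\<^sub>R jet \<alpha> c v x"
proof -
  have "partial_deriv (\<alpha> j) (\<lambda>y. z y $ c j + r * v y $ c j) x =
      partial_deriv (\<alpha> j) (\<lambda>y. z y $ c j) x + r * partial_deriv (\<alpha> j) (\<lambda>y. v y $ c j) x" for j
    unfolding partial_deriv_def
    by (subst foldr_dir_deriv_add[OF open_UNIV],
        intro smooth_on_component open_UNIV assms,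
        intro smooth_on_bilinear[OF _ bounded_bilinear_mult] smooth_on_const smooth_on_component open_UNIV assms,
        simp, subst foldr_dir_deriv_linear[OF open_UNIV _ bounded_linear_mult_right])
      (auto intro: smooth_on_component assms)
  then show ?thesis by (simp add: jet_def vec_eq_iff)
qed

lemma has_real_derivative_at_1:
  fixes f :: "real \<Rightarrow> real"
  assumes "(f has_derivative f') F"
  shows "(f has_real_derivative f' 1) F"
proof -
  interpret linear f' using assms by (rule has_derivative_linear)
  have "f' s = f' 1 * s" for s using scale[of s 1] by (simp add: mult.commute)
  then have "f' = (*) (f' 1)" by (rule ext)
  then show ?thesis using assms unfolding has_field_derivative_def by metis
qed

text \<open>
  Differentiation under the integral sign gives \<open>\<Sum>\<^sub>j (\<partial>F/\<partial>u\<^sub>j) \<partial>\<^sup>\<alpha>\<^sup>j v\<close>, and integration by parts moves the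
  derivatives off \<open>v\<close>.
\<close>

lemma density_integral_has_derivative:
  fixes z v :: "real^'d \<Rightarrow> real^'m" and F :: "real^'k \<Rightarrow> real"
  assumes ab: "\<And>i. a $ i < b $ i" and F: "smooth_on UNIV F" and z: "z \<in> V a b" and v: "v \<in> V a b"
  shows "((\<lambda>\<epsilon>. integral (cbox a b) (\<lambda>x. F (jet \<alpha> c (\<lambda>x. z x + \<epsilon> *\<^sub>R v x) x)))
    has_real_derivative L2_inner a b (euler_lagrange F \<alpha> c z) v) (at 0)"
proof -
  define g where "g w = F (jet \<alpha> c z (snd w) + fst w *\<^sub>R jet \<alpha> c v (snd w))" for w :: "real \<times> (real^'d)"
  note zs = VD(1)[OF z] and vs = VD(1)[OF v]
  have sm_snd: "smooth_on UNIV (\<lambda>w :: real \<times> (real^'d). f (snd w))" if "smooth_on UNIV f" for f :: "real^'d \<Rightarrow> real^'k"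
    by (rule smooth_on_compose[OF that]) (auto intro: smooth_on_bounded_linear bounded_linear_snd)
  have "smooth_on UNIV (\<lambda>w. jet \<alpha> c z (snd w) + fst w *\<^sub>R jet \<alpha> c v (snd w) :: real^'k)"
    by (intro smooth_on_add smooth_on_scaleR sm_snd smooth_on_jet zs vs open_UNIV
        smooth_on_bounded_linear bounded_linear_fst)
  then have "smooth_on UNIV g"
    unfolding g_def by (intro smooth_on_compose[OF F]) auto
  then have g: "smooth_on (UNIV \<times> UNIV) g" by simp
  define G where "G j x = dir_deriv (axis j 1) F (jet \<alpha> c z x)" for j x
  have G: "smooth_on UNIV (G j)" "periodic a b (G j)" for j
    unfolding G_def using periodic_jet[OF VD[OF z], of \<alpha> c]
    by (auto intro!: smooth_on_compose[OF smooth_on_dir_deriv[OF F]] smooth_on_jet zs simp: periodic_def)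
  have vc: "smooth_on UNIV (\<lambda>y. v y $ c j)" "periodic a b (\<lambda>y. v y $ c j)" for j
    using VD(2)[OF v] by (auto intro: smooth_on_component vs simp: periodic_def)
  have int: "(\<lambda>x. f' x * g' x) integrable_on cbox a b"
    if "smooth_on UNIV f'" "smooth_on UNIV g'" for f' g' :: "real^'d \<Rightarrow> real"
    using that by (intro integrable_continuous continuous_on_mult) (auto intro: smooth_on_continuous_on)
  have der: "dir_deriv (1, 0) g (0, x) = (\<Sum>j\<in>UNIV. G j x * partial_deriv (\<alpha> j) (\<lambda>y. v y $ c j) x)" for x
  proof -
    have Fd: "F differentiable at (jet \<alpha> c z x)"
      using smooth_on_differentiable[OF F] by simp
    have "((\<lambda>\<epsilon>. g (\<epsilon>, x)) has_derivative (\<lambda>s. dir_deriv (s, 0) g (0, x))) (at 0)"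
      using smooth_on_differentiable[OF g] by (intro has_derivative_slice_param) auto
    from dir_derivI[OF this, of 1]
    have "dir_deriv (1, 0) g (0, x) = dir_deriv 1 (\<lambda>\<epsilon>. g (\<epsilon>, x)) 0" by simp
    also have "\<dots> = dir_deriv (1 *\<^sub>R jet \<alpha> c v x) F (jet \<alpha> c z x)"
    proof (rule dir_derivI[where f' = "\<lambda>s. dir_deriv (s *\<^sub>R jet \<alpha> c v x) F (jet \<alpha> c z x)"])
      have "((\<lambda>\<epsilon>. jet \<alpha> c z x + \<epsilon> *\<^sub>R jet \<alpha> c v x) has_derivative (\<lambda>s. s *\<^sub>R jet \<alpha> c v x)) (at 0)"
        by (auto intro!: derivative_eq_intros)
      from has_derivative_compose[OF this, of F "\<lambda>w. dir_deriv w F (jet \<alpha> c z x)"]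
      show "((\<lambda>\<epsilon>. g (\<epsilon>, x)) has_derivative (\<lambda>s. dir_deriv (s *\<^sub>R jet \<alpha> c v x) F (jet \<alpha> c z x))) (at 0)"
        using has_derivative_dir_deriv[OF Fd] by (simp add: g_def)
    qed
    also have "\<dots> = (\<Sum>j\<in>UNIV. (1 *\<^sub>R jet \<alpha> c v x) $ j *\<^sub>R G j x)"
      unfolding G_def by (rule dir_deriv_eq_sum_axis[OF Fd])
    finally show ?thesis by (simp add: jet_def mult.commute)
  qed
  have "((\<lambda>\<epsilon>. integral (cbox a b) (\<lambda>x. g (\<epsilon>, x))) has_derivative
      (\<lambda>s. integral (cbox a b) (\<lambda>x. dir_deriv (s, 0) g (0, x)))) (at 0)"
    by (rule has_derivative_integral_param[OF open_UNIV g]) simp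
  from has_real_derivative_at_1[OF this] have "((\<lambda>\<epsilon>. integral (cbox a b) (\<lambda>x. g (\<epsilon>, x))) has_real_derivative
      integral (cbox a b) (\<lambda>x. dir_deriv (1, 0) g (0, x))) (at 0)"
    .
  moreover have "g (\<epsilon>, x) = F (jet \<alpha> c (\<lambda>x. z x + \<epsilon> *\<^sub>R v x) x)" for \<epsilon> x
    by (simp add: g_def jet_add_scaleR[OF zs vs])
  moreover have "integral (cbox a b) (\<lambda>x. dir_deriv (1, 0) g (0, x)) = L2_inner a b (euler_lagrange F \<alpha> c z) v"
  proof -
    have "integral (cbox a b) (\<lambda>x. dir_deriv (1, 0) g (0, x)) =
        (\<Sum>j\<in>UNIV. integral (cbox a b) (\<lambda>x. G j x * partial_deriv (\<alpha> j) (\<lambda>y. v y $ c j) x))"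
      unfolding der by (intro integral_sum int G smooth_on_partial_deriv vc) auto
    also have "\<dots> = (\<Sum>j\<in>UNIV. integral (cbox a b)
        (\<lambda>x. (-1) ^ length (\<alpha> j) * (partial_deriv (rev (\<alpha> j)) (G j) x * v x $ c j)))"
      using iterated_integration_by_parts[OF ab G vc] by simp
    also have "\<dots> = integral (cbox a b)
        (\<lambda>x. \<Sum>j\<in>UNIV. (-1) ^ length (\<alpha> j) * (partial_deriv (rev (\<alpha> j)) (G j) x * v x $ c j))"
      by (intro integral_sum[symmetric] integrable_on_mult_right int G smooth_on_partial_deriv vc) auto
    also have "(\<lambda>x. \<Sum>j\<in>UNIV. (-1) ^ length (\<alpha> j) * (partial_deriv (rev (\<alpha> j)) (G j) x * v x $ c j)) =
        (\<lambda>x. euler_lagrange F \<alpha> c z x \<bullet> v x)"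
      by (simp add: euler_lagrange_def inner_sum_left inner_axis' G_def[abs_def] mult.assoc)
    finally show ?thesis by (simp add: L2_inner_def)
  qed
  ultimately show ?thesis by simp
qed

text \<open>
  The difference \<open>w\<close> of the two sides lies in \<open>V\<close>, so it is an admissible direction; both sides have the same
  inner product with it, whence \<open>(w, w) = 0\<close>.
\<close>

lemma variational_derivative_eq:
  fixes z :: "real^'d \<Rightarrow> real^'m" and F :: "real^'k \<Rightarrow> real"
  assumes ab: "\<And>i. a $ i < b $ i" and F: "smooth_on UNIV F"
    and N: "\<And>z. z \<in> V a b \<Longrightarrow> N z = energy_density F \<alpha> c z"
    and N': "variational_derivative a b (H2 a b N) N'" and z: "z \<in> V a b"
  shows "N' z = euler_lagrange F \<alpha> c z"
proof -
  define w where "w = (\<lambda>x. N' z x - euler_lagrange F \<alpha> c z x)"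
  have N'z: "N' z \<in> V a b" using N' z by (simp add: variational_derivative_def)
  have EL: "euler_lagrange F \<alpha> c z \<in> V a b" by (rule euler_lagrange_V[OF F z])
  have w: "w \<in> V a b" unfolding w_def by (rule V_diff[OF N'z EL])
  have "H2 a b N (\<lambda>x. z x + \<epsilon> *\<^sub>R w x) = integral (cbox a b) (\<lambda>x. F (jet \<alpha> c (\<lambda>x. z x + \<epsilon> *\<^sub>R w x) x))" for \<epsilon>
    using N[OF V_add[OF z V_scaleR[OF w]]] by (simp add: H2_def L2_inner_def energy_density_def[abs_def] jet_def)
  then have "((\<lambda>\<epsilon>. H2 a b N (\<lambda>x. z x + \<epsilon> *\<^sub>R w x)) has_real_derivative
      L2_inner a b (euler_lagrange F \<alpha> c z) w) (at 0)"
    using density_integral_has_derivative[OF ab F z w] by simp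
  moreover have "((\<lambda>\<epsilon>. H2 a b N (\<lambda>x. z x + \<epsilon> *\<^sub>R w x)) has_real_derivative
      L2_inner a b (N' z) w) (at 0)"
    using N' z w by (simp add: variational_derivative_def)
  ultimately have "L2_inner a b (N' z) w = L2_inner a b (euler_lagrange F \<alpha> c z) w"
    using DERIV_unique by blast
  then have "L2_inner a b w w = 0"
    unfolding w_def
    using L2_inner_diff_left[OF V_continuous[OF N'z] V_continuous[OF EL] V_continuous[OF w]]
    by (simp add: w_def)
  then have "w = (\<lambda>x. 0)" by (rule L2_inner_eq_0D[OF ab w])
  then show ?thesis by (auto simp: w_def fun_eq_iff)
qed

section \<open>Automatic continuity of operators that possess an adjoint\<close>

text \<open>
  Term sequences of series that converge, with all derivatives, by the M-test.
\<close>

definition dominated_derivs :: "(nat \<Rightarrow> 'a::real_normed_vector \<Rightarrow> 'b::real_normed_vector) \<Rightarrow> bool" where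
  "dominated_derivs u \<longleftrightarrow> (\<forall>k. smooth_on UNIV (u k)) \<and>
     (\<forall>vs. \<exists>B. summable B \<and> (\<forall>k x. norm (foldr dir_deriv vs (u k) x) \<le> B k))"

lemma dominated_derivs_dir_deriv:
  assumes "dominated_derivs u"
  shows "dominated_derivs (\<lambda>k. dir_deriv v (u k))"
  unfolding dominated_derivs_def
proof (intro conjI allI)
  fix vs
  have "\<exists>B. summable B \<and> (\<forall>k x. norm (foldr dir_deriv (vs @ [v]) (u k) x) \<le> B k)"
    using assms unfolding dominated_derivs_def by blast
  then show "\<exists>B. summable B \<and> (\<forall>k x. norm (foldr dir_deriv vs (dir_deriv v (u k)) x) \<le> B k)"
    by simp
qed (use assms in \<open>simp add: dominated_derivs_def smooth_on_dir_deriv\<close>)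

lemma dominated_derivs_bound:
  assumes "dominated_derivs u"
  shows "\<exists>B. summable B \<and> (\<forall>k x. norm (u k x) \<le> B k)"
proof -
  have "\<exists>B. summable B \<and> (\<forall>k x. norm (foldr dir_deriv [] (u k) x) \<le> B k)"
    using assms unfolding dominated_derivs_def by blast
  then show ?thesis by simp
qed

lemma dominated_derivs_sums:
  fixes u :: "nat \<Rightarrow> 'a::real_normed_vector \<Rightarrow> 'b::banach"
  assumes "dominated_derivs u"
  shows "(\<lambda>k. u k x) sums (\<Sum>k. u k x)"
proof -
  obtain B where "summable B" "\<And>k x. norm (u k x) \<le> B k"
    using dominated_derivs_bound[OF assms] by blast
  then have "summable (\<lambda>k. u k x)" by (rule summable_comparison_test'[where N = 0])
  then show ?thesis by (rule summable_sums)
qed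

lemma has_derivative_dominated_series:
  fixes u :: "nat \<Rightarrow> 'a::euclidean_space \<Rightarrow> 'b::banach"
  assumes "dominated_derivs u"
  shows "((\<lambda>x. \<Sum>k. u k x) has_derivative (\<lambda>h. \<Sum>k. dir_deriv h (u k) x)) (at x)"
proof -
  define g' where "g' x h = (\<Sum>b\<in>Basis. (h \<bullet> b) *\<^sub>R (\<Sum>k. dir_deriv b (u k) x))" for x h
  have diff: "u k differentiable at x" for k x
    using assms smooth_on_differentiable by (auto simp: dominated_derivs_def)
  note sums = dominated_derivs_sums[OF dominated_derivs_dir_deriv[OF assms]]
  have "(\<lambda>k. \<Sum>b\<in>Basis. (h \<bullet> b) *\<^sub>R dir_deriv b (u k) x) sums g' x h" for x h
    unfolding g'_def by (intro sums_sum sums_scaleR_right sums)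
  then have "(\<lambda>k. dir_deriv h (u k) x) sums g' x h" for x h
    using dir_deriv_eq_sum_Basis[OF diff, of h _ x] by simp
  then have g': "g' x h = (\<Sum>k. dir_deriv h (u k) x)" for x h
    by (rule sums_unique)
  have "\<exists>g. \<forall>x\<in>UNIV. (\<lambda>n. u n x) sums g x \<and> (g has_derivative g' x) (at x within UNIV)"
  proof (rule has_derivative_series[where f' = "\<lambda>n x h. dir_deriv h (u n) x"])
    fix e :: real assume "e > 0"
    define d where "d = e / real DIM('a)"
    have "d > 0" using \<open>e > 0\<close> by (simp add: d_def)
    have "\<forall>\<^sub>F n in sequentially. \<forall>x\<in>UNIV.
        norm ((\<Sum>i<n. dir_deriv b (u i) x) - (\<Sum>k. dir_deriv b (u k) x)) < d" for b
    proof -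
      obtain B where B: "summable B" "\<And>k x. norm (dir_deriv b (u k) x) \<le> B k"
        using dominated_derivs_bound[OF dominated_derivs_dir_deriv[OF assms]] by blast
      have "uniform_limit UNIV (\<lambda>n x. \<Sum>i<n. dir_deriv b (u i) x) (\<lambda>x. \<Sum>k. dir_deriv b (u k) x) sequentially"
        by (rule Weierstrass_m_test[OF B(2,1)])
      from uniform_limitD[OF this \<open>d > 0\<close>] show ?thesis by (simp add: dist_norm)
    qed
    then have "\<forall>\<^sub>F n in sequentially. \<forall>b\<in>Basis. \<forall>x\<in>UNIV.
        norm ((\<Sum>i<n. dir_deriv b (u i) x) - (\<Sum>k. dir_deriv b (u k) x)) < d"
      by (intro eventually_ball_finite) auto
    then show "\<forall>\<^sub>F n in sequentially. \<forall>x\<in>UNIV. \<forall>h.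
        norm ((\<Sum>i<n. dir_deriv h (u i) x) - g' x h) \<le> e * norm h"
    proof eventually_elim
      case (elim n)
      show ?case
      proof (intro ballI allI)
        fix x h
        have "(\<Sum>i<n. dir_deriv h (u i) x) = (\<Sum>i<n. \<Sum>b\<in>Basis. (h \<bullet> b) *\<^sub>R dir_deriv b (u i) x)"
          by (intro sum.cong refl dir_deriv_eq_sum_Basis diff)
        also have "\<dots> = (\<Sum>b\<in>Basis. (h \<bullet> b) *\<^sub>R (\<Sum>i<n. dir_deriv b (u i) x))"
          by (subst sum.swap) (simp add: scaleR_sum_right)
        finally have "(\<Sum>i<n. dir_deriv h (u i) x) - g' x h =
            (\<Sum>b\<in>Basis. (h \<bullet> b) *\<^sub>R ((\<Sum>i<n. dir_deriv b (u i) x) - (\<Sum>k. dir_deriv b (u k) x)))"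
          by (simp add: g'_def sum_subtractf scaleR_diff_right)
        also have "norm \<dots> \<le> (\<Sum>b\<in>(Basis :: 'a set). norm h * d)"
        proof (intro sum_norm_le)
          fix b :: 'a assume b: "b \<in> Basis"
          have "norm ((\<Sum>i<n. dir_deriv b (u i) x) - (\<Sum>k. dir_deriv b (u k) x)) \<le> d"
            using elim b by (simp add: less_imp_le)
          then show "norm ((h \<bullet> b) *\<^sub>R ((\<Sum>i<n. dir_deriv b (u i) x) - (\<Sum>k. dir_deriv b (u k) x)))
              \<le> norm h * d"
            using Basis_le_norm[OF b, of h] by (auto intro!: mult_mono)
        qed
        also have "\<dots> = e * norm h" by (simp add: d_def)
        finally show "norm ((\<Sum>i<n. dir_deriv h (u i) x) - g' x h) \<le> e * norm h" .
      qed
    qed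
  qed (use has_derivative_dir_deriv[OF diff] dominated_derivs_sums[OF assms] in auto)
  then obtain g where g: "\<And>x. (\<lambda>n. u n x) sums g x" "\<And>x. (g has_derivative g' x) (at x)" by auto
  have "g = (\<lambda>x. \<Sum>k. u k x)" using g(1) by (auto intro: sums_unique)
  moreover have "g' x = (\<lambda>h. \<Sum>k. dir_deriv h (u k) x)" by (rule ext) (rule g')
  ultimately show ?thesis using g(2)[of x] by simp
qed

lemma smooth_on_dominated_series:
  fixes u :: "nat \<Rightarrow> 'a::euclidean_space \<Rightarrow> 'b::banach"
  assumes "dominated_derivs u"
  shows "smooth_on UNIV (\<lambda>x. \<Sum>k. u k x)"
proof -
  have "diff_order n UNIV (\<lambda>x. \<Sum>k. u k x)" for n
    using assms
  proof (induction n arbitrary: u)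
    case (Suc n)
    have "dir_deriv v (\<lambda>x. \<Sum>k. u k x) = (\<lambda>x. \<Sum>k. dir_deriv v (u k) x)" for v
      using dir_derivI[OF has_derivative_dominated_series[OF Suc.prems]] by blast
    moreover have "(\<lambda>x. \<Sum>k. u k x) differentiable at x" for x
      using has_derivative_dominated_series[OF Suc.prems] unfolding differentiable_def by blast
    ultimately show ?case using Suc.IH[OF dominated_derivs_dir_deriv[OF Suc.prems]] by simp
  qed simp
  then show ?thesis by (simp add: smooth_on_iff_diff_order)
qed

text \<open>
  On subsets of \<open>V\<close> this is boundedness in the Frechet space topology of \<open>V\<close>.
\<close>

definition derivs_bounded :: "('a::real_normed_vector \<Rightarrow> 'b::real_normed_vector) set \<Rightarrow> bool" where
  "derivs_bounded W \<longleftrightarrow> (\<forall>vs. \<exists>M. \<forall>f\<in>W. \<forall>x. norm (foldr dir_deriv vs f x) \<le> M)"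

lemma V_bounded_series:
  fixes w :: "nat \<Rightarrow> real^'d \<Rightarrow> real^'m"
  assumes "derivs_bounded W" "W \<subseteq> V a b" "\<And>k. w k \<in> W" "summable (\<lambda>k. \<bar>c k :: real\<bar>)"
  shows "(\<lambda>x. \<Sum>k. c k *\<^sub>R w k x) \<in> V a b"
proof -
  have w: "w k \<in> V a b" for k using assms by blast
  have "dominated_derivs (\<lambda>k x. c k *\<^sub>R w k x)"
    unfolding dominated_derivs_def
  proof (intro conjI allI)
    show "smooth_on UNIV (\<lambda>x. c k *\<^sub>R w k x)" for k
      by (rule VD(1)[OF V_scaleR[OF w]])
    fix vs
    obtain M where M: "\<And>k x. norm (foldr dir_deriv vs (w k) x) \<le> M"
      using assms(1,3) unfolding derivs_bounded_def by meson
    have "norm (foldr dir_deriv vs (\<lambda>x. c k *\<^sub>R w k x) x) \<le> \<bar>c k\<bar> * M" for k x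
    proof -
      have "foldr dir_deriv vs (\<lambda>x. c k *\<^sub>R w k x) x = c k *\<^sub>R foldr dir_deriv vs (w k) x"
        by (rule foldr_dir_deriv_linear[OF open_UNIV VD(1)[OF w] bounded_linear_scaleR_right UNIV_I])
      then show ?thesis using M[of k x] by (simp add: mult_left_mono)
    qed
    then show "\<exists>B. summable B \<and> (\<forall>k x. norm (foldr dir_deriv vs (\<lambda>x. c k *\<^sub>R w k x) x) \<le> B k)"
      using summable_mult2[OF assms(4), of M] by blast
  qed
  moreover have "periodic a b (\<lambda>x. \<Sum>k. c k *\<^sub>R w k x)"
    using VD(2)[OF w] by (simp add: periodic_def)
  ultimately show ?thesis using smooth_on_dominated_series by (auto simp: V_iff)
qed

lemma linear_op_onD:
  assumes "linear_op_on W T"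
  shows "f \<in> W \<Longrightarrow> T f \<in> W"
    and "f \<in> W \<Longrightarrow> g \<in> W \<Longrightarrow> T (\<lambda>x. f x + g x) = (\<lambda>x. T f x + T g x)"
    and "f \<in> W \<Longrightarrow> T (\<lambda>x. r *\<^sub>R f x) = (\<lambda>x. r *\<^sub>R T f x)"
  using assms by (auto simp: linear_op_on_def)

text \<open>
  Gliding hump. If the conclusion fails, choose \<open>w\<^sub>n \<in> W\<close> and coefficients \<open>c\<^sub>n > 0\<close> in turn, such that
  \<open>c\<^sub>n \<parallel>T w\<^sub>n\<parallel>\<close> is at least \<open>n + \<parallel>T s\<^sub>n\<parallel> + 1\<close> for the partial sum \<open>s\<^sub>n\<close> of the earlier terms \<open>c\<^sub>k w\<^sub>k\<close>. The
  coefficients decay so fast that \<open>f = \<Sum> c\<^sub>k w\<^sub>k\<close> lies in \<open>V\<close>. Pairing \<open>T f\<close> with \<open>T w\<^sub>n\<close> shows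
  \<open>\<parallel>T f\<parallel> \<ge> n\<close>: the adjoint turns the contribution of the remainder \<open>r\<close> of the series into \<open>(r, T' (T w\<^sub>n))\<close>,
  which involves no derivative of \<open>r\<close> and is small if the later coefficients are small compared to
  \<open>\<parallel>T' (T w\<^sub>n)\<parallel>\<close>.
\<close>

theorem operator_with_adjoint_bounded:
  fixes T T' :: "(real^'d \<Rightarrow> real^'m) \<Rightarrow> real^'d \<Rightarrow> real^'m"
  assumes T: "linear_op_on (V a b) T"
    and T': "\<And>g. g \<in> V a b \<Longrightarrow> T' g \<in> V a b"
    and adj: "\<And>f g. f \<in> V a b \<Longrightarrow> g \<in> V a b \<Longrightarrow> L2_inner a b (T f) g = L2_inner a b f (T' g)"
    and W: "W \<subseteq> V a b" "derivs_bounded W"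
  shows "\<exists>C. \<forall>f\<in>W. L2_norm a b (T f) \<le> C"
proof (rule ccontr)
  let ?n = "L2_norm a b"
  assume "\<not> ?thesis"
  then have unbounded: "\<exists>f\<in>W. ?n (T f) > C" for C by (meson not_le)
  have "\<exists>M. \<forall>f\<in>W. \<forall>x. norm (foldr dir_deriv [] f x) \<le> M"
    using W(2) unfolding derivs_bounded_def by blast
  then obtain M where M: "\<And>f x. f \<in> W \<Longrightarrow> norm (f x) \<le> M" by auto
  define M0 where "M0 = max M 0"
  have M0: "M0 \<ge> 0" "\<And>f x. f \<in> W \<Longrightarrow> norm (f x) \<le> M0"
    using M by (auto simp: M0_def le_max_iff_disj)
  \<comment> \<open>The remainder after the term \<open>w\<close> is at most \<open>2 * M0\<close> times the next coefficient, so \<open>c' * \<kappa> w\<close>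
    bounds its pairing with \<open>T' (T w)\<close>.\<close>
  define \<kappa> where "\<kappa> w = 2 * M0 * sqrt (measure lborel (cbox a b)) * ?n (T' (T w))" for w
  have \<kappa>: "\<kappa> w \<ge> 0" for w
    unfolding \<kappa>_def using M0(1) by (intro mult_nonneg_nonneg L2_norm_nonneg) auto
  \<comment> \<open>A state consists of the partial sum before step \<open>n\<close>, the coefficient and the hump of that step.\<close>
  define P where "P n = (\<lambda>(s, c, w). s \<in> V a b \<and> w \<in> W \<and> c > 0 \<and>
      c * ?n (T w) \<ge> real n + ?n (T s) + 1 \<and> ?n (T w) \<ge> 1 \<and> (n = 0 \<longrightarrow> s = (\<lambda>x. 0)))"
    for n :: nat
  define Q where "Q = (\<lambda>(s, c, w) (s', c', w'::real^'d \<Rightarrow> real^'m). s' = (\<lambda>x. s x + c *\<^sub>R w x :: real^'m) \<and>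
      c' \<le> c / 2 \<and> c' * \<kappa> w \<le> (1::real))"
  have pick: "\<exists>w\<in>W. c * ?n (T w) \<ge> r \<and> ?n (T w) \<ge> 1" if "c > 0" for c r
  proof -
    obtain w where "w \<in> W" "?n (T w) > max 1 (r / c)" using unbounded by blast
    then show ?thesis using that by (intro bexI[of _ w]) (auto simp: field_simps)
  qed
  have "\<exists>f. \<forall>n. P n (f n) \<and> Q (f n) (f (Suc n))"
  proof (rule dependent_nat_choice)
    obtain w where "w \<in> W" "1 * ?n (T w) \<ge> ?n (T (\<lambda>x. 0)) + 1" "?n (T w) \<ge> 1"
      using pick[OF zero_less_one] by blast
    then have "P 0 (\<lambda>x. 0, 1, w)" by (simp add: P_def V_zero)
    then show "\<exists>x. P 0 x" by blast
  next
    fix x n assume P: "P n x"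
    obtain s c w where x: "x = (s, c, w)" by (cases x) auto
    define s' where "s' = (\<lambda>x. s x + c *\<^sub>R w x)"
    define c' where "c' = min (c / 2) (1 / (1 + \<kappa> w))"
    have "s' \<in> V a b"
      using P W unfolding s'_def by (intro V_add V_scaleR) (auto simp: P_def x)
    have "1 + \<kappa> w > 0" using \<kappa>[of w] by simp
    then have "c' > 0" "c' \<le> c / 2" using P by (auto simp: c'_def P_def x)
    have "c' * \<kappa> w \<le> 1 / (1 + \<kappa> w) * (1 + \<kappa> w)"
      using \<kappa>[of w] by (intro mult_mono) (auto simp: c'_def)
    then have "c' * \<kappa> w \<le> 1" using \<open>1 + \<kappa> w > 0\<close> by simp
    obtain w' where "w' \<in> W" "c' * ?n (T w') \<ge> real (Suc n) + ?n (T s') + 1" "?n (T w') \<ge> 1"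
      using pick[OF \<open>c' > 0\<close>] by blast
    then have "P (Suc n) (s', c', w') \<and> Q x (s', c', w')"
      using \<open>s' \<in> V a b\<close> \<open>c' > 0\<close> \<open>c' \<le> c / 2\<close> \<open>c' * \<kappa> w \<le> 1\<close>
      by (simp add: P_def Q_def x s'_def)
    then show "\<exists>y. P (Suc n) y \<and> Q x y" by blast
  qed
  then obtain F where F: "\<And>n. P n (F n)" "\<And>n. Q (F n) (F (Suc n))" by blast
  define s c w where "s n = fst (F n)" and "c n = fst (snd (F n))" and "w n = snd (snd (F n))" for n
  have P': "s n \<in> V a b" "w n \<in> W" "c n > 0" "c n * ?n (T (w n)) \<ge> real n + ?n (T (s n)) + 1"
    "?n (T (w n)) \<ge> 1" "s 0 = (\<lambda>x. 0)" for n
    using F(1)[of n] F(1)[of 0] by (auto simp: P_def s_def c_def w_def split_beta)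
  have Q': "s (Suc n) = (\<lambda>x. s n x + c n *\<^sub>R w n x)" "c (Suc n) \<le> c n / 2" "c (Suc n) * \<kappa> (w n) \<le> 1" for n
    using F(2)[of n] by (auto simp: Q_def s_def c_def w_def split_beta)
  have w: "w n \<in> V a b" for n using P'(2) W(1) by blast
  have c_geo: "c (k + n) \<le> c n * (1/2) ^ k" for k n
  proof (induction k)
    case (Suc k)
    then show ?case using Q'(2)[of "k + n"] by simp
  qed simp
  have "summable (\<lambda>k. c 0 * (1/2) ^ k)" by (intro summable_mult summable_geometric) simp
  then have "summable (\<lambda>k. \<bar>c k\<bar>)"
    by (rule summable_comparison_test'[where N = 0]) (use c_geo[of _ 0] P'(3) in \<open>simp add: less_imp_le\<close>)
  note V_bounded_series[OF W(2,1) P'(2) this]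
  moreover define f where "f = (\<lambda>x. \<Sum>k. c k *\<^sub>R w k x)"
  ultimately have f: "f \<in> V a b" by simp
  have s_sum: "s n x = (\<Sum>k<n. c k *\<^sub>R w k x)" for n x
    by (induction n) (auto simp: P'(6) Q'(1))
  have term_bound: "norm (c (k + n) *\<^sub>R w (k + n) x) \<le> (M0 * c n) * (1/2) ^ k" for k n x
  proof -
    have "norm (c (k + n) *\<^sub>R w (k + n) x) \<le> c (k + n) * M0"
      using P'(3)[of "k + n"] M0(2)[OF P'(2)] by (simp add: mult_left_mono)
    also have "\<dots> \<le> (c n * (1/2) ^ k) * M0"
      using c_geo M0(1) by (intro mult_right_mono)
    finally show ?thesis by (simp add: ac_simps)
  qed
  have geo: "summable (\<lambda>k. r * (1/2::real) ^ k)" for r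
    by (intro summable_mult summable_geometric) simp
  have remainder: "norm (f x - s n x) \<le> 2 * M0 * c n" for n x
  proof -
    have "summable (\<lambda>k. c k *\<^sub>R w k x)"
      using summable_comparison_test'[OF geo, of 0 "\<lambda>k. c k *\<^sub>R w k x"] term_bound[of _ 0] by auto
    then have "f x - s n x = (\<Sum>k. c (k + n) *\<^sub>R w (k + n) x)"
      unfolding f_def s_sum by (rule suminf_minus_initial_segment[symmetric])
    also have "norm \<dots> \<le> (\<Sum>k. (M0 * c n) * (1/2) ^ k)"
      by (rule norm_suminf_le[OF term_bound geo])
    also have "\<dots> = 2 * M0 * c n"
      by (subst suminf_mult) (auto simp: suminf_geometric)
    finally show ?thesis .
  qed
  have CS: "\<bar>L2_inner a b g h\<bar> \<le> ?n g * ?n h" if "g \<in> V a b" "h \<in> V a b" for g h :: "real^'d \<Rightarrow> real^'m"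
    using L2_Cauchy_Schwarz that V_continuous by blast
  note TV = linear_op_onD(1)[OF T]
  have "real n \<le> ?n (T f)" for n
  proof -
    define r where "r = (\<lambda>x. f x - s (Suc n) x)"
    have r: "r \<in> V a b" unfolding r_def by (rule V_diff[OF f P'(1)])
    have cw: "(\<lambda>x. c n *\<^sub>R w n x) \<in> V a b" by (rule V_scaleR[OF w])
    note cont = V_continuous[OF linear_op_onD(1)[OF T]]
    have "f = (\<lambda>x. s (Suc n) x + r x)" by (simp add: r_def)
    then have "T f = (\<lambda>x. T (s (Suc n)) x + T r x)"
      using linear_op_onD(2)[OF T P'(1) r] by metis
    also have "T (s (Suc n)) = (\<lambda>x. T (s n) x + c n *\<^sub>R T (w n) x)"
      using linear_op_onD(2)[OF T P'(1) cw] linear_op_onD(3)[OF T w] Q'(1) by simp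
    finally have Tf: "T f = (\<lambda>x. (T (s n) x + c n *\<^sub>R T (w n) x) + T r x)" .
    have "?n (T f) * ?n (T (w n)) \<ge> L2_inner a b (T f) (T (w n))"
      using CS[OF TV[OF f] TV[OF w[of n]]] by simp
    moreover have "L2_inner a b (T f) (T (w n)) = L2_inner a b (T (s n)) (T (w n))
        + c n * (?n (T (w n)))\<^sup>2 + L2_inner a b (T r) (T (w n))"
      unfolding Tf L2_norm_power2
      by (simp add: L2_inner_add_left cont P'(1) w r L2_inner_scaleR_left continuous_intros)
    moreover have "L2_inner a b (T (s n)) (T (w n)) \<ge> - (?n (T (s n)) * ?n (T (w n)))"
      using CS[OF TV[OF P'(1)] TV[OF w], of n n] by simp
    moreover have "L2_inner a b (T r) (T (w n)) \<ge> - ?n (T (w n))"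
    proof -
      have Tw: "T (w n) \<in> V a b" by (rule linear_op_onD(1)[OF T w])
      have "\<bar>L2_inner a b (T r) (T (w n))\<bar> = \<bar>L2_inner a b r (T' (T (w n)))\<bar>"
        using adj[OF r Tw] by simp
      also have "\<dots> \<le> ?n r * ?n (T' (T (w n)))"
        by (rule CS[OF r T'[OF Tw]])
      also have "\<dots> \<le> (2 * M0 * c (Suc n) * sqrt (measure lborel (cbox a b))) * ?n (T' (T (w n)))"
        using remainder[of _ "Suc n"] M0(1) P'(3)[of "Suc n"]
        by (intro mult_right_mono L2_norm_nonneg L2_norm_bound V_continuous[OF r]) (auto simp: r_def)
      also have "\<dots> = c (Suc n) * \<kappa> (w n)" by (simp add: \<kappa>_def ac_simps)
      also have "\<dots> \<le> ?n (T (w n))" using Q'(3)[of n] P'(5)[of n] by linarith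
      finally show ?thesis by linarith
    qed
    ultimately have "(c n * ?n (T (w n))) * ?n (T (w n)) \<le> (?n (T f) + ?n (T (s n)) + 1) * ?n (T (w n))"
      by (simp add: algebra_simps power2_eq_square)
    then have "c n * ?n (T (w n)) \<le> ?n (T f) + ?n (T (s n)) + 1"
      using P'(5)[of n] by (simp add: mult_le_cancel_right)
    then show ?thesis using P'(4)[of n] by linarith
  qed
  then show False by (meson not_le reals_Archimedean2)
qed

section \<open>Families of functions that are stationary in a parameter direction\<close>

text \<open>
  The derivative of the family \<open>p \<mapsto> g (p, \<cdot>)\<close> at \<open>p\<close> in the parameter direction \<open>v\<close> vanishes as a function
  of \<open>x\<close>. Since this holds for all \<open>x\<close> at once, the property is inherited by everything that is computed from
  the family through spatial derivatives, smooth functions and integrals.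
\<close>

definition stationary :: "'p::real_normed_vector \<Rightarrow> 'p \<Rightarrow> ('p \<times> 'x::real_normed_vector \<Rightarrow> 'b::real_normed_vector) \<Rightarrow> bool" where
  "stationary p v g \<longleftrightarrow> (\<forall>x. dir_deriv (v, 0) g (p, x) = 0)"

lemma stationary_cong:
  assumes "stationary p v g" "open P" "p \<in> P" "\<And>w. w \<in> P \<times> UNIV \<Longrightarrow> g w = h w"
  shows "stationary p v h"
  unfolding stationary_def
proof
  fix x
  have "dir_deriv (v, 0) g (p, x) = dir_deriv (v, 0) h (p, x)"
    by (rule dir_deriv_cong_open[OF _ _ assms(4)]) (use assms(2,3) in \<open>auto simp: open_Times\<close>)
  then show "dir_deriv (v, 0) h (p, x) = 0" using assms(1) by (simp add: stationary_def)
qed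

lemma stationary_const: "stationary p v (\<lambda>w. k)"
  unfolding stationary_def by (auto intro!: dir_derivI)

lemma stationary_bilinear:
  assumes "bounded_bilinear B" "smooth_on (P \<times> UNIV) f" "smooth_on (P \<times> UNIV) g" "p \<in> P"
    and "stationary p v f" "stationary p v g"
  shows "stationary p v (\<lambda>w. B (f w) (g w))"
  unfolding stationary_def
proof
  fix x
  interpret bounded_bilinear B by fact
  have "dir_deriv (v, 0) (\<lambda>w. B (f w) (g w)) (p, x) =
      B (f (p, x)) (dir_deriv (v, 0) g (p, x)) + B (dir_deriv (v, 0) f (p, x)) (g (p, x))"
    using assms(2-4)
    by (intro dir_derivI FDERIV has_derivative_dir_deriv) (auto intro: smooth_on_differentiable)
  then show "dir_deriv (v, 0) (\<lambda>w. B (f w) (g w)) (p, x) = 0"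
    using assms(5,6) by (simp add: stationary_def zero_left zero_right)
qed

lemma stationary_sum:
  assumes "\<And>i. i \<in> I \<Longrightarrow> smooth_on (P \<times> UNIV) (f i)" "p \<in> P" "\<And>i. i \<in> I \<Longrightarrow> stationary p v (f i)"
  shows "stationary p v (\<lambda>w. \<Sum>i\<in>I. f i w)"
  unfolding stationary_def
proof
  fix x
  have "dir_deriv (v, 0) (\<lambda>w. \<Sum>i\<in>I. f i w) (p, x) = (\<Sum>i\<in>I. dir_deriv (v, 0) (f i) (p, x))"
    using assms(1,2)
    by (intro dir_derivI has_derivative_sum has_derivative_dir_deriv) (auto intro: smooth_on_differentiable)
  then show "dir_deriv (v, 0) (\<lambda>w. \<Sum>i\<in>I. f i w) (p, x) = 0"
    using assms(3) by (simp add: stationary_def)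
qed

lemma stationary_compose:
  assumes "smooth_on UNIV F" "smooth_on (P \<times> UNIV) u" "p \<in> P" "stationary p v u"
  shows "stationary p v (\<lambda>w. F (u w))"
  unfolding stationary_def
proof
  fix x
  have u: "(u has_derivative (\<lambda>h. dir_deriv h u (p, x))) (at (p, x))"
    using assms(2,3) by (intro has_derivative_dir_deriv) (auto intro: smooth_on_differentiable)
  have F: "(F has_derivative (\<lambda>h. dir_deriv h F (u (p, x)))) (at (u (p, x)))"
    using assms(1) by (intro has_derivative_dir_deriv) (auto intro: smooth_on_differentiable)
  have "dir_deriv (v, 0) (\<lambda>w. F (u w)) (p, x) = dir_deriv 0 F (u (p, x))"
    using dir_derivI[OF has_derivative_compose[OF u F], of "(v, 0)"] assms(4) by (simp add: stationary_def)
  also have "\<dots> = 0" using linear_0[OF has_derivative_linear[OF F]] .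
  finally show "dir_deriv (v, 0) (\<lambda>w. F (u w)) (p, x) = 0" .
qed

text \<open>
  The mixed derivatives commute, and the spatial derivative of the zero function is zero.
\<close>

lemma stationary_dir_deriv:
  assumes "open P" "smooth_on (P \<times> UNIV) g" "p \<in> P" "stationary p v g"
  shows "stationary p v (dir_deriv (0, w) g)"
  unfolding stationary_def
proof
  fix x
  have "dir_deriv (v, 0) (dir_deriv (0, w) g) (p, x) = dir_deriv (0, w) (dir_deriv (v, 0) g) (p, x)"
    using assms by (intro dir_deriv_commute[of "P \<times> UNIV"]) (auto simp: open_Times)
  also have "\<dots> = dir_deriv w (\<lambda>x. dir_deriv (v, 0) g (p, x)) x"
    using assms(3) smooth_on_differentiable[OF smooth_on_dir_deriv[OF assms(2)]]
    by (intro dir_derivI[symmetric] has_derivative_slice) auto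
  also have "\<dots> = 0"
    using assms(4) by (auto intro!: dir_derivI simp: stationary_def)
  finally show "dir_deriv (v, 0) (dir_deriv (0, w) g) (p, x) = 0" .
qed

lemma stationary_foldr:
  assumes "open P" "smooth_on (P \<times> UNIV) g" "p \<in> P" "stationary p v g"
  shows "stationary p v (foldr dir_deriv (map (Pair 0) vs) g)"
  by (induction vs) (auto intro: assms stationary_dir_deriv smooth_on_foldr)

lemma stationary_partial_deriv:
  assumes "open P" "smooth_on (P \<times> UNIV) g" "p \<in> P" "stationary p v g"
  shows "stationary p v (\<lambda>w. partial_deriv is (\<lambda>y. g (fst w, y)) (snd w))"
proof (rule stationary_cong[OF stationary_foldr[OF assms, of "map (\<lambda>i. axis i 1) is"] assms(1,3)])
  fix w :: "'a \<times> (real^'b)" assume "w \<in> P \<times> UNIV"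
  then show "foldr dir_deriv (map (Pair 0) (map (\<lambda>i. axis i 1) is)) g w =
      partial_deriv is (\<lambda>y. g (fst w, y)) (snd w)"
    using partial_deriv_slice[OF assms(2), of "fst w" "is" "snd w"] by (auto simp: comp_def)
qed

lemma stationary_jet:
  fixes Z :: "'p::euclidean_space \<times> (real^'d) \<Rightarrow> real^'m"
  assumes "open P" "smooth_on (P \<times> UNIV) Z" "p \<in> P" "stationary p v Z"
  shows "stationary p v (\<lambda>w. jet \<alpha> c (\<lambda>y. Z (fst w, y)) (snd w) :: real^'k)"
proof -
  have o: "open (P \<times> (UNIV :: (real^'d) set))" by (simp add: open_Times assms)
  have Zc: "smooth_on (P \<times> UNIV) (\<lambda>w. Z w $ i)" "stationary p v (\<lambda>w. Z w $ i)" for i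
    by (rule smooth_on_component[OF o assms(2)])
      (rule stationary_compose[OF smooth_on_bounded_linear[OF bounded_linear_vec_nth] assms(2-4)])
  have "stationary p v (\<lambda>w. \<Sum>j\<in>UNIV. partial_deriv (\<alpha> j) (\<lambda>y. Z (fst w, y) $ c j) (snd w) *\<^sub>R (axis j 1 :: real^'k))"
    by (intro stationary_sum[where P = P] stationary_bilinear[OF bounded_bilinear_scaleR, where P = P]
        smooth_on_scaleR smooth_on_const stationary_const assms(3) o
        smooth_on_partial_deriv_param[OF assms(1) Zc(1)] stationary_partial_deriv[OF assms(1) Zc(1) assms(3) Zc(2)])
  moreover have "jet \<alpha> c z x = (\<Sum>j\<in>UNIV. partial_deriv (\<alpha> j) (\<lambda>y. z y $ c j) x *\<^sub>R (axis j 1 :: real^'k))"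
    for z :: "real^'d \<Rightarrow> real^'m" and x
    using basis_expansion[of "jet \<alpha> c z x"] by (simp add: jet_def scalar_mult_eq_scaleR)
  ultimately show ?thesis by simp
qed

lemma stationary_euler_lagrange:
  fixes Z :: "'p::euclidean_space \<times> (real^'d) \<Rightarrow> real^'m" and F :: "real^'k \<Rightarrow> real"
  assumes "open P" "smooth_on (P \<times> UNIV) Z" "p \<in> P" "stationary p v Z" "smooth_on UNIV F"
  shows "stationary p v (\<lambda>w. euler_lagrange F \<alpha> c (\<lambda>y. Z (fst w, y)) (snd w))"
proof -
  let ?G = "\<lambda>j w. dir_deriv (axis j 1) F (jet \<alpha> c (\<lambda>y. Z (fst w, y)) (snd w))"
  have o: "open (P \<times> (UNIV :: (real^'d) set))" by (simp add: open_Times assms)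
  have G: "smooth_on (P \<times> UNIV) (?G j)" for j
    by (rule smooth_on_density_param[OF assms(1,2) smooth_on_dir_deriv[OF assms(5)]])
  have G': "stationary p v (?G j)" for j
    by (rule stationary_compose[OF smooth_on_dir_deriv[OF assms(5)]
          smooth_on_jet_param[OF assms(1,2)] assms(3) stationary_jet[OF assms(1-4)]])
  have P: "smooth_on (P \<times> UNIV) (\<lambda>w. partial_deriv (rev (\<alpha> j))
      (\<lambda>y. dir_deriv (axis j 1) F (jet \<alpha> c (\<lambda>y. Z (fst w, y)) y)) (snd w))" for j
    using smooth_on_partial_deriv_param[OF assms(1) G] by simp
  have P': "stationary p v (\<lambda>w. partial_deriv (rev (\<alpha> j))
      (\<lambda>y. dir_deriv (axis j 1) F (jet \<alpha> c (\<lambda>y. Z (fst w, y)) y)) (snd w))" for j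
    using stationary_partial_deriv[OF assms(1) G assms(3) G'] by simp
  show ?thesis
    unfolding euler_lagrange_def
    by (intro stationary_sum[where P = P] stationary_bilinear[OF bounded_bilinear_scaleR, where P = P]
        stationary_bilinear[OF bounded_bilinear_mult, where P = P]
        smooth_on_scaleR smooth_on_bilinear[OF _ bounded_bilinear_mult] smooth_on_const stationary_const assms(3) o P P')
qed

lemma stationary_fst:
  fixes f :: "'p::real_normed_vector \<Rightarrow> 'b::real_normed_vector"
  assumes "smooth_on P f" "p \<in> P" "dir_deriv v f p = 0"
  shows "stationary p v (\<lambda>w. f (fst w))"
  unfolding stationary_def
proof
  fix x
  have "((\<lambda>w. f (fst w)) has_derivative (\<lambda>h. dir_deriv (fst h) f p)) (at (p, x))"
    using has_derivative_compose[OF has_derivative_fst[OF has_derivative_ident], of f "\<lambda>h. dir_deriv h f p" "(p, x)" UNIV]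
      has_derivative_dir_deriv[OF smooth_on_differentiable[OF assms(1,2)]] by simp
  from dir_derivI[OF this, of "(v, 0)"] show "dir_deriv (v, 0) (\<lambda>w. f (fst w)) (p, x) = 0"
    using assms(3) by simp
qed

lemma smooth_on_fst:
  fixes f :: "'p::euclidean_space \<Rightarrow> 'b::real_normed_vector"
  assumes "open P" "smooth_on P f"
  shows "smooth_on (P \<times> (UNIV :: 'x::real_normed_vector set)) (\<lambda>w. f (fst w))"
  by (rule smooth_on_compose[OF assms(2)])
    (auto simp: open_Times assms(1) intro: smooth_on_bounded_linear bounded_linear_fst)

text \<open>
  The nonlinear term of the scheme at the data \<open>(Z (p, \<cdot>), E p)\<close>, with the Euler--Lagrange expression in
  place of the variational derivative. This formula makes sense for nonperiodic data as well, which occur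
  because the solution is periodic only at times in \<open>[0, T]\<close> while smoothness is a property of open sets of
  parameters. The factor \<open>- 1 *\<close> presents the exponent as a product.
\<close>

definition B_family ::
    "real^'d \<Rightarrow> real^'d \<Rightarrow> (real^'k \<Rightarrow> real) \<Rightarrow> ('k \<Rightarrow> 'd list) \<Rightarrow> ('k \<Rightarrow> 'm) \<Rightarrow>
     ('p \<times> (real^'d) \<Rightarrow> real^'m) \<Rightarrow> ('p \<Rightarrow> real) \<Rightarrow> 'p \<times> (real^'d) \<Rightarrow> real^'m" where
  "B_family a b F \<alpha> c Z E w =
     (E (fst w) * exp (- 1 * integral (cbox a b) (\<lambda>x. F (jet \<alpha> c (\<lambda>y. Z (fst w, y)) x)))) *\<^sub>R
       euler_lagrange F \<alpha> c (\<lambda>y. Z (fst w, y)) (snd w)"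

lemma
  fixes Z :: "'p::euclidean_space \<times> (real^'d) \<Rightarrow> real^'m" and F :: "real^'k \<Rightarrow> real"
  assumes P: "open P" and Z: "smooth_on (P \<times> UNIV) Z" and E: "smooth_on P E" and F: "smooth_on UNIV F"
  shows smooth_on_B_family: "smooth_on (P \<times> UNIV) (B_family a b F \<alpha> c Z E)"
    and stationary_B_family: "p \<in> P \<Longrightarrow> stationary p v Z \<Longrightarrow> dir_deriv v E p = 0 \<Longrightarrow>
      stationary p v (B_family a b F \<alpha> c Z E)"
proof -
  let ?H = "\<lambda>p. integral (cbox a b) (\<lambda>x. F (jet \<alpha> c (\<lambda>y. Z (p, y)) x))"
  let ?Q = "\<lambda>p. E p * exp (- 1 * ?H p)"
  let ?f = "\<lambda>w. F (jet \<alpha> c (\<lambda>y. Z (fst w, y)) (snd w))"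
  have f: "smooth_on (P \<times> UNIV) ?f" by (rule smooth_on_density_param[OF P Z F])
  have H: "smooth_on P ?H" using smooth_on_integral_param[OF P f] by simp
  have nH: "smooth_on P (\<lambda>p. - 1 * ?H p)"
    by (intro smooth_on_bilinear[OF _ bounded_bilinear_mult] P H smooth_on_const)
  have eH: "smooth_on P (\<lambda>p. exp (- 1 * ?H p))"
    by (rule smooth_on_compose[OF smooth_on_exp P nH]) simp
  have Q: "smooth_on P ?Q" by (intro smooth_on_bilinear[OF _ bounded_bilinear_mult] P E eH)
  have eq: "B_family a b F \<alpha> c Z E = (\<lambda>w. ?Q (fst w) *\<^sub>R euler_lagrange F \<alpha> c (\<lambda>y. Z (fst w, y)) (snd w))"
    by (simp add: B_family_def[abs_def])
  have o: "open (P \<times> (UNIV :: (real^'d) set))" by (simp add: open_Times P)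
  show "smooth_on (P \<times> UNIV) (B_family a b F \<alpha> c Z E)"
    unfolding eq by (intro smooth_on_scaleR o smooth_on_fst[OF P Q] smooth_on_euler_lagrange_param P Z F)
  assume p: "p \<in> P" and st: "stationary p v Z" and dE: "dir_deriv v E p = 0"
  have "stationary p v ?f"
    by (rule stationary_compose[OF F smooth_on_jet_param[OF P Z] p stationary_jet[OF P Z p st]])
  then have H0: "dir_deriv v ?H p = 0"
    using dir_deriv_integral_param[OF P f p, of v a b] by (simp add: stationary_def)
  have "stationary p v (\<lambda>w :: 'p \<times> (real^'d). ?H (fst w))" by (rule stationary_fst[OF H p H0])
  then have "stationary p v (\<lambda>w :: 'p \<times> (real^'d). - 1 * ?H (fst w))"
    by (intro stationary_bilinear[OF bounded_bilinear_mult smooth_on_const smooth_on_fst[OF P H] p stationary_const])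
  then have "stationary p v (\<lambda>w :: 'p \<times> (real^'d). exp (- 1 * ?H (fst w)))"
    by (rule stationary_compose[OF smooth_on_exp smooth_on_fst[OF P nH] p])
  then have "stationary p v (\<lambda>w :: 'p \<times> (real^'d). ?Q (fst w))"
    by (rule stationary_bilinear[OF bounded_bilinear_mult smooth_on_fst[OF P E] smooth_on_fst[OF P eH] p
          stationary_fst[OF E p dE]])
  then show "stationary p v (B_family a b F \<alpha> c Z E)"
    unfolding eq
    by (rule stationary_bilinear[OF bounded_bilinear_scaleR smooth_on_fst[OF P Q]
          smooth_on_euler_lagrange_param[OF P Z F] p _ stationary_euler_lagrange[OF P Z p st F]])
qed

lemma esav_B_eq_B_family:
  fixes Z :: "'p::euclidean_space \<times> (real^'d) \<Rightarrow> real^'m" and F :: "real^'k \<Rightarrow> real"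
  assumes ab: "\<And>i. a $ i < b $ i" and F: "smooth_on UNIV F"
    and N: "\<And>z. z \<in> V a b \<Longrightarrow> N z = energy_density F \<alpha> c z"
    and N': "variational_derivative a b (H2 a b N) N'" and z: "(\<lambda>y. Z (p, y)) \<in> V a b"
  shows "esav_B a b N N' (\<lambda>y. Z (p, y)) (E p) = (\<lambda>x. B_family a b F \<alpha> c Z E (p, x))"
proof -
  have "H2 a b N (\<lambda>y. Z (p, y)) = integral (cbox a b) (\<lambda>x. F (jet \<alpha> c (\<lambda>y. Z (p, y)) x))"
    using N[OF z] by (simp add: H2_def L2_inner_def energy_density_def[abs_def] jet_def)
  then show ?thesis
    using variational_derivative_eq[OF ab F N N' z]
    by (simp add: esav_B_def B_family_def exp_minus divide_inverse)
qed

section \<open>Taylor estimates\<close>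

lemma slice_has_vector_derivative:
  assumes "smooth_on (P \<times> UNIV) g" "p + r *\<^sub>R v \<in> P"
  shows "((\<lambda>r. g (p + r *\<^sub>R v, x)) has_vector_derivative dir_deriv (v, 0) g (p + r *\<^sub>R v, x)) (at r within S)"
proof -
  have d: "g differentiable at (p + r *\<^sub>R v, x)"
    using assms smooth_on_differentiable by blast
  note g = has_derivative_slice_param[OF d]
  have "((\<lambda>r. p + r *\<^sub>R v) has_derivative (\<lambda>h. h *\<^sub>R v)) (at r within S)"
    by (auto intro!: derivative_eq_intros)
  from has_derivative_compose[OF this g]
  show ?thesis
    using linear_scale[OF has_derivative_linear[OF g]] by (simp add: has_vector_derivative_def)
qed

lemma vector_mean_value_bound:
  fixes \<phi> :: "real \<Rightarrow> 'b::real_normed_vector"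
  assumes "\<And>r. r \<in> {u..v} \<Longrightarrow> (\<phi> has_vector_derivative \<phi>' r) (at r within {u..v})"
    and "\<And>r. r \<in> {u..v} \<Longrightarrow> norm (\<phi>' r) \<le> M" and "u \<le> v"
  shows "norm (\<phi> v - \<phi> u) \<le> M * (v - u)"
proof -
  have "norm (\<phi> v - \<phi> u) \<le> M * norm (v - u)"
  proof (rule differentiable_bound[where S = "{u..v}"])
    show "(\<phi> has_derivative (\<lambda>h. h *\<^sub>R \<phi>' r)) (at r within {u..v})" if "r \<in> {u..v}" for r
      using assms(1)[OF that] by (simp add: has_vector_derivative_def)
    show "onorm (\<lambda>h. h *\<^sub>R \<phi>' r) \<le> M" if "r \<in> {u..v}" for r
      using assms(2)[OF that] by (intro onorm_le) (simp add: mult.commute[of M] mult_left_mono)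
  qed (use assms(3) in auto)
  then show ?thesis using assms(3) by simp
qed

lemma second_order_vanishing_bound:
  fixes \<phi> :: "real \<Rightarrow> 'b::real_normed_vector"
  assumes "\<And>r. r \<in> {0..s} \<Longrightarrow> (\<phi> has_vector_derivative \<phi>' r) (at r within {0..s})"
    and "\<And>r. r \<in> {0..s} \<Longrightarrow> (\<phi>' has_vector_derivative \<phi>'' r) (at r within {0..s})"
    and "\<And>r. r \<in> {0..s} \<Longrightarrow> norm (\<phi>'' r) \<le> M"
    and "\<phi> 0 = 0" "\<phi>' 0 = 0" "0 \<le> s"
  shows "norm (\<phi> s) \<le> M * s\<^sup>2"
proof -
  have "0 \<le> norm (\<phi>'' 0)" "norm (\<phi>'' 0) \<le> M" using assms(3)[of 0] assms(6) by auto
  then have M: "0 \<le> M" by linarith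
  have "norm (\<phi>' r) \<le> M * s" if "r \<in> {0..s}" for r
  proof -
    have "norm (\<phi>' r - \<phi>' 0) \<le> M * (r - 0)"
    proof (rule vector_mean_value_bound)
      show "(\<phi>' has_vector_derivative \<phi>'' q) (at q within {0..r})" if "q \<in> {0..r}" for q
        using assms(2)[of q] that \<open>r \<in> {0..s}\<close>
        by (auto elim!: has_vector_derivative_within_subset)
    qed (use assms(3) that in auto)
    also have "\<dots> \<le> M * s" using that M by (simp add: mult_left_mono)
    finally show ?thesis using assms(5) by simp
  qed
  from vector_mean_value_bound[OF assms(1) this assms(6)] show ?thesis
    using assms(4) by (simp add: power2_eq_square)
qed

text \<open>
  The defect, as a function of the step \<open>r\<close>, vanishes to second order at \<open>0\<close>, and its second derivative is
  \<open>- r/2\<close> times the third derivative of \<open>h\<close>; the additional factor \<open>r\<close> gives the third order.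
\<close>

lemma trapezoidal_rule_bound:
  fixes h :: "real \<Rightarrow> 'b::real_normed_vector"
  assumes "\<And>r. r \<in> {t..t+s} \<Longrightarrow> (h has_vector_derivative h' r) (at r within {t..t+s})"
    and "\<And>r. r \<in> {t..t+s} \<Longrightarrow> (h' has_vector_derivative h'' r) (at r within {t..t+s})"
    and "\<And>r. r \<in> {t..t+s} \<Longrightarrow> (h'' has_vector_derivative h''' r) (at r within {t..t+s})"
    and "\<And>r. r \<in> {t..t+s} \<Longrightarrow> norm (h''' r) \<le> M"
    and "0 \<le> s"
  shows "norm (h (t + s) - h t - (s/2) *\<^sub>R (h' t + h' (t + s))) \<le> M * s ^ 3"
proof -
  have shift: "((\<lambda>r. f (t + r)) has_vector_derivative f' (t + r)) (at r within {0..s})"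
    if "\<And>r. r \<in> {t..t+s} \<Longrightarrow> (f has_vector_derivative f' r) (at r within {t..t+s})" "r \<in> {0..s}"
    for f f' :: "real \<Rightarrow> 'b" and r
  proof -
    have "((\<lambda>r. t + r) has_vector_derivative 1) (at r within {0..s})"
      by (auto intro!: derivative_eq_intros)
    moreover have "(f has_vector_derivative f' (t + r)) (at (t + r) within (\<lambda>r. t + r) ` {0..s})"
      using that by (simp add: add.commute)
    ultimately show ?thesis
      using vector_diff_chain_within[of "\<lambda>r. t + r" 1 r "{0..s}" f "f' (t + r)"] by (simp add: comp_def)
  qed
  define \<phi> where "\<phi> r = h (t + r) - h t - (r/2) *\<^sub>R (h' t + h' (t + r))" for r
  define \<phi>' where "\<phi>' r = (1/2) *\<^sub>R (h' (t + r) - h' t) - (r/2) *\<^sub>R h'' (t + r)" for r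
  define \<phi>'' where "\<phi>'' r = - ((r/2) *\<^sub>R h''' (t + r))" for r
  have "norm (\<phi> s) \<le> (M * s) * s\<^sup>2"
  proof (rule second_order_vanishing_bound[where \<phi>' = \<phi>' and \<phi>'' = \<phi>''])
    fix r assume r: "r \<in> {0..s}"
    note d = shift[OF assms(1) r] shift[OF assms(2) r] shift[OF assms(3) r]
    have "(\<phi> has_vector_derivative (h' (t + r) - 0 - ((r/2) *\<^sub>R (0 + h'' (t + r)) + (1/2) *\<^sub>R (h' t + h' (t + r)))))
        (at r within {0..s})"
      unfolding \<phi>_def
      by (intro has_vector_derivative_diff has_vector_derivative_scaleR has_vector_derivative_add d
          has_vector_derivative_const) (auto intro!: derivative_eq_intros)
    moreover have "h' (t + r) - 0 - ((r/2) *\<^sub>R (0 + h'' (t + r)) + (1/2) *\<^sub>R (h' t + h' (t + r))) = \<phi>' r"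
    proof -
      have "h' (t + r) = (1/2) *\<^sub>R h' (t + r) + (1/2) *\<^sub>R h' (t + r)"
        by (simp add: scaleR_add_left[symmetric])
      then have "h' (t + r) - (1/2) *\<^sub>R h' (t + r) = (1/2) *\<^sub>R h' (t + r)"
        by (metis add_diff_cancel_right')
      then show ?thesis by (simp add: \<phi>'_def scaleR_diff_right scaleR_add_right)
    qed
    ultimately show "(\<phi> has_vector_derivative \<phi>' r) (at r within {0..s})" by simp
    have "(\<phi>' has_vector_derivative (((1/2) *\<^sub>R (h'' (t + r) - 0) + 0 *\<^sub>R (h' (t + r) - h' t)) -
        ((r/2) *\<^sub>R h''' (t + r) + (1/2) *\<^sub>R h'' (t + r)))) (at r within {0..s})"
      unfolding \<phi>'_def
      by (intro has_vector_derivative_diff has_vector_derivative_scaleR d has_vector_derivative_const)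
        (auto intro!: derivative_eq_intros)
    then show "(\<phi>' has_vector_derivative \<phi>'' r) (at r within {0..s})"
      by (simp add: \<phi>''_def)
    have "norm (\<phi>'' r) = r / 2 * norm (h''' (t + r))" using r by (simp add: \<phi>''_def)
    also have "\<dots> \<le> s * M" using r assms(4)[of "t + r"] by (intro mult_mono) auto
    finally show "norm (\<phi>'' r) \<le> M * s" by (simp add: mult.commute)
  qed (use assms(5) in \<open>auto simp: \<phi>_def \<phi>'_def\<close>)
  then show ?thesis by (simp add: \<phi>_def power3_eq_cube power2_eq_square mult.assoc)
qed

lemma smooth_on_compact_bound:
  fixes g :: "'p::euclidean_space \<times> 'x::euclidean_space \<Rightarrow> 'b::real_normed_vector"
  assumes "smooth_on (P \<times> UNIV) g" "compact K" "K \<subseteq> P"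
  obtains M where "M \<ge> 0" "\<And>p x. p \<in> K \<Longrightarrow> x \<in> cbox a b \<Longrightarrow> norm (g (p, x)) \<le> M"
proof -
  have "compact (g ` (K \<times> cbox a b))"
    using assms(2,3)
    by (intro compact_continuous_image compact_Times compact_cbox smooth_on_continuous_on[OF assms(1)]) auto
  then obtain M where "\<And>y. y \<in> g ` (K \<times> cbox a b) \<Longrightarrow> norm y \<le> M"
    using compact_imp_bounded bounded_iff by metis
  then have "norm (g (p, x)) \<le> max M 0" if "p \<in> K" "x \<in> cbox a b" for p x
    using that by (fastforce simp: le_max_iff_disj)
  then show ?thesis using that[of "max M 0"] by simp
qed

text \<open>
  Spatial derivatives of \<open>g\<close> vanish to second order at \<open>s = 0\<close> as \<open>g\<close> itself does, so Taylor's estimate applies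
  to each of them. The bound on the second \<open>s\<close>-derivative comes from compactness of \<open>K\<close> and of the box, and
  periodicity carries the result from the box to the whole space.
\<close>

lemma second_order_family_bound:
  fixes g :: "(real \<times> real) \<times> (real^'d) \<Rightarrow> real^'m"
  assumes ab: "\<And>i. a $ i < b $ i" and P: "open P" and g: "smooth_on (P \<times> UNIV) g"
    and K: "compact K" "K \<subseteq> P" "\<And>t s r. (t, s) \<in> K \<Longrightarrow> r \<in> {0..s} \<Longrightarrow> (t, r) \<in> K"
      "\<And>t s. (t, s) \<in> K \<Longrightarrow> 0 \<le> s"
    and per: "\<And>p. p \<in> K \<Longrightarrow> periodic a b (\<lambda>x. g (p, x))"
    and zero: "\<And>t x. (t, 0) \<in> K \<Longrightarrow> g ((t, 0), x) = 0"
    and stat: "\<And>t. (t, 0) \<in> K \<Longrightarrow> stationary (t, 0) (0, 1) g"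
  shows "\<exists>M. \<forall>t s x. (t, s) \<in> K \<longrightarrow> norm (foldr dir_deriv vs (\<lambda>x. g ((t, s), x)) x) \<le> M * s\<^sup>2"
proof -
  define G where "G = foldr dir_deriv (map (Pair 0) vs) g"
  define d where "d = ((0 :: real, 1 :: real), 0 :: real^'d)"
  have G: "smooth_on (P \<times> UNIV) G" unfolding G_def by (rule smooth_on_foldr[OF g])
  have Gp: "foldr dir_deriv vs (\<lambda>x. g (p, x)) = (\<lambda>x. G (p, x))" if "p \<in> P" for p
    unfolding G_def by (rule foldr_dir_deriv_slice[OF g that])
  note G' = smooth_on_dir_deriv[OF G, of d]
  obtain M where M: "M \<ge> 0" "\<And>p x. p \<in> K \<Longrightarrow> x \<in> cbox a b \<Longrightarrow> norm (dir_deriv d (dir_deriv d G) (p, x)) \<le> M"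
    using smooth_on_compact_bound[OF smooth_on_dir_deriv[OF G', of d] K(1,2)] by metis
  have bound: "norm (G ((t, s), x)) \<le> M * s\<^sup>2" if ts: "(t, s) \<in> K" and x: "x \<in> cbox a b" for t s x
  proof (rule second_order_vanishing_bound[where \<phi> = "\<lambda>s. G ((t, s), x)"
        and \<phi>' = "\<lambda>s. dir_deriv d G ((t, s), x)" and \<phi>'' = "\<lambda>s. dir_deriv d (dir_deriv d G) ((t, s), x)"])
    show s: "0 \<le> s" using K(4)[OF ts] .
    have t0: "(t, 0) \<in> K" using K(3)[OF ts, of 0] s by simp
    fix r assume "r \<in> {0..s}"
    then have r: "(t, r) \<in> K" by (rule K(3)[OF ts])
    then have rP: "(t, 0) + r *\<^sub>R (0, 1) \<in> P" using K(2) by auto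
    from slice_has_vector_derivative[OF G this, of x "{0..s}"]
    show "((\<lambda>s. G ((t, s), x)) has_vector_derivative dir_deriv d G ((t, r), x)) (at r within {0..s})"
      by (simp add: d_def)
    from slice_has_vector_derivative[OF G' rP, of x "{0..s}"]
    show "((\<lambda>s. dir_deriv d G ((t, s), x)) has_vector_derivative dir_deriv d (dir_deriv d G) ((t, r), x))
        (at r within {0..s})"
      by (simp add: d_def)
    show "norm (dir_deriv d (dir_deriv d G) ((t, r), x)) \<le> M" by (rule M(2)[OF r x])
  next
    have t0: "(t, 0) \<in> K" using K(3)[OF ts, of 0] K(4)[OF ts] by simp
    then have t0P: "(t, 0) \<in> P" using K(2) by blast
    have "stationary (t, 0) (0, 1) G"
      unfolding G_def by (rule stationary_foldr[OF P g t0P stat[OF t0]])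
    then show "dir_deriv d G ((t, 0), x) = 0" by (simp add: stationary_def d_def)
    have "G ((t, 0), x) = foldr dir_deriv vs (\<lambda>x. g ((t, 0), x)) x" using Gp[OF t0P] by simp
    also have "(\<lambda>x. g ((t, 0), x)) = (\<lambda>x. 0 *\<^sub>R g ((t, 0), x))" using zero[OF t0] by simp
    also have "foldr dir_deriv vs \<dots> x = 0 *\<^sub>R foldr dir_deriv vs (\<lambda>x. g ((t, 0), x)) x"
      by (rule foldr_dir_deriv_linear[OF open_UNIV smooth_on_slice[OF g t0P] bounded_linear_scaleR_right UNIV_I])
    finally show "G ((t, 0), x) = 0" by simp
  qed
  have "norm (foldr dir_deriv vs (\<lambda>x. g ((t, s), x)) x) \<le> M * s\<^sup>2" if ts: "(t, s) \<in> K" for t s x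
  proof -
    have tP: "(t, s) \<in> P" using ts K(2) by blast
    obtain y where y: "y \<in> cbox a b" "\<And>f :: real^'d \<Rightarrow> real^'m. periodic a b f \<Longrightarrow> f x = f y"
      using periodic_representative[of a b x] ab by metis
    have "foldr dir_deriv vs (\<lambda>x. g ((t, s), x)) x = foldr dir_deriv vs (\<lambda>x. g ((t, s), x)) y"
      by (rule y(2)[OF periodic_foldr_dir_deriv[OF smooth_on_slice[OF g tP] per[OF ts]]])
    also have "\<dots> = G ((t, s), y)" using Gp[OF tP] by simp
    finally show ?thesis using bound[OF ts y(1)] by simp
  qed
  then show ?thesis by blast
qed

section \<open>Consistency\<close>

lemma esav_B_V:
  assumes "variational_derivative a b (H2 a b N) N'" "z \<in> V a b"
  shows "esav_B a b N N' z e \<in> V a b"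
  using assms unfolding esav_B_def variational_derivative_def by (intro V_scaleR) blast

lemma esav_Bbar_V:
  assumes "variational_derivative a b (H2 a b N) N'" "zp \<in> V a b" "zc \<in> V a b"
  shows "esav_Bbar a b N N' zp zc ep ec \<in> V a b"
  unfolding esav_Bbar_def by (intro esav_B_V V_scaleR V_diff assms)

text \<open>
  A parameter is a pair of a time \<open>t\<close> and a step \<open>s\<close>. In the direction \<open>(1/2, -1)\<close> the argument \<open>t\<close> moves with
  speed \<open>1/2\<close> and \<open>t - s\<close> with speed \<open>3/2\<close>, so the rates of \<open>3 z(t)\<close> and \<open>z(t - s)\<close> cancel at \<open>s = 0\<close>. The
  condition on \<open>t + s\<close> prepares the comparison with the value at the end of the step.
\<close>

lemma B_family_extrapolation:
  fixes z :: "real \<Rightarrow> real^'d \<Rightarrow> real^'m" and F :: "real^'k \<Rightarrow> real"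
  assumes F: "smooth_on UNIV F" and J: "open J"
    and z: "smooth_on (J \<times> UNIV) (\<lambda>(t, x). z t x)" and e: "smooth_on J e"
    and P: "P = {p. fst p \<in> J \<and> fst p - snd p \<in> J \<and> fst p + snd p \<in> J}"
    and Z: "Z = (\<lambda>w. (1/2) *\<^sub>R (3 *\<^sub>R z (fst (fst w)) (snd w) - z (fst (fst w) - snd (fst w)) (snd w)))"
    and E: "E = (\<lambda>p. (3 * e (fst p) - e (fst p - snd p)) / 2)"
  shows "open P" and "smooth_on (P \<times> UNIV) (B_family a b F \<alpha> c Z E)"
    and "t \<in> J \<Longrightarrow> stationary (t, 0) (1/2, -1) (B_family a b F \<alpha> c Z E)"
proof -
  define zz where "zz w = z (fst w) (snd w)" for w
  have "(\<lambda>(t, x). z t x) = zz" by (auto simp: zz_def)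
  then have zz: "smooth_on (J \<times> UNIV) zz" using z by simp
  have "P = (\<lambda>p. fst p) -` J \<inter> (\<lambda>p. fst p - snd p) -` J \<inter> (\<lambda>p. fst p + snd p) -` J"
    by (auto simp: P)
  then show openP: "open P"
    by (auto intro!: open_Int open_vimage J continuous_intros)
  have o: "open (P \<times> (UNIV :: (real^'d) set))" by (simp add: open_Times openP)
  have z1: "smooth_on (P \<times> UNIV) (\<lambda>w. z (fst (fst w)) (snd w))"
  proof -
    have "smooth_on (P \<times> (UNIV :: (real^'d) set)) (\<lambda>w. (fst (fst w), snd w))"
      by (intro smooth_on_bounded_linear bounded_linear_intros)
    from smooth_on_compose[OF zz o this] show ?thesis by (auto simp: P zz_def)
  qed
  have z2: "smooth_on (P \<times> UNIV) (\<lambda>w. z (fst (fst w) - snd (fst w)) (snd w))"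
  proof -
    have "smooth_on (P \<times> (UNIV :: (real^'d) set)) (\<lambda>w. (fst (fst w) - snd (fst w), snd w))"
      by (intro smooth_on_bounded_linear bounded_linear_intros)
    from smooth_on_compose[OF zz o this] show ?thesis by (auto simp: P zz_def)
  qed
  have Zs: "smooth_on (P \<times> UNIV) Z"
    unfolding Z by (intro smooth_on_scaleR smooth_on_minus smooth_on_const o z1 z2)
  have e1: "smooth_on P (\<lambda>p. e (fst p))"
    by (rule smooth_on_compose[OF e openP smooth_on_bounded_linear[OF bounded_linear_fst]]) (simp add: P)
  have e2: "smooth_on P (\<lambda>p. e (fst p - snd p))"
    by (rule smooth_on_compose[OF e openP smooth_on_bounded_linear])
      (auto simp: P intro!: bounded_linear_intros)
  have Es: "smooth_on P E"
    using smooth_on_scaleR[OF openP smooth_on_const[of P "1/2"] smooth_on_minus[OF openP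
        smooth_on_scaleR[OF openP smooth_on_const[of P "3 :: real"] e1] e2]]
    by (simp add: E)
  show "smooth_on (P \<times> UNIV) (B_family a b F \<alpha> c Z E)"
    by (rule smooth_on_B_family[OF openP Zs Es F])
  assume t: "t \<in> J"
  then have tP: "(t, 0) \<in> P" by (simp add: P)
  have "stationary (t, 0) (1/2, -1) Z"
    unfolding stationary_def
  proof
    fix x
    have zd: "(zz has_derivative (\<lambda>h. dir_deriv h zz (t, x))) (at (t, x))"
      using t by (intro has_derivative_dir_deriv smooth_on_differentiable[OF zz]) auto
    interpret zl: linear "\<lambda>h. dir_deriv h zz (t, x)" using zd by (rule has_derivative_linear)
    have lin: "dir_deriv (r, 0) zz (t, x) = r *\<^sub>R dir_deriv (1, 0) zz (t, x)" for r
      using zl.scale[of r "(1, 0)"] by simp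
    have "((\<lambda>w :: (real \<times> real) \<times> (real^'d). (fst (fst w), snd w)) has_derivative (\<lambda>h. (fst (fst h), snd h))) (at ((t, 0), x))"
      by (intro bounded_linear_imp_has_derivative bounded_linear_intros)
    from has_derivative_compose[OF this, of zz "\<lambda>h. dir_deriv h zz (t, x)"] zd
    have 1: "((\<lambda>w :: (real \<times> real) \<times> (real^'d). z (fst (fst w)) (snd w)) has_derivative (\<lambda>h. dir_deriv (fst (fst h), snd h) zz (t, x))) (at ((t, 0), x))"
      by (simp add: zz_def)
    have "((\<lambda>w :: (real \<times> real) \<times> (real^'d). (fst (fst w) - snd (fst w), snd w)) has_derivative
        (\<lambda>h. (fst (fst h) - snd (fst h), snd h))) (at ((t, 0), x))"
      by (intro bounded_linear_imp_has_derivative bounded_linear_intros)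
    from has_derivative_compose[OF this, of zz "\<lambda>h. dir_deriv h zz (t, x)"] zd
    have 2: "((\<lambda>w. z (fst (fst w) - snd (fst w)) (snd w)) has_derivative
        (\<lambda>h. dir_deriv (fst (fst h) - snd (fst h), snd h) zz (t, x))) (at ((t, 0), x))"
      by (simp add: zz_def)
    have "(Z has_derivative (\<lambda>h. (1/2) *\<^sub>R (3 *\<^sub>R dir_deriv (fst (fst h), snd h) zz (t, x)
        - dir_deriv (fst (fst h) - snd (fst h), snd h) zz (t, x)))) (at ((t, 0), x))"
      unfolding Z by (intro has_derivative_scaleR_right has_derivative_diff 1 2)
    from dir_derivI[OF this, of "((1/2, -1), 0)"]
    show "dir_deriv ((1/2, -1), 0) Z ((t, 0), x) = 0"
      using lin[of "1/2"] lin[of "3/2"] by simp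
  qed
  moreover have "dir_deriv (1/2, -1) E (t, 0) = 0"
  proof -
    have ed: "(e has_derivative (\<lambda>h. dir_deriv h e t)) (at t)"
      using t by (intro has_derivative_dir_deriv smooth_on_differentiable[OF e]) auto
    interpret el: linear "\<lambda>h. dir_deriv h e t" using ed by (rule has_derivative_linear)
    have lin: "dir_deriv r e t = r *\<^sub>R dir_deriv 1 e t" for r
      using el.scale[of r 1] by simp
    have 1: "((\<lambda>p. e (fst p)) has_derivative (\<lambda>h. dir_deriv (fst h) e t)) (at (t, 0))"
      using has_derivative_compose[OF has_derivative_fst[OF has_derivative_ident], of e "\<lambda>h. dir_deriv h e t" "(t, 0)" UNIV] ed
      by simp
    have 2: "((\<lambda>p. e (fst p - snd p)) has_derivative (\<lambda>h. dir_deriv (fst h - snd h) e t)) (at (t, 0))"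
      using has_derivative_compose[OF has_derivative_diff[OF has_derivative_fst[OF has_derivative_ident]
            has_derivative_snd[OF has_derivative_ident]], of e "\<lambda>h. dir_deriv h e t" "(t, 0)" UNIV] ed
      by simp
    have "(E has_derivative (\<lambda>h. (3 * dir_deriv (fst h) e t - dir_deriv (fst h - snd h) e t) / 2)) (at (t, 0))"
      unfolding E
      by (intro bounded_linear.has_derivative[OF bounded_linear_divide] has_derivative_diff
          has_derivative_mult_right 1 2)
    from dir_derivI[OF this, of "(1/2, -1)"] show ?thesis
      using lin[of "1/2"] lin[of "3/2"] by simp
  qed
  ultimately show "stationary (t, 0) (1/2, -1) (B_family a b F \<alpha> c Z E)"
    by (intro stationary_B_family[OF openP Zs Es F tP])
qed

text \<open>
  Stationarity of the extrapolated term in the direction \<open>(1/2, -1)\<close> means \<open>\<partial>\<^sub>s = (1/2) \<partial>\<^sub>t\<close> for it at \<open>s = 0\<close>,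
  and there \<open>\<partial>\<^sub>t\<close> is the time derivative of \<open>\<beta>\<close>. The average over the end points has the same
  \<open>s\<close>-derivative at \<open>s = 0\<close>, so the difference vanishes to second order.
\<close>

lemma extrapolation_defect:
  fixes z :: "real \<Rightarrow> real^'d \<Rightarrow> real^'m" and F :: "real^'k \<Rightarrow> real"
  assumes ab: "\<And>i. a $ i < b $ i" and F: "smooth_on UNIV F"
    and N: "\<And>z. z \<in> V a b \<Longrightarrow> N z = energy_density F \<alpha> c z"
    and N': "variational_derivative a b (H2 a b N) N'"
    and J: "open J" "{0..T} \<subseteq> J"
    and z: "smooth_on (J \<times> UNIV) (\<lambda>(t, x). z t x)" and e: "smooth_on J e"
    and zV: "\<And>t. t \<in> {0..T} \<Longrightarrow> z t \<in> V a b"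
  shows "\<exists>\<beta>. smooth_on (J \<times> UNIV) \<beta> \<and>
    (\<forall>t\<in>{0..T}. esav_B a b N N' (z t) (e t) = (\<lambda>x. \<beta> (t, x))) \<and>
    derivs_bounded {\<lambda>x. (1 / s\<^sup>2) *\<^sub>R ((1/2) *\<^sub>R (\<beta> (t, x) + \<beta> (t + s, x))
        - esav_Bbar a b N N' (z (t - s)) (z t) (e (t - s)) (e t) x) | t s. 0 < s \<and> s \<le> t \<and> t + s \<le> T}"
proof -
  let ?z = "\<lambda>(t, x). z t x"
  define \<beta> where "\<beta> = B_family a b F \<alpha> c ?z e"
  have \<beta>: "smooth_on (J \<times> UNIV) \<beta>"
    unfolding \<beta>_def by (rule smooth_on_B_family[OF J(1) z e F])
  have B: "esav_B a b N N' (z t) (e t) = (\<lambda>x. \<beta> (t, x))" if "t \<in> {0..T}" for t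
    using esav_B_eq_B_family[OF ab F N N', of ?z t e] zV[OF that] by (simp add: \<beta>_def)
  define P where "P = {p. fst p \<in> J \<and> fst p - snd p \<in> J \<and> fst p + snd p \<in> J}"
  define Z where "Z = (\<lambda>w. (1/2) *\<^sub>R (3 *\<^sub>R z (fst (fst w)) (snd w) - z (fst (fst w) - snd (fst w)) (snd w)))"
  define E where "E = (\<lambda>p. (3 * e (fst p) - e (fst p - snd p)) / 2)"
  define g0 where "g0 = B_family a b F \<alpha> c Z E"
  note openP = B_family_extrapolation(1)[OF F J(1) z e P_def Z_def E_def]
  note g0 = B_family_extrapolation(2)[where a = a and b = b and \<alpha> = \<alpha> and c = c,
      OF F J(1) z e P_def Z_def E_def, folded g0_def]
  note g0_stationary = B_family_extrapolation(3)[where a = a and b = b and \<alpha> = \<alpha> and c = c,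
      OF F J(1) z e P_def Z_def E_def, folded g0_def]
  \<comment> \<open>The parameters for which all three times \<open>t - s\<close>, \<open>t\<close>, \<open>t + s\<close> lie in \<open>[0, T]\<close>.\<close>
  define K where "K = {p :: real \<times> real. 0 \<le> snd p \<and> snd p \<le> fst p \<and> fst p + snd p \<le> T}"
  have "compact K"
  proof -
    have "K = cbox (0, 0) (T, T) \<inter> ({p. snd p \<le> fst p} \<inter> {p. fst p + snd p \<le> T})"
      by (auto simp: K_def cbox_Pair_eq)
    then show ?thesis
      by (auto intro!: compact_Int_closed compact_cbox closed_Int closed_Collect_le continuous_intros)
  qed
  have times: "t \<in> {0..T}" "t - s \<in> {0..T}" "t + s \<in> {0..T}" if "(t, s) \<in> K" for t s
    using that by (auto simp: K_def)
  have KP: "K \<subseteq> P"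
    using times J(2) by (auto simp: P_def)
  have o: "open (P \<times> (UNIV :: (real^'d) set))" by (simp add: open_Times openP)
  have \<beta>1: "smooth_on (P \<times> UNIV) (\<lambda>w. \<beta> (fst (fst w), snd w))"
    by (rule smooth_on_compose[OF \<beta> o smooth_on_bounded_linear])
      (auto simp: P_def intro!: bounded_linear_intros)
  have \<beta>2: "smooth_on (P \<times> UNIV) (\<lambda>w. \<beta> (fst (fst w) + snd (fst w), snd w))"
    by (rule smooth_on_compose[OF \<beta> o smooth_on_bounded_linear])
      (auto simp: P_def intro!: bounded_linear_intros)
  define g where "g w = (1/2) *\<^sub>R (\<beta> (fst (fst w), snd w) + \<beta> (fst (fst w) + snd (fst w), snd w)) - g0 w" for w
  have g: "smooth_on (P \<times> UNIV) g"
    unfolding g_def by (intro smooth_on_minus smooth_on_scaleR smooth_on_add smooth_on_const o \<beta>1 \<beta>2 g0)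
  have g0_0: "g0 ((t, 0), x) = \<beta> (t, x)" for t x
  proof -
    have "Z ((t, 0), y) = z t y" for y
    proof -
      have "3 *\<^sub>R z t y - z t y = 2 *\<^sub>R z t y"
        using scaleR_left_diff_distrib[of 3 1 "z t y"] by simp
      then show ?thesis by (simp add: Z_def)
    qed
    then show ?thesis by (simp add: g0_def \<beta>_def B_family_def E_def)
  qed
  have Bbar: "esav_Bbar a b N N' (z (t - s)) (z t) (e (t - s)) (e t) = (\<lambda>x. g0 ((t, s), x))"
    if "(t, s) \<in> K" for t s
  proof -
    have "(\<lambda>y. Z ((t, s), y)) \<in> V a b"
      unfolding Z_def using zV times[OF that] by (simp add: V_scaleR V_diff)
    from esav_B_eq_B_family[OF ab F N N' this, of E] show ?thesis
      by (simp add: g0_def esav_Bbar_def Z_def E_def)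
  qed
  have gV: "(\<lambda>x. g ((t, s), x)) \<in> V a b" if "(t, s) \<in> K" for t s
  proof -
    have "(\<lambda>x. (1/2) *\<^sub>R (esav_B a b N N' (z t) (e t) x + esav_B a b N N' (z (t + s)) (e (t + s)) x)
        - esav_Bbar a b N N' (z (t - s)) (z t) (e (t - s)) (e t) x) \<in> V a b"
      using times[OF that] zV by (intro V_diff V_scaleR V_add esav_B_V[OF N'] esav_Bbar_V[OF N']) auto
    then show ?thesis using B times[OF that] Bbar[OF that] by (simp add: g_def)
  qed
  have stat: "stationary (t, 0) (0, 1) g" if "(t, 0) \<in> K" for t
    unfolding stationary_def
  proof
    fix x
    have tJ: "t \<in> J" using times[OF that] J(2) by blast
    have tP: "(t, 0) \<in> P" using KP that by blast
    let ?D = "\<lambda>v. dir_deriv (v, 0) g0 ((t, 0), x)"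
    interpret D: linear ?D
      using has_derivative_slice_param[OF smooth_on_differentiable[OF g0, of "((t, 0), x)"]] tP
      by (intro has_derivative_linear) auto
    have "?D (1/2, -1) = 0" using g0_stationary[OF tJ] by (simp add: stationary_def)
    moreover have "?D (1/2, -1) = (1/2) *\<^sub>R ?D (1, 0) - ?D (0, 1)"
      using D.diff[of "(1/2) *\<^sub>R (1, 0)" "(0, 1)"] D.scale[of "1/2" "(1, 0)"] by simp
    ultimately have D01: "?D (0, 1) = (1/2) *\<^sub>R ?D (1, 0)" by simp
    have \<beta>': "((\<lambda>r. \<beta> (t + r, x)) has_vector_derivative dir_deriv (1, 0) \<beta> (t, x)) (at 0)"
      using slice_has_vector_derivative[OF \<beta>, of t 0 1 x UNIV] tJ by simp
    have "((\<lambda>r. g0 ((t + r, 0), x)) has_vector_derivative ?D (1, 0)) (at 0)"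
      using slice_has_vector_derivative[OF g0, of "(t, 0)" 0 "(1, 0)" x UNIV] tP by simp
    with \<beta>' have D10: "?D (1, 0) = dir_deriv (1, 0) \<beta> (t, x)"
      unfolding g0_0 by (rule vector_derivative_unique_at[symmetric])
    have "((\<lambda>r. g0 ((t, r), x)) has_vector_derivative ?D (0, 1)) (at 0)"
      using slice_has_vector_derivative[OF g0, of "(t, 0)" 0 "(0, 1)" x UNIV] tP by simp
    then have "((\<lambda>r. (1/2) *\<^sub>R (\<beta> (t, x) + \<beta> (t + r, x)) - g0 ((t, r), x)) has_vector_derivative
        ((1/2) *\<^sub>R (0 + dir_deriv (1, 0) \<beta> (t, x)) + 0 *\<^sub>R (\<beta> (t, x) + \<beta> (t + 0, x))) - ?D (0, 1)) (at 0)"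
      by (intro has_vector_derivative_diff has_vector_derivative_scaleR has_vector_derivative_add
          has_vector_derivative_const DERIV_const \<beta>')
    then have "((\<lambda>r. g ((t, r), x)) has_vector_derivative 0) (at 0)"
      by (simp add: g_def D01 D10)
    moreover have "((\<lambda>r. g ((t, r), x)) has_vector_derivative dir_deriv ((0, 1), 0) g ((t, 0), x)) (at 0)"
      using slice_has_vector_derivative[OF g, of "(t, 0)" 0 "(0, 1)" x UNIV] tP by simp
    ultimately show "dir_deriv ((0, 1), 0) g ((t, 0), x) = 0"
      using vector_derivative_unique_at by blast
  qed
  have "derivs_bounded {\<lambda>x. (1 / s\<^sup>2) *\<^sub>R g ((t, s), x) | t s. 0 < s \<and> s \<le> t \<and> t + s \<le> T}"
    unfolding derivs_bounded_def
  proof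
    fix vs
    have "\<exists>M. \<forall>t s x. (t, s) \<in> K \<longrightarrow> norm (foldr dir_deriv vs (\<lambda>x. g ((t, s), x)) x) \<le> M * s\<^sup>2"
    proof (rule second_order_family_bound[OF ab openP g \<open>compact K\<close> KP])
      show "(t, s) \<in> K \<Longrightarrow> r \<in> {0..s} \<Longrightarrow> (t, r) \<in> K" for t s r by (auto simp: K_def)
      show "(t, s) \<in> K \<Longrightarrow> 0 \<le> s" for t s by (auto simp: K_def)
      show "p \<in> K \<Longrightarrow> periodic a b (\<lambda>x. g (p, x))" for p
        using VD(2)[OF gV, of "fst p" "snd p"] by simp
      show "g ((t, 0), x) = 0" for t x
        by (simp add: g_def g0_0 scaleR_add_left[symmetric] scaleR_add_right)
    qed (rule stat)
    then obtain M where M: "\<And>t s x. (t, s) \<in> K \<Longrightarrow> norm (foldr dir_deriv vs (\<lambda>x. g ((t, s), x)) x) \<le> M * s\<^sup>2"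
      by blast
    have "norm (foldr dir_deriv vs (\<lambda>x. (1 / s\<^sup>2) *\<^sub>R g ((t, s), x)) x) \<le> M"
      if "0 < s" "s \<le> t" "t + s \<le> T" for t s x
    proof -
      have ts: "(t, s) \<in> K" using that by (simp add: K_def)
      have "foldr dir_deriv vs (\<lambda>x. (1 / s\<^sup>2) *\<^sub>R g ((t, s), x)) x =
          (1 / s\<^sup>2) *\<^sub>R foldr dir_deriv vs (\<lambda>x. g ((t, s), x)) x"
        by (rule foldr_dir_deriv_linear[OF open_UNIV VD(1)[OF gV[OF ts]] bounded_linear_scaleR_right UNIV_I])
      then show ?thesis using M[OF ts, of x] that(1) by (simp add: pos_divide_le_eq)
    qed
    then show "\<exists>M. \<forall>f\<in>{\<lambda>x. (1 / s\<^sup>2) *\<^sub>R g ((t, s), x) | t s. 0 < s \<and> s \<le> t \<and> t + s \<le> T}.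
        \<forall>x. norm (foldr dir_deriv vs f x) \<le> M"
      by blast
  qed
  also have "{\<lambda>x. (1 / s\<^sup>2) *\<^sub>R g ((t, s), x) | t s. 0 < s \<and> s \<le> t \<and> t + s \<le> T} =
      {\<lambda>x. (1 / s\<^sup>2) *\<^sub>R ((1/2) *\<^sub>R (\<beta> (t, x) + \<beta> (t + s, x))
        - esav_Bbar a b N N' (z (t - s)) (z t) (e (t - s)) (e t) x) | t s. 0 < s \<and> s \<le> t \<and> t + s \<le> T}"
  proof -
    have "(\<lambda>x. (1 / s\<^sup>2) *\<^sub>R g ((t, s), x)) = (\<lambda>x. (1 / s\<^sup>2) *\<^sub>R ((1/2) *\<^sub>R (\<beta> (t, x) + \<beta> (t + s, x))
        - esav_Bbar a b N N' (z (t - s)) (z t) (e (t - s)) (e t) x))"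
      if "0 < s" "s \<le> t" "t + s \<le> T" for t s
      using Bbar[of t s] that by (simp add: g_def K_def)
    then show ?thesis by (intro Collect_cong) (metis (no_types, lifting))
  qed
  finally show ?thesis using \<beta> B by blast
qed

lemma smooth_on_has_vector_derivative:
  fixes f :: "real \<Rightarrow> 'b::real_normed_vector"
  assumes "smooth_on J f" "r \<in> J"
  shows "(f has_vector_derivative dir_deriv 1 f r) (at r within S)"
proof -
  have f: "(f has_derivative (\<lambda>h. dir_deriv h f r)) (at r)"
    by (intro has_derivative_dir_deriv smooth_on_differentiable[OF assms])
  interpret linear "\<lambda>h. dir_deriv h f r" using f by (rule has_derivative_linear)
  have "dir_deriv h f r = h *\<^sub>R dir_deriv 1 f r" for h using scale[of h 1] by simp
  then have "(\<lambda>h. dir_deriv h f r) = (\<lambda>h. h *\<^sub>R dir_deriv 1 f r)" by (rule ext)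
  then show ?thesis
    using has_derivative_at_withinI[OF f, of S] unfolding has_vector_derivative_def by metis
qed

text \<open>
  The product of two averages differs from the average of the products by a product of differences,
  \<open>(p \<bullet> u + q \<bullet> u') / 2 - ((p + q) / 2) \<bullet> ((u + u') / 2) = (q - p) \<bullet> (u' - u) / 4\<close>,
  which is of second order when both differences are of first order.
\<close>

lemma inner_trapezoid_bound:
  fixes p q u u' d \<Delta> :: "'a::real_inner"
  assumes "norm p \<le> A" "norm q \<le> A" "norm (q - p) \<le> A' * s" "norm (u' - u) \<le> U' * s"
    and "norm (\<Delta> - (s/2) *\<^sub>R (u + u')) \<le> R * s ^ 3" "norm d \<le> d0 * s\<^sup>2" "norm \<Delta> \<le> U * s"
    and "0 \<le> A'" "0 \<le> U'" "0 \<le> s"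
  shows "\<bar>((1/2) *\<^sub>R (p + q) - d) \<bullet> \<Delta> - (s/2) * (p \<bullet> u + q \<bullet> u')\<bar> \<le> (A' * U' + A * R + d0 * U) * s ^ 3"
proof -
  define r where "r = \<Delta> - (s/2) *\<^sub>R (u + u')"
  have \<Delta>: "\<Delta> = (s/2) *\<^sub>R (u + u') + r" by (simp add: r_def)
  have "((1/2) *\<^sub>R (p + q) - d) \<bullet> \<Delta> = ((1/2) *\<^sub>R (p + q)) \<bullet> \<Delta> - d \<bullet> \<Delta>" by (simp add: inner_diff_left)
  also have "((1/2) *\<^sub>R (p + q)) \<bullet> \<Delta> = ((1/2) *\<^sub>R (p + q)) \<bullet> ((s/2) *\<^sub>R (u + u')) + ((1/2) *\<^sub>R (p + q)) \<bullet> r"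
    unfolding \<Delta> by (rule inner_add_right)
  also have "((1/2) *\<^sub>R (p + q)) \<bullet> ((s/2) *\<^sub>R (u + u')) = (s/2) * (p \<bullet> u + q \<bullet> u') - (s/4) * ((q - p) \<bullet> (u' - u))"
    by (simp add: inner_diff_left inner_diff_right inner_add_left inner_add_right field_simps)
  finally have eq: "((1/2) *\<^sub>R (p + q) - d) \<bullet> \<Delta> - (s/2) * (p \<bullet> u + q \<bullet> u') =
      - (s/4) * ((q - p) \<bullet> (u' - u)) + ((1/2) *\<^sub>R (p + q)) \<bullet> r - d \<bullet> \<Delta>" by simp
  have ip: "\<bar>v \<bullet> w\<bar> \<le> M * M'" if "norm v \<le> M" "norm w \<le> M'" for v w :: 'a and M M'
  proof -
    have "0 \<le> M" using that(1) norm_ge_zero[of v] by linarith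
    then show ?thesis
      using Cauchy_Schwarz_ineq2[of v w] mult_mono[OF that(1,2) _ norm_ge_zero] by linarith
  qed
  have "\<bar>(q - p) \<bullet> (u' - u)\<bar> \<le> (A' * s) * (U' * s)" by (rule ip[OF assms(3,4)])
  then have "\<bar>- (s/4) * ((q - p) \<bullet> (u' - u))\<bar> \<le> (s/4) * ((A' * s) * (U' * s))"
    using assms(10) by (simp add: abs_mult mult_left_mono)
  also have "\<dots> \<le> s * ((A' * s) * (U' * s))"
    using assms(8-10) by (intro mult_right_mono) auto
  finally have 1: "\<bar>- (s/4) * ((q - p) \<bullet> (u' - u))\<bar> \<le> A' * U' * s ^ 3"
    by (simp add: power3_eq_cube ac_simps)
  have "norm ((1/2) *\<^sub>R (p + q)) \<le> A"
    using norm_triangle_ineq[of p q] assms(1,2) by simp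
  then have 2: "\<bar>((1/2) *\<^sub>R (p + q)) \<bullet> r\<bar> \<le> A * (R * s ^ 3)"
    by (rule ip) (use assms(5) in \<open>simp add: r_def\<close>)
  have "\<bar>d \<bullet> \<Delta>\<bar> \<le> (d0 * s\<^sup>2) * (U * s)" by (rule ip[OF assms(6,7)])
  then have 3: "\<bar>d \<bullet> \<Delta>\<bar> \<le> d0 * U * s ^ 3"
    by (simp add: power3_eq_cube power2_eq_square ac_simps)
  have "A' * U' * s ^ 3 + A * (R * s ^ 3) + d0 * U * s ^ 3 = (A' * U' + A * R + d0 * U) * s ^ 3"
    by (simp add: algebra_simps)
  then show ?thesis unfolding eq using 1 2 3 by linarith
qed

text \<open>
  Here \<open>v\<close> is the time derivative of \<open>z\<close>, \<open>\<gamma> = (B, z\<^sub>t)\<close> is the derivative of \<open>ln e\<close>, \<open>\<delta>\<close> is the extrapolation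
  defect and \<open>q\<close> the trapezoidal error of \<open>z\<close> divided by the step. The first residual is \<open>q + D \<delta>\<close>. The
  smoothness of \<open>\<gamma>\<close> is read off from the parameter integral that defines it, so \<open>ln e\<close> needs no
  differentiation beyond the equation that it satisfies.
\<close>

lemma residual_bounds:
  fixes z :: "real \<Rightarrow> real^'d \<Rightarrow> real^'m" and F :: "real^'k \<Rightarrow> real"
  assumes ab: "\<And>i. a $ i < b $ i" and F: "smooth_on UNIV F"
    and D: "linear_op_on (V a b) D" "skew_adjoint a b D" and L: "linear_op_on (V a b) L"
    and N: "\<And>z. z \<in> V a b \<Longrightarrow> N z = energy_density F \<alpha> c z"
    and N': "variational_derivative a b (H2 a b N) N'"
    and T: "T > 0" and sol: "smooth_solution a b D L N N' T z e"
  shows "\<exists>C. \<forall>t s. 0 < s \<and> s \<le> t \<and> t + s \<le> T \<longrightarrow>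
    L2_norm a b (residual_z a b D L N N' s (z (t - s)) (z t) (z (t + s)) (e (t - s)) (e t)) \<le> C * s\<^sup>2 \<and>
    \<bar>residual_e a b N N' s (z (t - s)) (z t) (z (t + s)) (e (t - s)) (e t) (e (t + s))\<bar> \<le> C * s\<^sup>2"
proof -
  obtain J where J: "open J" "{0..T} \<subseteq> J" and zJ: "smooth_on (J \<times> UNIV) (\<lambda>(t, x). z t x)"
    and eJ: "smooth_on J e"
    using sol unfolding smooth_solution_def by blast
  have zV: "z t \<in> V a b" if "t \<in> {0..T}" for t
    using sol that unfolding smooth_solution_def by blast
  have ode: "(\<lambda>x. vector_derivative (\<lambda>s. z s x) (at t within {0..T})) =
      D (\<lambda>x. L (z t) x + esav_B a b N N' (z t) (e t) x)"
    and ode_ln: "((\<lambda>s. ln (e s)) has_real_derivative L2_inner a b (esav_B a b N N' (z t) (e t))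
      (\<lambda>x. vector_derivative (\<lambda>s. z s x) (at t within {0..T}))) (at t within {0..T})"
    if "t \<in> {0..T}" for t
    using sol that unfolding smooth_solution_def Let_def by blast+
  obtain \<beta> where \<beta>: "smooth_on (J \<times> UNIV) \<beta>"
    and B: "\<And>t. t \<in> {0..T} \<Longrightarrow> esav_B a b N N' (z t) (e t) = (\<lambda>x. \<beta> (t, x))"
    and W0: "derivs_bounded {\<lambda>x. (1 / s\<^sup>2) *\<^sub>R ((1/2) *\<^sub>R (\<beta> (t, x) + \<beta> (t + s, x))
        - esav_Bbar a b N N' (z (t - s)) (z t) (e (t - s)) (e t) x) | t s. 0 < s \<and> s \<le> t \<and> t + s \<le> T}"
    using extrapolation_defect[OF ab F N N' J zJ eJ zV] by blast
  have \<beta>V: "(\<lambda>x. \<beta> (t, x)) \<in> V a b" if "t \<in> {0..T}" for t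
    using esav_B_V[OF N' zV[OF that], of "e t"] B[OF that] by simp
  define zz where "zz w = z (fst w) (snd w)" for w
  have "(\<lambda>(t, x). z t x) = zz" by (auto simp: zz_def)
  then have zz: "smooth_on (J \<times> UNIV) zz" using zJ by simp
  define v where "v = dir_deriv (1, 0) zz"
  have v: "smooth_on (J \<times> UNIV) v" unfolding v_def by (rule smooth_on_dir_deriv[OF zz])
  have path: "((\<lambda>r. g (r, x)) has_vector_derivative dir_deriv (1, 0) g (t, x)) (at t within S)"
    if "smooth_on (J \<times> UNIV) g" "t \<in> J" for g :: "real \<times> (real^'d) \<Rightarrow> real^'m" and t x S
    using slice_has_vector_derivative[OF that(1), of 0 t 1 x S] that(2) by simp
  have zpath: "((\<lambda>r. z r x) has_vector_derivative v (t, x)) (at t within S)" if "t \<in> J" for t x S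
    using path[OF zz that, of x S] by (simp add: zz_def v_def)
  have velocity: "(\<lambda>x. vector_derivative (\<lambda>s. z s x) (at t within {0..T})) = (\<lambda>x. v (t, x))"
    if "t \<in> {0..T}" for t
  proof
    fix x
    show "vector_derivative (\<lambda>s. z s x) (at t within {0..T}) = v (t, x)"
      using vector_derivative_within_cbox[of 0 T t "\<lambda>s. z s x" "v (t, x)"] T that zpath[of t x "{0..T}"] J(2)
      by (simp add: subset_iff)
  qed
  define \<mu> where "\<mu> t = (\<lambda>x. L (z t) x + \<beta> (t, x))" for t
  have \<mu>V: "\<mu> t \<in> V a b" if "t \<in> {0..T}" for t
    unfolding \<mu>_def by (intro V_add linear_op_onD(1)[OF L] zV \<beta>V that)
  have vD: "(\<lambda>x. v (t, x)) = D (\<mu> t)" if "t \<in> {0..T}" for t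
    using ode[OF that] unfolding velocity[OF that] B[OF that] \<mu>_def .
  have vV: "(\<lambda>x. v (t, x)) \<in> V a b" if "t \<in> {0..T}" for t
    unfolding vD[OF that] by (rule linear_op_onD(1)[OF D(1) \<mu>V[OF that]])
  define \<gamma> where "\<gamma> t = integral (cbox a b) (\<lambda>x. \<beta> (t, x) \<bullet> v (t, x))" for t
  have \<gamma>: "smooth_on J \<gamma>"
    using smooth_on_integral_param[OF J(1) smooth_on_inner[OF _ \<beta> v]] J(1)
    by (simp add: \<gamma>_def[abs_def] open_Times)
  have lne: "((\<lambda>s. ln (e s)) has_vector_derivative \<gamma> t) (at t within {0..T})" if "t \<in> {0..T}" for t
  proof -
    have "((\<lambda>s. ln (e s)) has_real_derivative L2_inner a b (\<lambda>x. \<beta> (t, x)) (\<lambda>x. v (t, x))) (at t within {0..T})"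
      using ode_ln[OF that] unfolding velocity[OF that] B[OF that] .
    then show ?thesis
      by (simp add: has_real_derivative_iff_has_vector_derivative \<gamma>_def L2_inner_def)
  qed
  obtain A where A: "A \<ge> 0" "\<And>t x. t \<in> {0..T} \<Longrightarrow> x \<in> cbox a b \<Longrightarrow> norm (\<beta> (t, x)) \<le> A"
    using smooth_on_compact_bound[OF \<beta> compact_Icc J(2)] by metis
  obtain A' where A': "A' \<ge> 0" "\<And>t x. t \<in> {0..T} \<Longrightarrow> x \<in> cbox a b \<Longrightarrow> norm (dir_deriv (1, 0) \<beta> (t, x)) \<le> A'"
    using smooth_on_compact_bound[OF smooth_on_dir_deriv[OF \<beta>] compact_Icc J(2)] by metis
  obtain U where U: "U \<ge> 0" "\<And>t x. t \<in> {0..T} \<Longrightarrow> x \<in> cbox a b \<Longrightarrow> norm (v (t, x)) \<le> U"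
    using smooth_on_compact_bound[OF v compact_Icc J(2)] by metis
  note v' = smooth_on_dir_deriv[OF v, of "(1, 0)"]
  note v'' = smooth_on_dir_deriv[OF v', of "(1, 0)"]
  obtain U' where U': "U' \<ge> 0" "\<And>t x. t \<in> {0..T} \<Longrightarrow> x \<in> cbox a b \<Longrightarrow> norm (dir_deriv (1, 0) v (t, x)) \<le> U'"
    using smooth_on_compact_bound[OF v' compact_Icc J(2)] by metis
  obtain R where R: "R \<ge> 0" "\<And>t x. t \<in> {0..T} \<Longrightarrow> x \<in> cbox a b \<Longrightarrow>
      norm (dir_deriv (1, 0) (dir_deriv (1, 0) v) (t, x)) \<le> R"
    using smooth_on_compact_bound[OF v'' compact_Icc J(2)] by metis
  note \<gamma>' = smooth_on_dir_deriv[OF \<gamma>, of 1]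
  note \<gamma>'' = smooth_on_dir_deriv[OF \<gamma>', of 1]
  obtain G where G: "\<And>t. t \<in> {0..T} \<Longrightarrow> norm (dir_deriv 1 (dir_deriv 1 \<gamma>) t) \<le> G"
  proof -
    have "compact (dir_deriv 1 (dir_deriv 1 \<gamma>) ` {0..T})"
      by (intro compact_continuous_image smooth_on_continuous_on[OF \<gamma>'' J(2)] compact_Icc)
    then show ?thesis using that compact_imp_bounded bounded_iff by (metis imageI)
  qed
  define W where "W = {\<lambda>x. (1 / s\<^sup>2) *\<^sub>R ((1/2) *\<^sub>R (\<beta> (t, x) + \<beta> (t + s, x))
        - esav_Bbar a b N N' (z (t - s)) (z t) (e (t - s)) (e t) x) | t s. 0 < s \<and> s \<le> t \<and> t + s \<le> T}"
  have W: "derivs_bounded W" unfolding W_def by (rule W0)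
  have WV: "W \<subseteq> V a b"
  proof
    fix f assume "f \<in> W"
    then obtain t s where s: "0 < s" "s \<le> t" "t + s \<le> T" and f: "f = (\<lambda>x. (1 / s\<^sup>2) *\<^sub>R
        ((1/2) *\<^sub>R (\<beta> (t, x) + \<beta> (t + s, x)) - esav_Bbar a b N N' (z (t - s)) (z t) (e (t - s)) (e t) x))"
      unfolding W_def by blast
    show "f \<in> V a b"
      unfolding f using s by (intro V_scaleR V_diff V_add \<beta>V esav_Bbar_V[OF N'] zV) auto
  qed
  obtain d0 where d0: "\<And>f x. f \<in> W \<Longrightarrow> norm (f x) \<le> d0"
  proof -
    have "\<exists>M. \<forall>f\<in>W. \<forall>x. norm (foldr dir_deriv [] f x) \<le> M"
      using W unfolding derivs_bounded_def by blast
    then show ?thesis using that by auto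
  qed
  obtain C1 where C1: "\<And>f. f \<in> W \<Longrightarrow> L2_norm a b (D f) \<le> C1"
  proof -
    have "\<exists>C. \<forall>f\<in>W. L2_norm a b (D f) \<le> C"
    proof (rule operator_with_adjoint_bounded[OF D(1) _ _ WV W, of "\<lambda>g x. (-1) *\<^sub>R D g x"])
      show "(\<lambda>x. (-1) *\<^sub>R D g x) \<in> V a b" if "g \<in> V a b" for g
        by (rule V_scaleR[OF linear_op_onD(1)[OF D(1) that]])
      show "L2_inner a b (D f) g = L2_inner a b f (\<lambda>x. (-1) *\<^sub>R D g x)" if "f \<in> V a b" "g \<in> V a b" for f g
        using D(2) that unfolding skew_adjoint_def L2_inner_scaleR_right by simp
    qed
    then show ?thesis using that by blast
  qed
  define vol where "vol = measure lborel (cbox a b)"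
  have vol: "vol \<ge> 0" by (simp add: vol_def)
  define K where "K = A' * U' + A * R + d0 * U"
  have "L2_norm a b (residual_z a b D L N N' s (z (t - s)) (z t) (z (t + s)) (e (t - s)) (e t))
      \<le> (R * sqrt vol + C1) * s\<^sup>2 \<and>
      \<bar>residual_e a b N N' s (z (t - s)) (z t) (z (t + s)) (e (t - s)) (e t) (e (t + s))\<bar> \<le> (G + K * vol) * s\<^sup>2"
    if s: "0 < s" "s \<le> t" "t + s \<le> T" for t s
  proof
    have times: "t \<in> {0..T}" "t - s \<in> {0..T}" "t + s \<in> {0..T}" and sub: "{t..t + s} \<subseteq> {0..T}"
      using s by auto
    have inJ: "r \<in> J" if "r \<in> {t..t + s}" for r using that sub J(2) by blast
    let ?Bb = "esav_Bbar a b N N' (z (t - s)) (z t) (e (t - s)) (e t)"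
    let ?r = "residual_z a b D L N N' s (z (t - s)) (z t) (z (t + s)) (e (t - s)) (e t)"
    have BbV: "?Bb \<in> V a b" by (intro esav_Bbar_V[OF N'] zV times)
    define \<delta> where "\<delta> x = (1/2) *\<^sub>R (\<beta> (t, x) + \<beta> (t + s, x)) - ?Bb x" for x
    define w where "w x = (1 / s\<^sup>2) *\<^sub>R \<delta> x" for x
    have wW: "w \<in> W" unfolding W_def w_def[abs_def] \<delta>_def using s by blast
    have wV: "w \<in> V a b" using wW WV by blast
    have \<delta>w: "\<delta> = (\<lambda>x. s\<^sup>2 *\<^sub>R w x)" using s by (simp add: w_def fun_eq_iff)
    have \<delta>V: "\<delta> \<in> V a b" unfolding \<delta>w by (rule V_scaleR[OF wV])
    have D\<delta>: "L2_norm a b (D \<delta>) \<le> C1 * s\<^sup>2"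
      using C1[OF wW] linear_op_onD(3)[OF D(1) wV, of "s\<^sup>2"] s
      by (simp add: \<delta>w L2_norm_scaleR mult.commute[of C1] mult_left_mono)
    define q where "q x = (1/s) *\<^sub>R (z (t + s) x - z t x) - (1/2) *\<^sub>R (v (t, x) + v (t + s, x))" for x
    have trapez: "norm (z (t + s) x - z t x - (s/2) *\<^sub>R (v (t, x) + v (t + s, x))) \<le> R * s ^ 3"
      if "x \<in> cbox a b" for x
    proof (rule trapezoidal_rule_bound[where h = "\<lambda>r. z r x" and h' = "\<lambda>r. v (r, x)"
          and h'' = "\<lambda>r. dir_deriv (1, 0) v (r, x)" and h''' = "\<lambda>r. dir_deriv (1, 0) (dir_deriv (1, 0) v) (r, x)"])
      show "norm (dir_deriv (1, 0) (dir_deriv (1, 0) v) (r, x)) \<le> R" if "r \<in> {t..t + s}" for r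
        using R(2)[OF _ \<open>x \<in> cbox a b\<close>] that sub by blast
    qed (use s in \<open>auto intro!: zpath path v v' inJ\<close>)
    have qV: "q \<in> V a b"
      unfolding q_def[abs_def] by (intro V_diff V_scaleR V_add zV vV times)
    have q: "norm (q x) \<le> R * s\<^sup>2" if "x \<in> cbox a b" for x
    proof -
      have "q x = (1/s) *\<^sub>R (z (t + s) x - z t x - (s/2) *\<^sub>R (v (t, x) + v (t + s, x)))"
        using s by (simp add: q_def scaleR_diff_right)
      then have "norm (q x) \<le> (1/s) * (R * s ^ 3)"
        using trapez[OF that] s by (simp add: divide_right_mono)
      then show ?thesis using s by (simp add: power3_eq_cube power2_eq_square)
    qed
    have Lh: "L (\<lambda>y. (1/2) *\<^sub>R (z t y + z (t + s) y)) = (\<lambda>x. (1/2) *\<^sub>R (L (z t) x + L (z (t + s)) x))"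
      using linear_op_onD(3)[OF L V_add[OF zV[OF times(1)] zV[OF times(3)]]]
        linear_op_onD(2)[OF L zV[OF times(1)] zV[OF times(3)]] by simp
    have mu: "esav_mu a b L N N' (z (t - s)) (z t) (z (t + s)) (e (t - s)) (e t) =
        (\<lambda>x. (1/2) *\<^sub>R (\<mu> t x + \<mu> (t + s) x) + (-1) *\<^sub>R \<delta> x)"
      unfolding esav_mu_def Lh by (simp add: \<mu>_def \<delta>_def algebra_simps)
    note \<mu>s = \<mu>V[OF times(1)] \<mu>V[OF times(3)]
    have "D (esav_mu a b L N N' (z (t - s)) (z t) (z (t + s)) (e (t - s)) (e t)) =
        (\<lambda>x. (1/2) *\<^sub>R (v (t, x) + v (t + s, x)) + (-1) *\<^sub>R D \<delta> x)"
      unfolding mu linear_op_onD(2)[OF D(1) V_scaleR[OF V_add[OF \<mu>s]] V_scaleR[OF \<delta>V]]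
        linear_op_onD(3)[OF D(1) \<delta>V] linear_op_onD(3)[OF D(1) V_add[OF \<mu>s]]
        linear_op_onD(2)[OF D(1) \<mu>s] vD[OF times(1), symmetric] vD[OF times(3), symmetric] ..
    then have "?r = (\<lambda>x. q x + D \<delta> x)"
      by (simp add: residual_z_def q_def fun_eq_iff)
    then have "L2_norm a b ?r \<le> L2_norm a b q + L2_norm a b (D \<delta>)"
      using L2_norm_triangle[OF V_continuous[OF qV] V_continuous[OF linear_op_onD(1)[OF D(1) \<delta>V]]] by simp
    moreover have "L2_norm a b q \<le> (R * s\<^sup>2) * sqrt vol"
      unfolding vol_def using R(1) by (intro L2_norm_bound V_continuous[OF qV] q) auto
    ultimately show "L2_norm a b ?r \<le> (R * sqrt vol + C1) * s\<^sup>2"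
      using D\<delta> by (simp add: algebra_simps)
    let ?\<Delta> = "\<lambda>x. z (t + s) x - z t x"
    have pointwise: "\<bar>?Bb x \<bullet> ?\<Delta> x - (s/2) * (\<beta> (t, x) \<bullet> v (t, x) + \<beta> (t + s, x) \<bullet> v (t + s, x))\<bar> \<le> K * s ^ 3"
      if x: "x \<in> cbox a b" for x
    proof -
      have mv: "norm (h (t + s) - h t) \<le> M * s"
        if "\<And>r. r \<in> {t..t + s} \<Longrightarrow> (h has_vector_derivative h' r) (at r within {t..t + s})"
          "\<And>r. r \<in> {0..T} \<Longrightarrow> norm (h' r) \<le> M" for h h' :: "real \<Rightarrow> real^'m" and M
        using vector_mean_value_bound[OF that(1), of M] that(2) sub s by (auto simp: subset_iff)
      have Bb: "?Bb x = (1/2) *\<^sub>R (\<beta> (t, x) + \<beta> (t + s, x)) - \<delta> x" by (simp add: \<delta>_def)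
      show ?thesis
        unfolding Bb K_def
      proof (rule inner_trapezoid_bound[OF A(2)[OF times(1) x] A(2)[OF times(3) x] _ _ trapez[OF x] _ _ A'(1) U'(1)])
        show "norm (\<beta> (t + s, x) - \<beta> (t, x)) \<le> A' * s"
          by (rule mv[OF path[OF \<beta> inJ] A'(2)[OF _ x]])
        show "norm (v (t + s, x) - v (t, x)) \<le> U' * s"
          by (rule mv[OF path[OF v inJ] U'(2)[OF _ x]])
        show "norm (?\<Delta> x) \<le> U * s"
          by (rule mv[OF zpath[OF inJ] U(2)[OF _ x]])
        show "norm (\<delta> x) \<le> d0 * s\<^sup>2"
          using d0[OF wW, of x] s by (simp add: \<delta>w mult.commute[of d0] mult_left_mono)
      qed (use s in auto)
    qed
    have int: "(\<lambda>x. f x \<bullet> g x) integrable_on cbox a b" if "f \<in> V a b" "g \<in> V a b" for f g :: "real^'d \<Rightarrow> real^'m"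
      using that by (intro L2_integrable V_continuous)
    let ?I = "\<lambda>x. ?Bb x \<bullet> ?\<Delta> x - (s/2) * (\<beta> (t, x) \<bullet> v (t, x) + \<beta> (t + s, x) \<bullet> v (t + s, x))"
    have I: "(?I has_integral (L2_inner a b ?Bb ?\<Delta> - (s/2) * (\<gamma> t + \<gamma> (t + s)))) (cbox a b)"
      unfolding L2_inner_def \<gamma>_def
      by (intro has_integral_diff has_integral_mult_right has_integral_add integrable_integral
          int BbV V_diff zV \<beta>V vV times)
    have "norm (integral (cbox a b) ?I) \<le> integral (cbox a b) (\<lambda>x. K * s ^ 3)"
      using pointwise by (intro integral_norm_bound_integral has_integral_integrable[OF I]) auto
    then have 1: "\<bar>L2_inner a b ?Bb ?\<Delta> - (s/2) * (\<gamma> t + \<gamma> (t + s))\<bar> \<le> (K * vol) * s ^ 3"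
      unfolding integral_unique[OF I] by (simp add: vol_def ac_simps)
    have 2: "\<bar>ln (e (t + s)) - ln (e t) - (s/2) * (\<gamma> t + \<gamma> (t + s))\<bar> \<le> G * s ^ 3"
    proof -
      have "norm (ln (e (t + s)) - ln (e t) - (s/2) *\<^sub>R (\<gamma> t + \<gamma> (t + s))) \<le> G * s ^ 3"
      proof (rule trapezoidal_rule_bound[where h = "\<lambda>r. ln (e r)" and h'' = "dir_deriv 1 \<gamma>"
            and h''' = "dir_deriv 1 (dir_deriv 1 \<gamma>)"])
        show "((\<lambda>r. ln (e r)) has_vector_derivative \<gamma> r) (at r within {t..t + s})" if "r \<in> {t..t + s}" for r
          using lne[of r] that sub has_vector_derivative_within_subset by blast
      qed (use s sub G in \<open>auto intro!: smooth_on_has_vector_derivative[OF \<gamma>] smooth_on_has_vector_derivative[OF \<gamma>'] inJ\<close>)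
      then show ?thesis by simp
    qed
    have "residual_e a b N N' s (z (t - s)) (z t) (z (t + s)) (e (t - s)) (e t) (e (t + s)) =
        ((ln (e (t + s)) - ln (e t) - (s/2) * (\<gamma> t + \<gamma> (t + s))) -
         (L2_inner a b ?Bb ?\<Delta> - (s/2) * (\<gamma> t + \<gamma> (t + s)))) / s"
      by (simp add: residual_e_def)
    also have "\<bar>\<dots>\<bar> \<le> (G * s ^ 3 + (K * vol) * s ^ 3) / s"
      unfolding abs_divide using 1 2 s by (simp add: divide_right_mono)
    also have "\<dots> = (G + K * vol) * s\<^sup>2"
      using s by (simp add: field_simps power3_eq_cube power2_eq_square)
    finally show "\<bar>residual_e a b N N' s (z (t - s)) (z t) (z (t + s)) (e (t - s)) (e t) (e (t + s))\<bar>
        \<le> (G + K * vol) * s\<^sup>2" .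
  qed
  note bounds = this
  define C where "C = max (R * sqrt vol + C1) (G + K * vol)"
  have "(R * sqrt vol + C1) * s\<^sup>2 \<le> C * s\<^sup>2" "(G + K * vol) * s\<^sup>2 \<le> C * s\<^sup>2" for s
    by (auto simp: C_def intro!: mult_right_mono)
  then show ?thesis using bounds by (meson order_trans)
qed

lemma second_order_consistent_esav:
  fixes F :: "real^'k \<Rightarrow> real" and a b :: "real^'d"
    and D L N' :: "(real^'d \<Rightarrow> real^'m) \<Rightarrow> (real^'d \<Rightarrow> real^'m)"
  assumes ab: "\<And>i. a $ i < b $ i" and F: "smooth_on UNIV F"
    and D: "linear_op_on (V a b) D" "skew_adjoint a b D" and L: "linear_op_on (V a b) L"
    and N: "\<And>z. z \<in> V a b \<Longrightarrow> N z = energy_density F \<alpha> c z"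
    and N': "variational_derivative a b (H2 a b N) N'"
  shows "second_order_consistent a b D L N N'"
  unfolding second_order_consistent_def
proof (intro allI impI)
  fix T :: real and z e assume T: "T > 0" and sol: "smooth_solution a b D L N N' T z e"
  obtain C where C: "\<And>t s. 0 < s \<Longrightarrow> s \<le> t \<Longrightarrow> t + s \<le> T \<Longrightarrow>
    L2_norm a b (residual_z a b D L N N' s (z (t - s)) (z t) (z (t + s)) (e (t - s)) (e t)) \<le> C * s\<^sup>2 \<and>
    \<bar>residual_e a b N N' s (z (t - s)) (z t) (z (t + s)) (e (t - s)) (e t) (e (t + s))\<bar> \<le> C * s\<^sup>2"
    using residual_bounds[OF ab F D L N N' T sol] by blast
  show "\<exists>C. \<exists>\<tau>\<^sub>0>0. \<forall>\<tau> n. 0 < \<tau> \<and> \<tau> < \<tau>\<^sub>0 \<and> 1 \<le> n \<and> real (n + 1) * \<tau> \<le> T \<longrightarrow>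
         (let t = (\<lambda>k::nat. real k * \<tau>) in
           L2_norm a b (residual_z a b D L N N' \<tau>
             (z (t (n - 1))) (z (t n)) (z (t (n + 1))) (e (t (n - 1))) (e (t n))) \<le> C * \<tau>^2 \<and>
           \<bar>residual_e a b N N' \<tau>
             (z (t (n - 1))) (z (t n)) (z (t (n + 1))) (e (t (n - 1))) (e (t n)) (e (t (n + 1)))\<bar>
               \<le> C * \<tau>^2)"
  proof (rule exI[of _ C], rule exI[of _ 1], intro conjI allI impI)
    fix \<tau> :: real and n :: nat
    assume n: "0 < \<tau> \<and> \<tau> < 1 \<and> 1 \<le> n \<and> real (n + 1) * \<tau> \<le> T"
    have t: "real (n - 1) * \<tau> = real n * \<tau> - \<tau>" "real (n + 1) * \<tau> = real n * \<tau> + \<tau>"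
      using n by (auto simp: of_nat_diff algebra_simps)
    have "\<tau> \<le> real n * \<tau>" using n by simp
    then show "let t = (\<lambda>k::nat. real k * \<tau>) in
           L2_norm a b (residual_z a b D L N N' \<tau>
             (z (t (n - 1))) (z (t n)) (z (t (n + 1))) (e (t (n - 1))) (e (t n))) \<le> C * \<tau>^2 \<and>
           \<bar>residual_e a b N N' \<tau>
             (z (t (n - 1))) (z (t n)) (z (t (n + 1))) (e (t (n - 1))) (e (t n)) (e (t (n + 1)))\<bar>
               \<le> C * \<tau>^2"
      unfolding Let_def t using n t(2) by (intro C) auto
  qed simp
qed

section \<open>Linear implicitness and energy conservation\<close>

lemma skew_adjoint_self:
  assumes "skew_adjoint a b D" "u \<in> V a b"
  shows "L2_inner a b u (D u) = 0"
proof -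
  have "L2_inner a b (D u) u = - L2_inner a b u (D u)"
    using assms unfolding skew_adjoint_def by blast
  then show ?thesis using L2_inner_commute[of a b u "D u"] by simp
qed

text \<open>
  The quadratic \<open>r \<mapsto> (h + r L h, L (h + r L h))\<close> is nonnegative and has constant term \<open>0\<close>, so its linear
  coefficient \<open>2 (L h, L h)\<close> vanishes.
\<close>

lemma nonneg_op_null:
  fixes L :: "(real^'d \<Rightarrow> real^'m) \<Rightarrow> real^'d \<Rightarrow> real^'m"
  assumes ab: "\<And>i. a $ i < b $ i"
    and L: "linear_op_on (V a b) L" "symmetric_op a b L" "nonneg_op a b L"
    and h: "h \<in> V a b" and null: "L2_inner a b h (L h) = 0"
  shows "L h = (\<lambda>x. 0)"
proof (rule L2_inner_eq_0D[OF ab])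
  note LV = linear_op_onD(1)[OF L(1)]
  show g: "L h \<in> V a b" by (rule LV[OF h])
  let ?g = "L h"
  have "0 \<le> 0 + 2 * r * L2_inner a b ?g ?g + r\<^sup>2 * L2_inner a b ?g (L ?g)" for r
  proof -
    note rg = V_scaleR[OF g, of r]
    note s = V_add[OF h rg]
    have Ls: "L (\<lambda>x. h x + r *\<^sub>R ?g x) = (\<lambda>x. ?g x + r *\<^sub>R L ?g x)"
      using linear_op_onD(2)[OF L(1) h rg] linear_op_onD(3)[OF L(1) g, of r] by simp
    have sym: "L2_inner a b h (L ?g) = L2_inner a b ?g ?g"
      using L(2) h g unfolding symmetric_op_def by metis
    have "0 \<le> L2_inner a b (\<lambda>x. h x + r *\<^sub>R ?g x) (L (\<lambda>x. h x + r *\<^sub>R ?g x))"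
      using L(3) s unfolding nonneg_op_def by blast
    also have "\<dots> = L2_inner a b h ?g + r * L2_inner a b h (L ?g)
        + (r * L2_inner a b ?g ?g + r * (r * L2_inner a b ?g (L ?g)))"
      unfolding Ls
      by (simp add: L2_inner_add_left L2_inner_add_right L2_inner_scaleR_left L2_inner_scaleR_right
          V_continuous[OF h] V_continuous[OF g] V_continuous[OF LV[OF g]] V_continuous[OF rg]
          V_continuous[OF V_scaleR[OF LV[OF g]]] V_continuous[OF V_add[OF g V_scaleR[OF LV[OF g]]]] algebra_simps)
    finally show ?thesis unfolding null sym by (simp add: power2_eq_square algebra_simps)
  qed
  from nonneg_quadratic_discriminant[OF this] show "L2_inner a b ?g ?g = 0" by simp
qed

lemma linear_op_on_zero:
  assumes "linear_op_on (V a b) T"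
  shows "T (\<lambda>x. 0) = (\<lambda>x. 0)"
  using linear_op_onD(3)[OF assms V_zero, of 0] by simp

lemma linear_op_on_diff:
  assumes T: "linear_op_on (V a b) T" and f: "f \<in> V a b" and g: "g \<in> V a b"
  shows "T (\<lambda>x. f x - g x) = (\<lambda>x. T f x - T g x)"
  using linear_op_onD(2)[OF T f V_scaleR[OF g, of "-1"]] linear_op_onD(3)[OF T g, of "-1"] by simp

lemma linear_op_on_coeff_op:
  assumes D: "linear_op_on (V a b) D" and L: "linear_op_on (V a b) L"
  shows "linear_op_on (V a b) (coeff_op D L \<tau>)"
  unfolding linear_op_on_def coeff_op_def
proof (intro conjI ballI allI)
  fix f g :: "real^'a \<Rightarrow> real^'b" and r :: real
  assume f: "f \<in> V a b"
  note LV = linear_op_onD(1)[OF L]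
  show "(\<lambda>x. f x - (\<tau>/2) *\<^sub>R D (L f) x) \<in> V a b"
    by (intro V_diff V_scaleR f linear_op_onD(1)[OF D] LV)
  show "(\<lambda>x. r *\<^sub>R f x - (\<tau>/2) *\<^sub>R D (L (\<lambda>x. r *\<^sub>R f x)) x) =
      (\<lambda>x. r *\<^sub>R (f x - (\<tau>/2) *\<^sub>R D (L f) x))"
    unfolding linear_op_onD(3)[OF L f] linear_op_onD(3)[OF D LV[OF f]] by (simp add: algebra_simps)
  assume g: "g \<in> V a b"
  show "(\<lambda>x. f x + g x - (\<tau>/2) *\<^sub>R D (L (\<lambda>x. f x + g x)) x) =
      (\<lambda>x. f x - (\<tau>/2) *\<^sub>R D (L f) x + (g x - (\<tau>/2) *\<^sub>R D (L g) x))"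
    unfolding linear_op_onD(2)[OF L f g] linear_op_onD(2)[OF D LV[OF f] LV[OF g]]
    by (simp add: algebra_simps)
qed

text \<open>
  For \<open>h\<close> in the kernel, \<open>(h, L h) = (\<tau>/2) (D (L h), L h) = 0\<close> by skew-adjointness, hence \<open>L h = 0\<close> and
  \<open>h = (\<tau>/2) D 0 = 0\<close>.
\<close>

lemma inj_on_coeff_op:
  fixes D L :: "(real^'d \<Rightarrow> real^'m) \<Rightarrow> real^'d \<Rightarrow> real^'m"
  assumes ab: "\<And>i. a $ i < b $ i"
    and D: "linear_op_on (V a b) D" "skew_adjoint a b D"
    and L: "linear_op_on (V a b) L" "symmetric_op a b L" "nonneg_op a b L"
  shows "inj_on (coeff_op D L \<tau>) (V a b)"
proof (rule inj_onI)
  fix f g assume f: "f \<in> V a b" and g: "g \<in> V a b" and eq: "coeff_op D L \<tau> f = coeff_op D L \<tau> g"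
  define h where "h x = f x - g x" for x
  have h: "h \<in> V a b" unfolding h_def[abs_def] by (rule V_diff[OF f g])
  note LV = linear_op_onD(1)[OF L(1)]
  have "coeff_op D L \<tau> h = (\<lambda>x. coeff_op D L \<tau> f x - coeff_op D L \<tau> g x)"
    unfolding h_def[abs_def] by (rule linear_op_on_diff[OF linear_op_on_coeff_op[OF D(1) L(1)] f g])
  then have heq: "h = (\<lambda>x. (\<tau>/2) *\<^sub>R D (L h) x)"
    using eq by (simp add: coeff_op_def fun_eq_iff)
  have "L2_inner a b h (L h) = (\<tau>/2) * L2_inner a b (D (L h)) (L h)"
    using L2_inner_scaleR_left[of a b "\<tau>/2" "D (L h)" "L h"] heq by metis
  also have "\<dots> = 0"
    using skew_adjoint_self[OF D(2) LV[OF h]] L2_inner_commute[of a b "L h" "D (L h)"] by simp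
  finally have "L h = (\<lambda>x. 0)" by (rule nonneg_op_null[OF ab L h])
  then have "h = (\<lambda>x. 0)" using heq linear_op_on_zero[OF D(1)] by simp
  then show "f = g" by (simp add: h_def fun_eq_iff)
qed

lemma D_esav_mu:
  assumes D: "linear_op_on (V a b) D" and L: "linear_op_on (V a b) L"
    and N': "variational_derivative a b (H2 a b N) N'"
    and V: "zp \<in> V a b" "zc \<in> V a b" "zn \<in> V a b"
  shows "esav_mu a b L N N' zp zc zn ep ec \<in> V a b"
    and "D (esav_mu a b L N N' zp zc zn ep ec) = (\<lambda>x. (1/2) *\<^sub>R (D (L zc) x + D (L zn) x)
      + D (esav_Bbar a b N N' zp zc ep ec) x)"
proof -
  note LV = linear_op_onD(1)[OF L]
  note B = esav_Bbar_V[OF N' V(1,2), of ep ec]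
  have mu: "esav_mu a b L N N' zp zc zn ep ec =
      (\<lambda>x. (1/2) *\<^sub>R (L zc x + L zn x) + esav_Bbar a b N N' zp zc ep ec x)"
    unfolding esav_mu_def linear_op_onD(3)[OF L V_add[OF V(2,3)]] linear_op_onD(2)[OF L V(2,3)] ..
  note s = V_add[OF LV[OF V(2)] LV[OF V(3)]]
  show "esav_mu a b L N N' zp zc zn ep ec \<in> V a b"
    unfolding mu by (intro V_add[OF V_scaleR[OF s] B])
  show "D (esav_mu a b L N N' zp zc zn ep ec) = (\<lambda>x. (1/2) *\<^sub>R (D (L zc) x + D (L zn) x)
      + D (esav_Bbar a b N N' zp zc ep ec) x)"
    unfolding mu linear_op_onD(2)[OF D V_scaleR[OF s] B] linear_op_onD(3)[OF D s]
      linear_op_onD(2)[OF D LV[OF V(2)] LV[OF V(3)]] ..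
qed

lemma scheme_vector_equation:
  fixes c n p q k :: "'a::real_vector"
  assumes "\<tau> > 0"
  shows "(1/\<tau>) *\<^sub>R (n - c) = (1/2) *\<^sub>R (p + q) + k \<longleftrightarrow> n - (\<tau>/2) *\<^sub>R q = c + (\<tau>/2) *\<^sub>R p + \<tau> *\<^sub>R k"
proof -
  have "(1/\<tau>) *\<^sub>R u = w \<longleftrightarrow> u = \<tau> *\<^sub>R w" for u w :: 'a
    using assms by auto
  then have "(1/\<tau>) *\<^sub>R (n - c) = (1/2) *\<^sub>R (p + q) + k \<longleftrightarrow> n - c = \<tau> *\<^sub>R ((1/2) *\<^sub>R (p + q) + k)" .
  also have "\<dots> \<longleftrightarrow> n - (\<tau>/2) *\<^sub>R q = c + (\<tau>/2) *\<^sub>R p + \<tau> *\<^sub>R k"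
    using assms by (auto simp: scaleR_add_right algebra_simps)
  finally show ?thesis .
qed

lemma linearly_implicit_esav:
  fixes D L N' :: "(real^'d \<Rightarrow> real^'m) \<Rightarrow> real^'d \<Rightarrow> real^'m"
  assumes ab: "\<And>i. a $ i < b $ i"
    and D: "linear_op_on (V a b) D" "skew_adjoint a b D"
    and L: "linear_op_on (V a b) L" "symmetric_op a b L" "nonneg_op a b L"
    and N': "variational_derivative a b (H2 a b N) N'"
  shows "linearly_implicit a b D L N N'"
  unfolding linearly_implicit_def Let_def
proof (intro allI impI conjI ballI linear_op_on_coeff_op D(1) L(1) inj_on_coeff_op ab D L)
  fix \<tau> :: real and zp zc :: "real^'d \<Rightarrow> real^'m" and ep ec :: real
  assume \<tau>: "0 < \<tau>" and z: "zp \<in> V a b" "zc \<in> V a b" and e: "0 < ep" "0 < ec"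
  let ?B = "esav_Bbar a b N N' zp zc ep ec"
  let ?r = "\<lambda>x. zc x + (\<tau>/2) *\<^sub>R D (L zc) x + \<tau> *\<^sub>R D ?B x"
  show "?r \<in> V a b"
    by (intro V_add V_scaleR z linear_op_onD(1)[OF D(1)] linear_op_onD(1)[OF L(1)] esav_Bbar_V[OF N'])
  fix zn en
  let ?X = "L2_inner a b ?B (\<lambda>x. zn x - zc x)"
  have "0 < en \<and> ln en - ln ec = ?X \<longleftrightarrow> en = ec * exp ?X"
  proof
    assume "0 < en \<and> ln en - ln ec = ?X"
    then have "ln en = ln ec + ?X" by simp
    then have "exp (ln en) = exp (ln ec) * exp ?X" by (simp add: exp_add)
    then show "en = ec * exp ?X" using \<open>0 < en \<and> _\<close> e by simp
  qed (use e in \<open>simp add: ln_mult\<close>)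
  moreover have "(\<lambda>x. (1/\<tau>) *\<^sub>R (zn x - zc x)) = D (esav_mu a b L N N' zp zc zn ep ec) \<longleftrightarrow> coeff_op D L \<tau> zn = ?r"
    if "zn \<in> V a b"
    unfolding D_esav_mu(2)[OF D(1) L(1) N' z that] coeff_op_def fun_eq_iff scheme_vector_equation[OF \<tau>] ..
  ultimately show "esav_cn a b D L N N' \<tau> zp zc zn ep ec en \<longleftrightarrow>
      zn \<in> V a b \<and> coeff_op D L \<tau> zn = ?r \<and> en = ec * exp ?X"
    unfolding esav_cn_def using z e by blast
qed

text \<open>
  Pairing the first equation of a step with \<open>\<mu>\<close> gives \<open>(\<mu>, z\<^sup>n\<^sup>+\<^sup>1 - z\<^sup>n) = 0\<close>. The linear part of \<open>\<mu>\<close> contributes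
  the increment of \<open>(z, L z) / 2\<close>, by symmetry of \<open>L\<close>, and the nonlinear part is the increment of \<open>ln e\<close> by the
  second equation.
\<close>

lemma energy_preserving_esav:
  fixes D L N' :: "(real^'d \<Rightarrow> real^'m) \<Rightarrow> real^'d \<Rightarrow> real^'m"
  assumes D: "linear_op_on (V a b) D" "skew_adjoint a b D"
    and L: "linear_op_on (V a b) L" "symmetric_op a b L"
    and N': "variational_derivative a b (H2 a b N) N'"
  shows "energy_preserving a b D L N N'"
proof -
  have "modified_energy a b L zn en = modified_energy a b L zc ec"
    if \<tau>: "\<tau> > 0" and step: "esav_cn a b D L N N' \<tau> zp zc zn ep ec en" for \<tau> zp zc zn ep ec en
  proof -
    have z: "zp \<in> V a b" "zc \<in> V a b" "zn \<in> V a b" using step unfolding esav_cn_def by auto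
    let ?B = "esav_Bbar a b N N' zp zc ep ec" and ?mu = "esav_mu a b L N N' zp zc zn ep ec"
    note LV = linear_op_onD(1)[OF L(1)]
    note BV = esav_Bbar_V[OF N' z(1,2), of ep ec]
    note muV = D_esav_mu(1)[OF D(1) L(1) N' z, of ep ec]
    note \<Delta>V = V_diff[OF z(3,2)]
    have eq: "(\<lambda>x. (1/\<tau>) *\<^sub>R (zn x - zc x)) = D ?mu"
      and ln: "ln en - ln ec = L2_inner a b ?B (\<lambda>x. zn x - zc x)"
      using step unfolding esav_cn_def by auto
    have "(1/\<tau>) * L2_inner a b ?mu (\<lambda>x. zn x - zc x) = L2_inner a b ?mu (D ?mu)"
      unfolding eq[symmetric] L2_inner_scaleR_right ..
    then have 0: "L2_inner a b ?mu (\<lambda>x. zn x - zc x) = 0"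
      using skew_adjoint_self[OF D(2) muV] \<tau> by simp
    have mu: "?mu = (\<lambda>x. (1/2) *\<^sub>R (L zc x + L zn x) + ?B x)"
      unfolding esav_mu_def linear_op_onD(3)[OF L(1) V_add[OF z(2,3)]] linear_op_onD(2)[OF L(1) z(2,3)] ..
    note LcV = LV[OF z(2)] and LnV = LV[OF z(3)]
    note cont = V_continuous[OF LcV] V_continuous[OF LnV] V_continuous[OF z(2)] V_continuous[OF z(3)]
      V_continuous[OF \<Delta>V] V_continuous[OF V_add[OF LcV LnV]] V_continuous[OF V_scaleR[OF V_add[OF LcV LnV]]]
      V_continuous[OF BV]
    have "L2_inner a b ?mu (\<lambda>x. zn x - zc x) =
        (1/2) * (L2_inner a b (L zc) zn - L2_inner a b (L zc) zc + (L2_inner a b (L zn) zn - L2_inner a b (L zn) zc))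
        + L2_inner a b ?B (\<lambda>x. zn x - zc x)"
      unfolding mu L2_inner_add_left[OF cont(7,8,5)] L2_inner_scaleR_left L2_inner_add_left[OF cont(1,2,5)]
        L2_inner_diff_right[OF cont(4,3,1)] L2_inner_diff_right[OF cont(4,3,2)] ..
    moreover have "L2_inner a b (L zc) zn = L2_inner a b (L zn) zc"
      using L(2) z L2_inner_commute[of a b "L zn" zc] unfolding symmetric_op_def by metis
    ultimately have "(1/2) * (L2_inner a b (L zn) zn - L2_inner a b (L zc) zc) + (ln en - ln ec) = 0"
      using 0 ln by simp
    then show ?thesis
      unfolding modified_energy_def L2_inner_commute[of a b _ "L _"] by (simp add: algebra_simps)
  qed
  then show ?thesis unfolding energy_preserving_def by blast
qed

theorem theorem2p1:
  fixes a b :: "real^'d"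
    and D L N' :: "(real^'d \<Rightarrow> real^'m) \<Rightarrow> (real^'d \<Rightarrow> real^'m)"
    and N :: "(real^'d \<Rightarrow> real^'m) \<Rightarrow> (real^'d \<Rightarrow> real)"
    and F :: "real^'k \<Rightarrow> real" and \<alpha> :: "'k \<Rightarrow> 'd list" and c :: "'k \<Rightarrow> 'm"
  assumes region: "\<And>i. a $ i < b $ i"
    and D: "linear_op_on (V a b) D" "skew_adjoint a b D"
    and L: "linear_op_on (V a b) L" "symmetric_op a b L" "nonneg_op a b L"
    and density: "smooth_on UNIV F" "\<And>z. z \<in> V a b \<Longrightarrow> N z = energy_density F \<alpha> c z"
    and derivative: "variational_derivative a b (H2 a b N) N'"
  shows "linearly_implicit a b D L N N' \<and>
         second_order_consistent a b D L N N' \<and>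
         energy_preserving a b D L N N'"
  using linearly_implicit_esav[OF region D L derivative]
    second_order_consistent_esav[OF region density(1) D L(1) density(2) derivative]
    energy_preserving_esav[OF D L(1,2) derivative]
  by blast

end
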